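(* Let $d\ge 1$, let $\kappa\in\mathbb{R}^{d+1}$ with $\kappa_i>-1$ for all $i$, and let $n\in\mathbb{N}_0$. For every $\nu\in\mathbb{N}_0^d$ with $|\nu|=n$ and all $x\in\mathbb{R}^d$, $$P_\nu^\kappa(x)=\sum_{\alpha\in\mathbb{N}_0^{d+1},\,|\alpha|=n}\frac{n!}{\alpha!}\,\mathsf{H}_\nu(\alpha;\kappa,n)\,R_\alpha^\kappa(x),$$ and, conversely, for every $\alpha\in\mathbb{N}_0^{d+1}$ with $|\alpha|=n$ and all $x\in\mathbb{R}^d$, $$R_\alpha^\kappa(x)=\frac{(\kappa+\mathbf 1)_\alpha}{(|\kappa|+d+1)_n}\sum_{\nu\in\mathbb{N}_0^d,\,|\nu|=n}\frac{\mathsf{H}_\nu(\alpha;\kappa,n)}{\mathsf{B}_\nu(\kappa,n)}\,P_\nu^\kappa(x).$$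
   Context: Notation: $(a)_k=a(a+1)\cdots(a+k-1)$; for vectors, $|\cdot|$ is the sum of the components (so $|\kappa|=\kappa_1+\cdots+\kappa_{d+1}$), $\alpha!=\prod_i\alpha_i!$, $\mathbf 1=(1,\ldots,1)$, $(\kappa+\mathbf 1)_\alpha=\prod_{i=1}^{d+1}(\kappa_i+1)_{\alpha_i}$. Jacobi inner product on the simplex $T^d=\{x\in\mathbb{R}^d: x_i\ge 0,\ |x|\le 1\}$: with $W_\kappa(x)=x_1^{\kappa_1}\cdots x_d^{\kappa_d}(1-|x|)^{\kappa_{d+1}}$, $\langle f,g\rangle_{W_\kappa}=c\int_{T^d}f(x)g(x)W_\kappa(x)\,dx$ with $c=\Gamma(|\kappa|+d+1)/\prod_{i=1}^{d+1}\Gamma(\kappa_i+1)$, so $\langle 1,1\rangle_{W_\kappa}=1$. $\mathcal{V}_n^d(W_\kappa)$ is the space of polynomials of degree at most $n$ in $d$ variables that are orthogonal to all polynomials of degree at most $n-1$. Jacobi polynomials on the simplex: for $\nu\in\mathbb{N}_0^d$, $$P_\nu^\kappa(x)=\prod_{j=1}^d(1-x_1-\cdots-x_{j-1})^{\nu_j}\,\frac{P_{\nu_j}^{(a_j,\kappa_j)}\left(\frac{2x_j}{1-x_1-\cdots-x_{j-1}}-1\right)}{P_{\nu_j}^{(a_j,\kappa_j)}(1)}$$ (a polynomial in $x$), where $a_j=\sum_{i=j+1}^{d+1}\kappa_i+2\sum_{i=j+1}^{d}\nu_i+d-j$ and $P_m^{(a,b)}(t)/P_m^{(a,b)}(1)={}_2F_1\left(-m,m+a+b+1;a+1;\frac{1-t}{2}\right)$.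 Monic polynomials: for $x\in\mathbb{R}^d$ put $X=(x_1,\ldots,x_d,1-|x|)$. For $\alpha\in\mathbb{N}_0^{d+1}$, $R_\alpha^\kappa$ is the unique element of $\mathcal{V}_{|\alpha|}^d(W_\kappa)$ of the form $X^\alpha+q(x)$ with $q$ a polynomial of degree at most $|\alpha|-1$. Hahn polynomials: for $\nu\in\mathbb{N}_0^d$ with $|\nu|\le N$, the values $\mathsf{H}_\nu(\alpha;\kappa,N)$, $\alpha\in\mathbb{N}_0^{d+1}$, $|\alpha|=N$, are defined by the identity of homogeneous polynomials of degree $N$ in $y=(y',y_{d+1})\in\mathbb{R}^{d+1}$ (with $|y|=y_1+\cdots+y_{d+1}$) $$|y|^N P_\nu^\kappa\left(\frac{y'}{|y|}\right)=\sum_{|\alpha|=N}\frac{N!}{\alpha!}\,\mathsf{H}_\nu(\alpha;\kappa,N)\,y^\alpha .$$ Their squared norm is $$\mathsf{B}_\nu(\kappa,N)=\frac{N!}{(|\kappa|+d+1)_N}\sum_{\alpha\in\mathbb{N}_0^{d+1},|\alpha|=N}\mathsf{H}_\nu(\alpha;\kappa,N)^2\,\frac{(\kappa+\mathbf 1)_\alpha}{\alpha!}.$$ *)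

theory Defs
  imports "HOL-Analysis.Analysis"
begin

text \<open>
  Vectors in dimension \<open>m\<close> are functions on \<open>nat\<close> of which only the values at \<open>1, \<dots>, m\<close> matter.
  Multi-indices are required to vanish outside \<open>{1..m}\<close>, so that there are only finitely
  many of each length and sums over them are honest finite sums.
\<close>

definition multi_index :: "nat \<Rightarrow> nat \<Rightarrow> (nat \<Rightarrow> nat) set" where
  "multi_index m n = {\<alpha>. (\<forall>i. i \<notin> {1..m} \<longrightarrow> \<alpha> i = 0) \<and> (\<Sum>i=1..m. \<alpha> i) = n}"

lemma finite_multi_index: "finite (multi_index m n)"
proof (rule finite_subset)
  show "multi_index m n \<subseteq> {\<alpha>. \<forall>i. (i \<in> {1..m} \<longrightarrow> \<alpha> i \<in> {0..n}) \<and> (i \<notin> {1..m} \<longrightarrow> \<alpha> i = 0)}"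
    by (force simp: multi_index_def intro: member_le_sum)
  show "finite {\<alpha>::nat \<Rightarrow> nat. \<forall>i. (i \<in> {1..m} \<longrightarrow> \<alpha> i \<in> {0..n}) \<and> (i \<notin> {1..m} \<longrightarrow> \<alpha> i = 0)}"
    by (rule finite_set_of_finite_funs) auto
qed

definition monomial :: "nat \<Rightarrow> (nat \<Rightarrow> real) \<Rightarrow> (nat \<Rightarrow> nat) \<Rightarrow> real" where
  "monomial m x \<alpha> = (\<Prod>i=1..m. x i ^ \<alpha> i)"

definition multi_fact :: "nat \<Rightarrow> (nat \<Rightarrow> nat) \<Rightarrow> real" where
  "multi_fact m \<alpha> = (\<Prod>i=1..m. fact (\<alpha> i))"

definition multi_pochhammer :: "nat \<Rightarrow> (nat \<Rightarrow> real) \<Rightarrow> (nat \<Rightarrow> nat) \<Rightarrow> real" where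
  "multi_pochhammer m a \<alpha> = (\<Prod>i=1..m. pochhammer (a i) (\<alpha> i))"

text \<open>
  Polynomial functions in \<open>x 1, \<dots>, x d\<close> of degree strictly less than \<open>n\<close>. The strict bound makes
  ``degree at most \<open>n - 1\<close>'' mean the zero polynomial when \<open>n = 0\<close>.
\<close>

definition polys_below :: "nat \<Rightarrow> nat \<Rightarrow> ((nat \<Rightarrow> real) \<Rightarrow> real) set" where
  "polys_below d n =
     {f. \<exists>c. \<forall>x. f x = (\<Sum>k<n. \<Sum>\<alpha>\<in>multi_index d k. c \<alpha> * monomial d x \<alpha>)}"

definition simplex_region :: "nat \<Rightarrow> (nat \<Rightarrow> real) set" where
  "simplex_region d = {x. (\<forall>i\<in>{1..d}. 0 \<le> x i) \<and> (\<Sum>i=1..d. x i) \<le> 1}"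

definition barycentric :: "nat \<Rightarrow> (nat \<Rightarrow> real) \<Rightarrow> nat \<Rightarrow> real" where
  "barycentric d x i = (if i = d + 1 then 1 - (\<Sum>j=1..d. x j) else x i)"

definition jacobi_weight :: "nat \<Rightarrow> (nat \<Rightarrow> real) \<Rightarrow> (nat \<Rightarrow> real) \<Rightarrow> real" where
  "jacobi_weight d \<kappa> x = (\<Prod>i=1..d. x i powr \<kappa> i) * (1 - (\<Sum>i=1..d. x i)) powr \<kappa> (d + 1)"

definition jacobi_inner ::
  "nat \<Rightarrow> (nat \<Rightarrow> real) \<Rightarrow> ((nat \<Rightarrow> real) \<Rightarrow> real) \<Rightarrow> ((nat \<Rightarrow> real) \<Rightarrow> real) \<Rightarrow> real" where
  "jacobi_inner d \<kappa> f g =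
     Gamma ((\<Sum>i=1..d+1. \<kappa> i) + real d + 1) / (\<Prod>i=1..d+1. Gamma (\<kappa> i + 1)) *
     (LINT x:simplex_region d|PiM {1..d} (\<lambda>_. lborel). f x * g x * jacobi_weight d \<kappa> x)"

definition orth_polys :: "nat \<Rightarrow> (nat \<Rightarrow> real) \<Rightarrow> nat \<Rightarrow> ((nat \<Rightarrow> real) \<Rightarrow> real) set" where
  "orth_polys d \<kappa> n =
     {f \<in> polys_below d (Suc n). \<forall>g\<in>polys_below d n. jacobi_inner d \<kappa> f g = 0}"

definition hyp2F1 :: "real \<Rightarrow> real \<Rightarrow> real \<Rightarrow> real \<Rightarrow> real" where
  "hyp2F1 a b c z = (\<Sum>k. pochhammer a k * pochhammer b k / (pochhammer c k * fact k) * z ^ k)"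

text \<open>The Jacobi polynomial \<open>P_m^(a,b)\<close> divided by its value at 1.\<close>

definition jacobi_normalized :: "nat \<Rightarrow> real \<Rightarrow> real \<Rightarrow> real \<Rightarrow> real" where
  "jacobi_normalized m a b t = hyp2F1 (- real m) (real m + a + b + 1) (a + 1) ((1 - t) / 2)"

text \<open>
  The polynomial \<open>s^m * jacobi_normalized m a b (2 * u / s - 1)\<close> in \<open>s\<close> and \<open>u\<close> with denominators
  cleared: \<open>(1 - t) / 2 = (s - u) / s\<close> for \<open>t = 2 * u / s - 1\<close>. Unlike the quotient form it has the
  right value also at \<open>s = 0\<close>; the two agree elsewhere by \<open>jacobi_homogenized_eq\<close>.
\<close>

definition jacobi_homogenized :: "nat \<Rightarrow> real \<Rightarrow> real \<Rightarrow> real \<Rightarrow> real \<Rightarrow> real" where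
  "jacobi_homogenized m a b s u =
     (\<Sum>k\<le>m. pochhammer (- real m) k * pochhammer (real m + a + b + 1) k /
        (pochhammer (a + 1) k * fact k) * (s - u) ^ k * s ^ (m - k))"

lemma jacobi_homogenized_eq:
  assumes "s \<noteq> 0"
  shows "jacobi_homogenized m a b s u = s ^ m * jacobi_normalized m a b (2 * u / s - 1)"
proof -
  have z: "(1 - (2 * u / s - 1)) / 2 = (s - u) / s"
    using assms by (simp add: field_simps)
  have "jacobi_normalized m a b (2 * u / s - 1) =
     (\<Sum>k\<le>m. pochhammer (- real m) k * pochhammer (real m + a + b + 1) k /
        (pochhammer (a + 1) k * fact k) * ((s - u) / s) ^ k)"
    unfolding jacobi_normalized_def hyp2F1_def z
    by (rule suminf_finite) (auto simp: pochhammer_of_nat_eq_0_lemma)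
  moreover have "s ^ (m - k) * (s - u) ^ k = s ^ m * ((s - u) / s) ^ k" if "k \<le> m" for k
    using that assms by (simp add: power_divide power_diff)
  ultimately show ?thesis
    unfolding jacobi_homogenized_def
    by (auto simp: sum_distrib_left mult_ac intro!: sum.cong)
qed

definition jacobi_param :: "nat \<Rightarrow> (nat \<Rightarrow> real) \<Rightarrow> (nat \<Rightarrow> nat) \<Rightarrow> nat \<Rightarrow> real" where
  "jacobi_param d \<kappa> \<nu> j =
     (\<Sum>i=j+1..d+1. \<kappa> i) + 2 * (\<Sum>i=j+1..d. real (\<nu> i)) + real d - real j"

definition simplex_jacobi :: "nat \<Rightarrow> (nat \<Rightarrow> real) \<Rightarrow> (nat \<Rightarrow> nat) \<Rightarrow> (nat \<Rightarrow> real) \<Rightarrow> real" where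
  "simplex_jacobi d \<kappa> \<nu> x =
     (\<Prod>j=1..d. jacobi_homogenized (\<nu> j) (jacobi_param d \<kappa> \<nu> j) (\<kappa> j)
        (1 - (\<Sum>i=1..<j. x i)) (x j))"

lemma simplex_jacobi_eq:
  assumes "\<And>j. j \<in> {1..d} \<Longrightarrow> 1 - (\<Sum>i=1..<j. x i) \<noteq> 0"
  shows "simplex_jacobi d \<kappa> \<nu> x =
    (\<Prod>j=1..d. (1 - (\<Sum>i=1..<j. x i)) ^ \<nu> j *
       jacobi_normalized (\<nu> j) (jacobi_param d \<kappa> \<nu> j) (\<kappa> j)
         (2 * x j / (1 - (\<Sum>i=1..<j. x i)) - 1))"
  unfolding simplex_jacobi_def
  by (rule prod.cong) (use assms in \<open>auto intro!: jacobi_homogenized_eq\<close>)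

definition simplex_monic ::
  "nat \<Rightarrow> (nat \<Rightarrow> real) \<Rightarrow> (nat \<Rightarrow> nat) \<Rightarrow> (nat \<Rightarrow> real) \<Rightarrow> real" where
  "simplex_monic d \<kappa> \<alpha> =
     (THE f. f \<in> orth_polys d \<kappa> (\<Sum>i=1..d+1. \<alpha> i) \<and>
        (\<exists>q\<in>polys_below d (\<Sum>i=1..d+1. \<alpha> i).
           \<forall>x. f x = monomial (d + 1) (barycentric d x) \<alpha> + q x))"

text \<open>
  Both sides of the defining identity are polynomials in \<open>y\<close> when \<open>|\<nu>| \<le> N\<close>, so it suffices to
  require it on the dense set \<open>|y| \<noteq> 0\<close> where the quotient \<open>y' / |y|\<close> makes sense. The values
  at \<open>\<alpha>\<close> with \<open>|\<alpha>| \<noteq> N\<close> are set to 0 only to make the coefficient function unique.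
\<close>

definition hahn ::
  "nat \<Rightarrow> (nat \<Rightarrow> nat) \<Rightarrow> (nat \<Rightarrow> real) \<Rightarrow> nat \<Rightarrow> (nat \<Rightarrow> nat) \<Rightarrow> real" where
  "hahn d \<nu> \<kappa> N =
     (THE h. (\<forall>\<alpha>. \<alpha> \<notin> multi_index (d + 1) N \<longrightarrow> h \<alpha> = 0) \<and>
        (\<forall>y. (\<Sum>i=1..d+1. y i) \<noteq> 0 \<longrightarrow>
           (\<Sum>i=1..d+1. y i) ^ N * simplex_jacobi d \<kappa> \<nu> (\<lambda>i. y i / (\<Sum>j=1..d+1. y j)) =
           (\<Sum>\<alpha>\<in>multi_index (d + 1) N.
              fact N / multi_fact (d + 1) \<alpha> * h \<alpha> * monomial (d + 1) y \<alpha>)))"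

definition hahn_norm_sq :: "nat \<Rightarrow> (nat \<Rightarrow> nat) \<Rightarrow> (nat \<Rightarrow> real) \<Rightarrow> nat \<Rightarrow> real" where
  "hahn_norm_sq d \<nu> \<kappa> N =
     fact N / pochhammer ((\<Sum>i=1..d+1. \<kappa> i) + real d + 1) N *
     (\<Sum>\<alpha>\<in>multi_index (d + 1) N.
        (hahn d \<nu> \<kappa> N \<alpha>)\<^sup>2 * multi_pochhammer (d + 1) (\<lambda>i. \<kappa> i + 1) \<alpha> /
        multi_fact (d + 1) \<alpha>)"

end

theory Submission
  imports Defs
begin

text \<open>
  Homogenize in the barycentric coordinates \<open>X = (x, 1 - |x|)\<close>: a polynomial of degree at most
  \<open>n\<close> is the restriction of a form of degree \<open>n\<close> in \<open>d + 1\<close> variables. The homogenized Jacobi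
  polynomials are annihilated by \<open>L = (\<Sum>i. y_i \<partial>_i\<^sup>2 + (\<kappa>_i + 1) \<partial>_i)\<close>, which is adjoint to
  multiplication by \<open>|y|\<close> for the form \<open>F(y^\<alpha>, y^\<beta>) = \<alpha>! (\<kappa> + 1)_\<alpha>\<close> if \<open>\<alpha> = \<beta>\<close> and \<open>0\<close>
  otherwise. If \<open>L v = 0\<close>, then \<open>\<langle>u, v\<rangle>\<close> and \<open>F(u, v)\<close> agree up to a factor depending only on
  the degree, so elements of \<open>ker L\<close> are orthogonal to everything of lower degree. The first
  expansion compares leading forms. The second is the expansion of \<open>y^\<alpha>\<close> modulo \<open>|y|\<close> in the
  homogenized Jacobi polynomials, whose coefficients are read off with \<open>F\<close> because these
  polynomials are \<open>F\<close>-orthogonal, being joint eigenvectors of the Casimir operators of the tails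
  \<open>{j..d+1}\<close> with distinct eigenvalues.
\<close>

section \<open>Multiplication and second-order operators on coefficient functions\<close>

text \<open>For every finite set \<open>J\<close> of variables, \<open>shifts J\<close>,
  \<open>Lap \<kappa> J\<close> and the weight
  \<open>2 deg + (\<Sum>i\<in>J. \<kappa> i + 1)\<close> form an sl_2 triple, and the forms killed
  by \<open>Lap \<kappa> J\<close> are its lowest-weight vectors. Variables are adjoined from the
  last one backwards: a homogenized Jacobi factor is the combination of powers of two neighbouring
  tail sums that turns a lowest-weight vector for the tail \<open>{j+1..d+1}\<close> into one for
  \<open>{j..d+1}\<close>. This explains the parameter \<open>a_j\<close>: \<open>a_j + 1\<close> is
  the weight of the vector already built. The integral enters only through the moments of
  \<open>X^\<gamma>\<close>, which are \<open>(\<kappa> + 1)_\<gamma>\<close> over a factor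
  depending on \<open>|\<gamma>|\<close>. The obstacle is that the moment matrix
  \<open>(\<kappa> + 1)_(\<alpha> + \<beta>)\<close> is full, while the sums defining the Hahn norms
  are diagonal; on harmonic coefficients the matrix acts diagonally. Positivity of the weights of F
  also gives the uniqueness behind \<open>simplex_monic\<close>: a polynomial orthogonal to its own
  degree class loses its top harmonic part, degree after degree, until nothing is left.\<close>

text \<open>
  A polynomial in \<open>y\<close> is represented by its coefficients: \<open>shift i\<close> is multiplication by \<open>y_i\<close> and
  \<open>lap \<kappa> i\<close> is \<open>y_i \<partial>_i\<^sup>2 + (\<kappa>_i + 1) \<partial>_i\<close>.
\<close>

definition shift :: "nat \<Rightarrow> ((nat \<Rightarrow> nat) \<Rightarrow> real) \<Rightarrow> (nat \<Rightarrow> nat) \<Rightarrow> real" where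
  "shift i c \<alpha> = (if \<alpha> i = 0 then 0 else c (\<alpha>(i := \<alpha> i - 1)))"

definition lap :: "(nat \<Rightarrow> real) \<Rightarrow> nat \<Rightarrow> ((nat \<Rightarrow> nat) \<Rightarrow> real) \<Rightarrow> (nat \<Rightarrow> nat) \<Rightarrow> real" where
  "lap \<kappa> i c \<alpha> = (real (\<alpha> i) + 1) * (real (\<alpha> i) + 1 + \<kappa> i) * c (\<alpha>(i := Suc (\<alpha> i)))"

definition shifts :: "nat set \<Rightarrow> ((nat \<Rightarrow> nat) \<Rightarrow> real) \<Rightarrow> (nat \<Rightarrow> nat) \<Rightarrow> real" where
  "shifts J c \<alpha> = (\<Sum>i\<in>J. shift i c \<alpha>)"

definition Lap :: "(nat \<Rightarrow> real) \<Rightarrow> nat set \<Rightarrow> ((nat \<Rightarrow> nat) \<Rightarrow> real) \<Rightarrow> (nat \<Rightarrow> nat) \<Rightarrow> real" where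
  "Lap \<kappa> J c \<alpha> = (\<Sum>i\<in>J. lap \<kappa> i c \<alpha>)"

lemma shift_commute: "shift i (shift j c) = shift j (shift i c)"
  by (rule ext) (auto simp: shift_def fun_upd_twist)

lemma shift_sum: "shift i (\<lambda>\<alpha>. \<Sum>x\<in>A. f x \<alpha>) = (\<lambda>\<alpha>. \<Sum>x\<in>A. shift i (f x) \<alpha>)"
  by (rule ext) (simp add: shift_def)

lemma shift_scale: "shift i (\<lambda>\<alpha>. a * f \<alpha>) = (\<lambda>\<alpha>. a * shift i f \<alpha>)"
  by (rule ext) (simp add: shift_def)

lemma shift_add: "shift i (\<lambda>\<alpha>. f \<alpha> + g \<alpha>) = (\<lambda>\<alpha>. shift i f \<alpha> + shift i g \<alpha>)"
  by (rule ext) (simp add: shift_def)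

lemma shift_zero: "shift i (\<lambda>\<alpha>. 0) = (\<lambda>\<alpha>. 0)"
  by (rule ext) (simp add: shift_def)

lemma lap_sum: "lap \<kappa> i (\<lambda>\<alpha>. \<Sum>x\<in>A. f x \<alpha>) = (\<lambda>\<alpha>. \<Sum>x\<in>A. lap \<kappa> i (f x) \<alpha>)"
  by (rule ext) (simp add: lap_def sum_distrib_left)

lemma lap_scale: "lap \<kappa> i (\<lambda>\<alpha>. a * f \<alpha>) = (\<lambda>\<alpha>. a * lap \<kappa> i f \<alpha>)"
  by (rule ext) (simp add: lap_def)

lemma lap_add: "lap \<kappa> i (\<lambda>\<alpha>. f \<alpha> + g \<alpha>) = (\<lambda>\<alpha>. lap \<kappa> i f \<alpha> + lap \<kappa> i g \<alpha>)"
  by (rule ext) (simp add: lap_def algebra_simps)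

lemma shifts_sum: "shifts J (\<lambda>\<alpha>. \<Sum>x\<in>A. f x \<alpha>) = (\<lambda>\<alpha>. \<Sum>x\<in>A. shifts J (f x) \<alpha>)"
  by (rule ext) (simp add: shifts_def shift_sum sum.swap[of _ _ A])

lemma shifts_scale: "shifts J (\<lambda>\<alpha>. a * f \<alpha>) = (\<lambda>\<alpha>. a * shifts J f \<alpha>)"
  by (rule ext) (simp add: shifts_def shift_scale sum_distrib_left)

lemma shifts_add: "shifts J (\<lambda>\<alpha>. f \<alpha> + g \<alpha>) = (\<lambda>\<alpha>. shifts J f \<alpha> + shifts J g \<alpha>)"
  by (rule ext) (simp add: shifts_def shift_add sum.distrib)

lemma shifts_zero: "shifts J (\<lambda>\<alpha>. 0) = (\<lambda>\<alpha>. 0)"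
  by (rule ext) (simp add: shifts_def shift_zero)

lemma Lap_sum: "Lap \<kappa> J (\<lambda>\<alpha>. \<Sum>x\<in>A. f x \<alpha>) = (\<lambda>\<alpha>. \<Sum>x\<in>A. Lap \<kappa> J (f x) \<alpha>)"
  by (rule ext) (simp add: Lap_def lap_sum sum.swap[of _ _ A])

lemma Lap_scale: "Lap \<kappa> J (\<lambda>\<alpha>. a * f \<alpha>) = (\<lambda>\<alpha>. a * Lap \<kappa> J f \<alpha>)"
  by (rule ext) (simp add: Lap_def lap_scale sum_distrib_left)

lemma Lap_add: "Lap \<kappa> J (\<lambda>\<alpha>. f \<alpha> + g \<alpha>) = (\<lambda>\<alpha>. Lap \<kappa> J f \<alpha> + Lap \<kappa> J g \<alpha>)"
  by (rule ext) (simp add: Lap_def lap_add sum.distrib)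

lemma shift_shifts: "shift i (shifts J c) = shifts J (shift i c)"
  unfolding shifts_def[abs_def] by (simp add: shift_sum shift_commute[of i])

lemma lap_shift_neq: "i \<noteq> j \<Longrightarrow> lap \<kappa> i (shift j c) = shift j (lap \<kappa> i c)"
  by (rule ext) (auto simp: lap_def shift_def fun_upd_twist)

text \<open>The commutator of \<open>y \<partial>^2 + (\<kappa> + 1) \<partial>\<close> with
  multiplication by \<open>y\<close> is \<open>2 y \<partial> + \<kappa> + 1\<close>, and the Euler
  operator \<open>y \<partial>\<close> reads \<open>\<alpha> i\<close> at the coefficient
  \<alpha>.\<close>

lemma lap_shift_same:
  "lap \<kappa> i (shift i c) \<alpha> = shift i (lap \<kappa> i c) \<alpha> + (2 * real (\<alpha> i) + 1 + \<kappa> i) * c \<alpha>"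
  by (auto simp: lap_def shift_def fun_upd_upd algebra_simps of_nat_diff)

lemma Lap_shift_notin: "i \<notin> J \<Longrightarrow> Lap \<kappa> J (shift i c) = shift i (Lap \<kappa> J c)"
  unfolding Lap_def[abs_def] shift_sum
  by (intro ext sum.cong refl) (metis lap_shift_neq)

lemma Lap_shift_in:
  assumes "finite J" "i \<in> J"
  shows "Lap \<kappa> J (shift i c) \<alpha> = shift i (Lap \<kappa> J c) \<alpha> + (2 * real (\<alpha> i) + 1 + \<kappa> i) * c \<alpha>"
proof -
  have "Lap \<kappa> J (shift i c) \<alpha> = lap \<kappa> i (shift i c) \<alpha> + (\<Sum>k\<in>J-{i}. lap \<kappa> k (shift i c) \<alpha>)"
    unfolding Lap_def using assms by (rule sum.remove)
  also have "(\<Sum>k\<in>J-{i}. lap \<kappa> k (shift i c) \<alpha>) = (\<Sum>k\<in>J-{i}. shift i (lap \<kappa> k c) \<alpha>)"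
    by (intro sum.cong) (auto simp: lap_shift_neq)
  also have "lap \<kappa> i (shift i c) \<alpha> + \<dots> =
      (shift i (lap \<kappa> i c) \<alpha> + (\<Sum>k\<in>J-{i}. shift i (lap \<kappa> k c) \<alpha>)) + (2 * real (\<alpha> i) + 1 + \<kappa> i) * c \<alpha>"
    by (simp add: lap_shift_same)
  also have "shift i (lap \<kappa> i c) \<alpha> + (\<Sum>k\<in>J-{i}. shift i (lap \<kappa> k c) \<alpha>) = shift i (Lap \<kappa> J c) \<alpha>"
    using assms unfolding Lap_def[abs_def] shift_sum by (simp add: sum.remove)
  finally show ?thesis .
qed

text \<open>The sl_2 relation, as the sum of the one-variable commutators. The weight is evaluated
  at each coefficient separately; homogeneity enters only when powers of \<open>shifts J\<close> are
  formed.\<close>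

lemma Lap_shifts:
  assumes "finite J"
  shows "Lap \<kappa> J (shifts J c) =
    (\<lambda>\<alpha>. shifts J (Lap \<kappa> J c) \<alpha> + (2 * real (\<Sum>i\<in>J. \<alpha> i) + (\<Sum>i\<in>J. \<kappa> i + 1)) * c \<alpha>)"
proof
  fix \<alpha>
  have "Lap \<kappa> J (shifts J c) \<alpha> = (\<Sum>i\<in>J. Lap \<kappa> J (shift i c) \<alpha>)"
    unfolding shifts_def[abs_def] Lap_sum ..
  also have "\<dots> = (\<Sum>i\<in>J. shift i (Lap \<kappa> J c) \<alpha> + (2 * real (\<alpha> i) + 1 + \<kappa> i) * c \<alpha>)"
    by (intro sum.cong refl Lap_shift_in assms)
  also have "\<dots> = shifts J (Lap \<kappa> J c) \<alpha> + (\<Sum>i\<in>J. 2 * real (\<alpha> i) + 1 + \<kappa> i) * c \<alpha>"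
    by (simp only: shifts_def sum.distrib[of "\<lambda>i. shift i _ _"] sum_distrib_right)
  also have "(\<Sum>i\<in>J. 2 * real (\<alpha> i) + 1 + \<kappa> i) = 2 * real (\<Sum>i\<in>J. \<alpha> i) + (\<Sum>i\<in>J. \<kappa> i + 1)"
    by (simp add: sum.distrib sum_distrib_left)
  finally show "Lap \<kappa> J (shifts J c) \<alpha> =
     shifts J (Lap \<kappa> J c) \<alpha> + (2 * real (\<Sum>i\<in>J. \<alpha> i) + (\<Sum>i\<in>J. \<kappa> i + 1)) * c \<alpha>" .
qed

lemma Lap_shifts_disjoint:
  assumes "I \<inter> J = {}"
  shows "Lap \<kappa> I (shifts J c) = shifts J (Lap \<kappa> I c)"
proof
  fix \<alpha>
  have "Lap \<kappa> I (shifts J c) \<alpha> = (\<Sum>i\<in>J. Lap \<kappa> I (shift i c) \<alpha>)"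
    unfolding shifts_def[abs_def] Lap_sum ..
  also have "\<dots> = shifts J (Lap \<kappa> I c) \<alpha>"
    unfolding shifts_def
    by (intro sum.cong refl fun_cong[OF Lap_shift_notin]) (use assms in auto)
  finally show "Lap \<kappa> I (shifts J c) \<alpha> = shifts J (Lap \<kappa> I c) \<alpha>" .
qed

section \<open>Evaluation of coefficient functions as forms\<close>

lemma multi_index_0: "multi_index m 0 = {\<lambda>_. 0}"
  by (auto simp: multi_index_def intro!: ext)

text \<open>Only the part of \<open>c\<close> of length \<open>n\<close> is read. Coefficient
  functions live on all multi-indices, so the operators above need no degree in their type or
  hypotheses.\<close>

definition hom_eval :: "nat \<Rightarrow> nat \<Rightarrow> ((nat \<Rightarrow> nat) \<Rightarrow> real) \<Rightarrow> (nat \<Rightarrow> real) \<Rightarrow> real" where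
  "hom_eval m n c y = (\<Sum>\<alpha>\<in>multi_index m n. c \<alpha> * monomial m y \<alpha>)"

lemma sum_upd:
  fixes \<alpha> :: "nat \<Rightarrow> nat"
  assumes "finite J" "i \<in> J"
  shows "sum (\<alpha>(i := k)) J = sum \<alpha> (J - {i}) + k"
  using assms by (subst sum.remove[of _ i]) auto

lemma sum_inc:
  fixes \<alpha> :: "nat \<Rightarrow> nat"
  assumes "finite J" "i \<in> J"
  shows "sum (\<alpha>(i := Suc (\<alpha> i))) J = Suc (sum \<alpha> J)"
  using sum_upd[OF assms, of \<alpha> "Suc (\<alpha> i)"] sum.remove[OF assms, of \<alpha>] by simp

lemma multi_index_inc:
  "i \<in> {1..m} \<Longrightarrow> \<alpha>(i := Suc (\<alpha> i)) \<in> multi_index m (Suc n) \<longleftrightarrow> \<alpha> \<in> multi_index m n"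
  using sum_inc[of "{1..m}" i \<alpha>] by (auto simp: multi_index_def)

lemma multi_index_dec:
  assumes "i \<in> {1..m}" "\<alpha> \<in> multi_index m (Suc n)" "\<alpha> i \<noteq> 0"
  shows "\<alpha>(i := \<alpha> i - 1) \<in> multi_index m n"
  using multi_index_inc[OF assms(1), of "\<alpha>(i := \<alpha> i - 1)" n] assms by simp

text \<open>A multi-index of length \<open>n + 1\<close> with positive entry at \<open>i\<close>
  arises from exactly one of length \<open>n\<close> by raising that entry. Evaluation of products,
  adjointness for F and the moment recursions all rest on this reindexing.\<close>

lemma sum_multi_index_Suc:
  assumes i: "i \<in> {1..m}" and 0: "\<And>\<alpha>. \<alpha> i = 0 \<Longrightarrow> f \<alpha> = 0"
  shows "(\<Sum>\<alpha>\<in>multi_index m (Suc n). f \<alpha>) = (\<Sum>\<alpha>\<in>multi_index m n. f (\<alpha>(i := Suc (\<alpha> i))))"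
proof -
  have "(\<Sum>\<alpha>\<in>multi_index m (Suc n). f \<alpha>) = (\<Sum>\<alpha>\<in>{\<alpha>\<in>multi_index m (Suc n). \<alpha> i \<noteq> 0}. f \<alpha>)"
    by (rule sum.mono_neutral_right) (auto simp: finite_multi_index 0)
  also have "\<dots> = (\<Sum>\<alpha>\<in>multi_index m n. f (\<alpha>(i := Suc (\<alpha> i))))"
    by (rule sum.reindex_bij_witness[of _ "\<lambda>\<alpha>. \<alpha>(i := Suc (\<alpha> i))" "\<lambda>\<alpha>. \<alpha>(i := \<alpha> i - 1)"])
       (use i in \<open>auto simp del: One_nat_def simp: multi_index_inc intro: multi_index_dec\<close>)
  finally show ?thesis .
qed

lemma prod_inc:
  assumes "i \<in> {1..m::nat}" and "\<And>k. k \<noteq> i \<Longrightarrow> g k = f k" and "g i = a * f i"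
  shows "prod g {1..m} = a * (prod f {1..m} :: real)"
proof -
  have "prod g {1..m} = g i * prod g ({1..m} - {i})"
    using assms by (subst prod.remove[of _ i]) auto
  also have "prod g ({1..m} - {i}) = prod f ({1..m} - {i})"
    using assms by (intro prod.cong) auto
  also have "g i * \<dots> = a * (f i * prod f ({1..m} - {i}))"
    using assms by simp
  also have "f i * prod f ({1..m} - {i}) = prod f {1..m}"
    using assms by (subst prod.remove[of _ i]) auto
  finally show ?thesis .
qed

lemma monomial_inc: "i \<in> {1..m} \<Longrightarrow> monomial m y (\<alpha>(i := Suc (\<alpha> i))) = y i * monomial m y \<alpha>"
  unfolding monomial_def by (rule prod_inc) auto

lemma multi_fact_inc:
  "i \<in> {1..m} \<Longrightarrow> multi_fact m (\<alpha>(i := Suc (\<alpha> i))) = (real (\<alpha> i) + 1) * multi_fact m \<alpha>"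
  unfolding multi_fact_def by (rule prod_inc) (auto simp: algebra_simps)

lemma multi_pochhammer_inc:
  "i \<in> {1..m} \<Longrightarrow> multi_pochhammer m a (\<alpha>(i := Suc (\<alpha> i))) = (a i + real (\<alpha> i)) * multi_pochhammer m a \<alpha>"
  unfolding multi_pochhammer_def by (rule prod_inc) (auto simp: pochhammer_Suc)

lemma hom_eval_shift:
  assumes "i \<in> {1..m}"
  shows "hom_eval m (Suc n) (shift i c) y = y i * hom_eval m n c y"
  unfolding hom_eval_def
  by (subst sum_multi_index_Suc[OF assms])
     (auto simp: shift_def monomial_inc[OF assms] sum_distrib_left algebra_simps)

lemma hom_eval_shift_0: "i \<in> {1..m} \<Longrightarrow> hom_eval m 0 (shift i c) y = 0"
  by (auto simp: hom_eval_def multi_index_def shift_def intro!: sum.neutral)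

lemma hom_eval_sum: "hom_eval m n (\<lambda>\<alpha>. \<Sum>x\<in>A. f x \<alpha>) y = (\<Sum>x\<in>A. hom_eval m n (f x) y)"
  unfolding hom_eval_def by (simp add: sum_distrib_right sum.swap[of _ _ A])

lemma hom_eval_scale: "hom_eval m n (\<lambda>\<alpha>. a * f \<alpha>) y = a * hom_eval m n f y"
  unfolding hom_eval_def by (simp add: sum_distrib_left algebra_simps)

lemma hom_eval_add: "hom_eval m n (\<lambda>\<alpha>. f \<alpha> + g \<alpha>) y = hom_eval m n f y + hom_eval m n g y"
  unfolding hom_eval_def by (simp add: sum.distrib algebra_simps)

lemma hom_eval_shifts:
  assumes "J \<subseteq> {1..m}"
  shows "hom_eval m (Suc n) (shifts J c) y = (\<Sum>i\<in>J. y i) * hom_eval m n c y"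
  unfolding shifts_def[abs_def] hom_eval_sum sum_distrib_right
  by (intro sum.cong hom_eval_shift) (use assms in auto)

lemma hom_eval_shifts_pow:
  assumes "J \<subseteq> {1..m}"
  shows "hom_eval m (n + k) ((shifts J ^^ k) c) y = (\<Sum>i\<in>J. y i) ^ k * hom_eval m n c y"
  by (induction k) (auto simp: hom_eval_shifts[OF assms])

section \<open>The diagonal form F\<close>

text \<open>A weighted Fischer (apolar) inner product. Since \<open>lap \<kappa> i\<close> sends
  \<open>y_i^k\<close> to \<open>k (k + \<kappa>_i) y_i^(k-1)\<close>, adjointness to multiplication
  by \<open>y_i\<close> forces, up to scale, the product of these factors over
  \<open>k = 1, ..., \<alpha>_i\<close> as weight, which is
  \<open>\<alpha>_i! (\<kappa>_i + 1)_(\<alpha>_i)\<close>.\<close>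

definition fischer ::
  "nat \<Rightarrow> (nat \<Rightarrow> real) \<Rightarrow> nat \<Rightarrow> ((nat \<Rightarrow> nat) \<Rightarrow> real) \<Rightarrow> ((nat \<Rightarrow> nat) \<Rightarrow> real) \<Rightarrow> real" where
  "fischer m \<kappa> n u v = (\<Sum>\<alpha>\<in>multi_index m n.
     multi_fact m \<alpha> * multi_pochhammer m (\<lambda>i. \<kappa> i + 1) \<alpha> * u \<alpha> * v \<alpha>)"

lemma fischer_commute: "fischer m \<kappa> n u v = fischer m \<kappa> n v u"
  by (simp add: fischer_def mult_ac)

lemma fischer_sum: "fischer m \<kappa> n u (\<lambda>\<alpha>. \<Sum>x\<in>A. f x \<alpha>) = (\<Sum>x\<in>A. fischer m \<kappa> n u (f x))"
  unfolding fischer_def by (simp add: sum_distrib_left sum.swap[of _ _ A])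

lemma fischer_scale: "fischer m \<kappa> n u (\<lambda>\<alpha>. a * f \<alpha>) = a * fischer m \<kappa> n u f"
  unfolding fischer_def by (simp add: sum_distrib_left algebra_simps)

lemma fischer_add: "fischer m \<kappa> n u (\<lambda>\<alpha>. f \<alpha> + g \<alpha>) = fischer m \<kappa> n u f + fischer m \<kappa> n u g"
  unfolding fischer_def by (simp add: sum.distrib algebra_simps)

lemma fischer_cong:
  assumes "\<And>\<alpha>. \<alpha> \<in> multi_index m n \<Longrightarrow> u \<alpha> = u' \<alpha>" "\<And>\<alpha>. \<alpha> \<in> multi_index m n \<Longrightarrow> v \<alpha> = v' \<alpha>"
  shows "fischer m \<kappa> n u v = fischer m \<kappa> n u' v'"
  unfolding fischer_def using assms by (intro sum.cong) auto

lemma fischer_shift: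
  assumes "i \<in> {1..m}"
  shows "fischer m \<kappa> (Suc n) (shift i u) v = fischer m \<kappa> n u (lap \<kappa> i v)"
  unfolding fischer_def
  by (subst sum_multi_index_Suc[OF assms])
     (auto simp: shift_def multi_fact_inc[OF assms] multi_pochhammer_inc[OF assms] lap_def
       algebra_simps intro!: sum.cong)

lemma fischer_shifts:
  assumes "J \<subseteq> {1..m}"
  shows "fischer m \<kappa> (Suc n) v (shifts J u) = fischer m \<kappa> n (Lap \<kappa> J v) u"
proof -
  have "fischer m \<kappa> (Suc n) v (shifts J u) = (\<Sum>i\<in>J. fischer m \<kappa> (Suc n) (shift i u) v)"
    unfolding shifts_def[abs_def] fischer_sum by (simp add: fischer_commute)
  also have "\<dots> = (\<Sum>i\<in>J. fischer m \<kappa> n u (lap \<kappa> i v))"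
    by (intro sum.cong fischer_shift) (use assms in auto)
  also have "\<dots> = fischer m \<kappa> n (Lap \<kappa> J v) u"
    unfolding Lap_def[abs_def] by (subst fischer_commute) (simp add: fischer_sum)
  finally show ?thesis .
qed

lemma fischer_shifts_0:
  assumes "J \<subseteq> {1..m}"
  shows "fischer m \<kappa> 0 v (shifts J u) = 0"
proof -
  have "shifts J u \<alpha> = 0" if "\<alpha> \<in> multi_index m 0" for \<alpha>
    using assms that by (force simp: multi_index_def shifts_def shift_def intro!: sum.neutral)
  then show ?thesis by (simp add: fischer_def)
qed

lemma multi_fact_pos: "multi_fact m \<alpha> > 0"
  unfolding multi_fact_def by (intro prod_pos) auto

lemma multi_pochhammer_pos: "(\<And>i. i \<in> {1..m} \<Longrightarrow> a i > 0) \<Longrightarrow> multi_pochhammer m a \<alpha> > 0"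
  unfolding multi_pochhammer_def by (intro prod_pos) (auto intro: pochhammer_pos)

lemma fischer_pos_def:
  assumes \<kappa>: "\<And>i. i \<in> {1..m} \<Longrightarrow> \<kappa> i > -1" and "fischer m \<kappa> n u u = 0" "\<alpha> \<in> multi_index m n"
  shows "u \<alpha> = 0"
proof -
  have pos: "multi_fact m \<alpha> * multi_pochhammer m (\<lambda>i. \<kappa> i + 1) \<alpha> > 0" for \<alpha>
    by (intro mult_pos_pos multi_fact_pos multi_pochhammer_pos) (use \<kappa> in force)
  have nonneg: "0 \<le> multi_fact m \<alpha> * multi_pochhammer m (\<lambda>i. \<kappa> i + 1) \<alpha> * u \<alpha> * u \<alpha>" for \<alpha>
    using mult_nonneg_nonneg[OF less_imp_le[OF pos[of \<alpha>]] zero_le_square[of "u \<alpha>"]]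
    by (simp only: mult.assoc)
  have "\<forall>\<alpha>\<in>multi_index m n. multi_fact m \<alpha> * multi_pochhammer m (\<lambda>i. \<kappa> i + 1) \<alpha> * u \<alpha> * u \<alpha> = 0"
    using assms(2) unfolding fischer_def
    by (subst (asm) sum_nonneg_eq_0_iff) (auto simp: finite_multi_index nonneg)
  then show ?thesis using assms(3) pos[of \<alpha>] by auto
qed

section \<open>Moments of harmonic forms\<close>

lemma multi_pochhammer_param_inc:
  assumes i: "i \<in> {1..m}"
  shows "multi_pochhammer m (b(i := b i + 1)) (\<gamma>(i := Suc (\<gamma> i))) =
    multi_pochhammer m b (\<gamma>(i := Suc (\<gamma> i))) +
    (real (\<gamma> i) + 1) * multi_pochhammer m (b(i := b i + 1)) \<gamma>"
proof -
  have "multi_pochhammer m b (\<gamma>(i := Suc (\<gamma> i))) = b i * multi_pochhammer m (b(i := b i + 1)) \<gamma>"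
    unfolding multi_pochhammer_def by (rule prod_inc[OF i]) (auto simp: pochhammer_rec)
  then show ?thesis
    by (simp add: multi_pochhammer_inc[OF i] algebra_simps)
qed

text \<open>
  With \<open>h = \<alpha>! c\<close> this interpolates between the moments of \<open>c\<close> at \<open>j = 0\<close> and its coefficients:
  a unit of \<open>\<alpha>\<close> either disappears or moves to \<open>j\<close>, by \<open>(b + 1)_m = (b)_m + m (b + 1)_(m - 1)\<close>.
\<close>

definition moment_sum ::
  "nat \<Rightarrow> (nat \<Rightarrow> real) \<Rightarrow> ((nat \<Rightarrow> nat) \<Rightarrow> real) \<Rightarrow> nat \<Rightarrow> (nat \<Rightarrow> nat) \<Rightarrow> (nat \<Rightarrow> nat) \<Rightarrow> real" where
  "moment_sum m \<kappa> h p j \<alpha> = (\<Sum>\<gamma>\<in>multi_index m p.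
     multi_pochhammer m (\<lambda>i. \<kappa> i + 1 + real (j i) + real (\<alpha> i)) \<gamma> / multi_fact m \<gamma> *
     h (\<lambda>i. j i + \<gamma> i))"

text \<open>Raising \<open>\<alpha> i\<close> raises the i-th Pochhammer parameter by one. The
  resulting change of weight vanishes for \<open>\<gamma> i = 0\<close>; elsewhere it has a factor
  \<open>\<gamma> i\<close> that cancels against the factorial, and the unit removed from \<gamma>
  is recorded in \<open>j\<close>.\<close>

lemma moment_sum_rec:
  assumes i: "i \<in> {1..m}"
  shows "moment_sum m \<kappa> h (Suc p) j (\<alpha>(i := Suc (\<alpha> i))) =
    moment_sum m \<kappa> h (Suc p) j \<alpha> + moment_sum m \<kappa> h p (j(i := Suc (j i))) \<alpha>"
proof -
  define b where "b = (\<lambda>k. \<kappa> k + 1 + real (j k) + real (\<alpha> k))"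
  have b1: "(\<lambda>k. \<kappa> k + 1 + real (j k) + real ((\<alpha>(i := Suc (\<alpha> i))) k)) = b(i := b i + 1)"
    by (auto simp: b_def)
  have b2: "(\<lambda>k. \<kappa> k + 1 + real ((j(i := Suc (j i))) k) + real (\<alpha> k)) = b(i := b i + 1)"
    by (auto simp: b_def)
  have zero: "multi_pochhammer m (b(i := b i + 1)) \<gamma> = multi_pochhammer m b \<gamma>" if "\<gamma> i = 0" for \<gamma>
    unfolding multi_pochhammer_def using that by (intro prod.cong) auto
  define D where "D \<gamma> = (multi_pochhammer m (b(i := b i + 1)) \<gamma> - multi_pochhammer m b \<gamma>) /
      multi_fact m \<gamma> * h (\<lambda>k. j k + \<gamma> k)" for \<gamma>
  have "moment_sum m \<kappa> h (Suc p) j (\<alpha>(i := Suc (\<alpha> i))) - moment_sum m \<kappa> h (Suc p) j \<alpha> =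
      (\<Sum>\<gamma>\<in>multi_index m (Suc p). D \<gamma>)"
    unfolding moment_sum_def b1 unfolding b_def[symmetric] sum_subtractf[symmetric] D_def
    by (simp add: diff_divide_distrib algebra_simps)
  also have "\<dots> = (\<Sum>\<gamma>\<in>multi_index m p. D (\<gamma>(i := Suc (\<gamma> i))))"
    by (rule sum_multi_index_Suc[OF i]) (simp add: D_def zero)
  also have "\<dots> = moment_sum m \<kappa> h p (j(i := Suc (j i))) \<alpha>"
    unfolding moment_sum_def b2
  proof (rule sum.cong)
    fix \<gamma>
    have "(\<lambda>k. j k + (\<gamma>(i := Suc (\<gamma> i))) k) = (\<lambda>k. (j(i := Suc (j i))) k + \<gamma> k)"
      by auto
    moreover have "real (\<gamma> i) + 1 > 0" by simp
    ultimately show "D (\<gamma>(i := Suc (\<gamma> i))) =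
        multi_pochhammer m (b(i := b i + 1)) \<gamma> / multi_fact m \<gamma> * h (\<lambda>k. (j(i := Suc (j i))) k + \<gamma> k)"
      unfolding D_def multi_pochhammer_param_inc[OF i] by (simp add: multi_fact_inc[OF i])
  qed simp
  finally show ?thesis by simp
qed

text \<open>Euler's trick: multiplied by its degree, the sum becomes one over \<open>i\<close> in
  which \<open>\<gamma> i + 1\<close> cancels after reindexing. The Pochhammer factor
  \<open>j i + \<gamma> i + 1 + \<kappa> i\<close> and the new factorial factor
  \<open>j i + \<gamma> i + 1\<close> are precisely those of \<open>lap \<kappa> i\<close> at
  \<open>j + \<gamma>\<close>, so the harmonic operator appears.\<close>

lemma moment_sum_0:
  assumes Lap: "Lap \<kappa> {1..m} c = (\<lambda>_. 0)"
  shows "moment_sum m \<kappa> (\<lambda>\<alpha>. multi_fact m \<alpha> * c \<alpha>) (Suc p) j (\<lambda>_. 0) = 0"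
proof -
  let ?h = "\<lambda>\<alpha>. multi_fact m \<alpha> * c \<alpha>"
  define b where "b = (\<lambda>k. \<kappa> k + 1 + real (j k))"
  define t where "t \<gamma> = multi_pochhammer m b \<gamma> / multi_fact m \<gamma> * ?h (\<lambda>i. j i + \<gamma> i)" for \<gamma>
  have "real (Suc p) * moment_sum m \<kappa> ?h (Suc p) j (\<lambda>_. 0) =
      (\<Sum>\<gamma>\<in>multi_index m (Suc p). (\<Sum>i=1..m. real (\<gamma> i)) * t \<gamma>)"
    unfolding moment_sum_def t_def b_def sum_distrib_left
    by (intro sum.cong) (auto simp: multi_index_def simp flip: of_nat_sum)
  also have "\<dots> = (\<Sum>i=1..m. \<Sum>\<gamma>\<in>multi_index m (Suc p). real (\<gamma> i) * t \<gamma>)"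
    unfolding sum_distrib_right by (rule sum.swap)
  also have "\<dots> = (\<Sum>i=1..m. \<Sum>\<gamma>\<in>multi_index m p. (real (\<gamma> i) + 1) * t (\<gamma>(i := Suc (\<gamma> i))))"
    by (intro sum.cong refl trans[OF sum_multi_index_Suc]) (auto simp: algebra_simps)
  also have "\<dots> = (\<Sum>\<gamma>\<in>multi_index m p. \<Sum>i=1..m. (real (\<gamma> i) + 1) * t (\<gamma>(i := Suc (\<gamma> i))))"
    by (rule sum.swap)
  also have "\<dots> = (\<Sum>\<gamma>\<in>multi_index m p. multi_pochhammer m b \<gamma> / multi_fact m \<gamma> *
      multi_fact m (\<lambda>i. j i + \<gamma> i) * Lap \<kappa> {1..m} c (\<lambda>i. j i + \<gamma> i))"
    unfolding Lap_def sum_distrib_left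
  proof (intro sum.cong refl)
    fix \<gamma> i assume i: "i \<in> {1..m}"
    have *: "(\<lambda>k. j k + (\<gamma>(i := Suc (\<gamma> i))) k) = (\<lambda>k. j k + \<gamma> k)(i := Suc (j i + \<gamma> i))"
      by auto
    have cancel: "x * (q * P / (x * F) * (y * F' * z)) = P / F * F' * (y * q * z)"
      if "x \<noteq> 0" for x q P F y F' z :: real
      using that by simp
    have \<gamma>1: "real (\<gamma> i) + 1 \<noteq> 0" by (simp add: add_nonneg_eq_0_iff)
    have b: "b i + real (\<gamma> i) = real (j i + \<gamma> i) + 1 + \<kappa> i" by (simp add: b_def)
    show "(real (\<gamma> i) + 1) * t (\<gamma>(i := Suc (\<gamma> i))) = multi_pochhammer m b \<gamma> / multi_fact m \<gamma> *
        multi_fact m (\<lambda>i. j i + \<gamma> i) * lap \<kappa> i c (\<lambda>i. j i + \<gamma> i)"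
      unfolding t_def lap_def * multi_fact_inc[OF i] multi_pochhammer_inc[OF i]
        multi_fact_inc[OF i, of "\<lambda>k. j k + \<gamma> k"] b by (rule cancel[OF \<gamma>1])
  qed
  also have "\<dots> = 0" by (simp add: Lap del: One_nat_def)
  finally show ?thesis by simp
qed

text \<open>Each unit of \<alpha> is either dropped or moved to \<open>j\<close>, the latter
  lowering \<open>p\<close>. Any history that exhausts \<alpha> with \<open>p\<close> still positive
  ends in \<open>moment_sum_0\<close>; for \<open>q = p\<close> only the history that moves every
  unit survives.\<close>

lemma moment_sum_harmonic:
  assumes Lap: "Lap \<kappa> {1..m} c = (\<lambda>_. 0)"
  shows "q \<le> p \<Longrightarrow> \<alpha> \<in> multi_index m q \<Longrightarrow>
    moment_sum m \<kappa> (\<lambda>\<alpha>. multi_fact m \<alpha> * c \<alpha>) p j \<alpha> =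
    (if q = p then multi_fact m (\<lambda>i. j i + \<alpha> i) * c (\<lambda>i. j i + \<alpha> i) else 0)"
proof (induction q arbitrary: p j \<alpha>)
  case 0
  show ?case
  proof (cases p)
    case 0
    then show ?thesis using "0.prems"
      by (simp add: moment_sum_def multi_index_0 multi_pochhammer_def multi_fact_def)
  next
    case (Suc p')
    then show ?thesis using "0.prems" moment_sum_0[OF Lap] by (simp add: multi_index_0)
  qed
next
  case (Suc q)
  obtain p' where p: "p = Suc p'" using Suc.prems by (cases p) auto
  have "(\<Sum>i=1..m. \<alpha> i) \<noteq> 0" using Suc.prems by (auto simp: multi_index_def)
  then obtain i where i: "i \<in> {1..m}" and ai: "\<alpha> i \<noteq> 0"
    by (auto simp: sum.neutral)
  define \<beta> where "\<beta> = \<alpha>(i := \<alpha> i - 1)"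
  have \<alpha>: "\<alpha> = \<beta>(i := Suc (\<beta> i))" using ai by (auto simp: \<beta>_def)
  have \<beta>: "\<beta> \<in> multi_index m q"
    using multi_index_dec[OF i Suc.prems(2) ai] by (simp add: \<beta>_def)
  have eq: "(\<lambda>k. (j(i := Suc (j i))) k + \<beta> k) = (\<lambda>k. j k + \<alpha> k)"
    by (auto simp: \<alpha>)
  let ?h = "\<lambda>\<alpha>. multi_fact m \<alpha> * c \<alpha>"
  have "moment_sum m \<kappa> ?h (Suc p') j \<alpha> =
      moment_sum m \<kappa> ?h (Suc p') j \<beta> + moment_sum m \<kappa> ?h p' (j(i := Suc (j i))) \<beta>"
    by (subst \<alpha>) (rule moment_sum_rec[OF i])
  moreover have "moment_sum m \<kappa> ?h (Suc p') j \<beta> = 0"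
    using Suc.IH[OF _ \<beta>, of "Suc p'" j] Suc.prems(1) by (simp add: p)
  moreover have "moment_sum m \<kappa> ?h p' (j(i := Suc (j i))) \<beta> =
      (if q = p' then ?h (\<lambda>k. j k + \<alpha> k) else 0)"
    using Suc.IH[OF _ \<beta>, of p' "j(i := Suc (j i))"] Suc.prems(1) unfolding eq
    by (auto simp: p fun_upd_def)
  ultimately show ?case by (simp add: p)
qed

lemma harmonic_moment:
  assumes "Lap \<kappa> {1..m} c = (\<lambda>_. 0)" "\<alpha> \<in> multi_index m n"
  shows "(\<Sum>\<gamma>\<in>multi_index m n. multi_pochhammer m (\<lambda>i. \<kappa> i + 1 + real (\<alpha> i)) \<gamma> * c \<gamma>) =
    multi_fact m \<alpha> * c \<alpha>"
proof -
  have "multi_fact m \<gamma> \<noteq> 0" for \<gamma>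
    using multi_fact_pos[of m \<gamma>] by simp
  then show ?thesis
    using moment_sum_harmonic[OF assms(1) order.refl assms(2), of "\<lambda>_. 0"] by (simp add: moment_sum_def)
qed

lemma multi_pochhammer_add:
  "multi_pochhammer m a (\<lambda>i. \<alpha> i + \<gamma> i) =
    multi_pochhammer m a \<alpha> * multi_pochhammer m (\<lambda>i. a i + real (\<alpha> i)) \<gamma>"
  by (simp add: multi_pochhammer_def pochhammer_product' prod.distrib)

text \<open>Harmonicity of one argument suffices: splitting
  \<open>(\<kappa> + 1)_(\<alpha> + \<gamma>)\<close> as \<open>(\<kappa> + 1)_\<alpha>\<close>
  times \<open>(\<kappa> + 1 + \<alpha>)_\<gamma>\<close> leaves as inner sum the moment of
  \<open>c\<close>, which is \<open>\<alpha>! c_\<alpha>\<close>.\<close>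

lemma fischer_eq_moments:
  assumes "Lap \<kappa> {1..m} c = (\<lambda>_. 0)"
  shows "(\<Sum>\<alpha>\<in>multi_index m n. \<Sum>\<gamma>\<in>multi_index m n.
      u \<alpha> * c \<gamma> * multi_pochhammer m (\<lambda>i. \<kappa> i + 1) (\<lambda>i. \<alpha> i + \<gamma> i)) = fischer m \<kappa> n u c"
  unfolding fischer_def
proof (rule sum.cong)
  fix \<alpha> assume \<alpha>: "\<alpha> \<in> multi_index m n"
  have "(\<Sum>\<gamma>\<in>multi_index m n. u \<alpha> * c \<gamma> * multi_pochhammer m (\<lambda>i. \<kappa> i + 1) (\<lambda>i. \<alpha> i + \<gamma> i)) =
    u \<alpha> * multi_pochhammer m (\<lambda>i. \<kappa> i + 1) \<alpha> *
      (\<Sum>\<gamma>\<in>multi_index m n. multi_pochhammer m (\<lambda>i. \<kappa> i + 1 + real (\<alpha> i)) \<gamma> * c \<gamma>)"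
    unfolding multi_pochhammer_add sum_distrib_left by (simp only: mult_ac)
  then show "(\<Sum>\<gamma>\<in>multi_index m n. u \<alpha> * c \<gamma> * multi_pochhammer m (\<lambda>i. \<kappa> i + 1) (\<lambda>i. \<alpha> i + \<gamma> i)) =
      multi_fact m \<alpha> * multi_pochhammer m (\<lambda>i. \<kappa> i + 1) \<alpha> * u \<alpha> * c \<alpha>"
    unfolding harmonic_moment[OF assms \<alpha>] by simp
qed simp

section \<open>Dirichlet integrals\<close>

text \<open>This is the integral over the last coordinate of a simplex, with \<open>r\<close> the
  room left by the others. Working with nonnegative integrals lets the final value certify
  integrability as well.\<close>

lemma nn_integral_Beta_scaled:
  fixes a b r :: real
  assumes "a > -1" "b > -1" "r \<ge> 0"
  shows "(\<integral>\<^sup>+t. ennreal (indicator {0..r} t * (t powr a * (r - t) powr b)) \<partial>lborel) =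
    ennreal (Beta (a + 1) (b + 1) * r powr (a + b + 1))"
proof (cases "r = 0")
  \<comment> \<open>The interval is a single point, and \<open>0 powr _ = 0\<close> makes the
    integrand and the right-hand side vanish for every exponent.\<close>
  case True
  have "(\<integral>\<^sup>+t. ennreal (indicator {0..r} t * (t powr a * (r - t) powr b)) \<partial>lborel) =
      (\<integral>\<^sup>+t. 0 \<partial>(lborel :: real measure))"
    by (rule nn_integral_cong) (use True in \<open>auto simp: indicator_def\<close>)
  then show ?thesis using True by simp
next
  case False
  with assms have r: "r > 0" by simp
  have Beta: "Beta (a + 1) (b + 1) \<ge> 0"
    using assms by (auto simp: Beta_def intro!: divide_nonneg_nonneg mult_nonneg_nonneg Gamma_real_nonneg)
  have "(\<integral>\<^sup>+t. ennreal (indicator {0..r} t * (t powr a * (r - t) powr b)) \<partial>lborel) =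
      ennreal \<bar>r\<bar> * (\<integral>\<^sup>+t. ennreal (indicator {0..r} (0 + r * t) * ((0 + r * t) powr a * (r - (0 + r * t)) powr b)) \<partial>lborel)"
    by (rule nn_integral_real_affine) (use r in auto)
  also have "(\<integral>\<^sup>+t. ennreal (indicator {0..r} (0 + r * t) * ((0 + r * t) powr a * (r - (0 + r * t)) powr b)) \<partial>lborel) =
      (\<integral>\<^sup>+t. ennreal (r powr (a + b)) * (indicator {0..1} t * ennreal (t powr a * (1 - t) powr b)) \<partial>lborel)"
  proof (rule nn_integral_cong)
    fix t :: real
    have ind: "(0 + r * t \<in> {0..r}) = (t \<in> {0..1})"
      using r by (auto simp: zero_le_mult_iff)
    have "(r * t) powr a * (r - r * t) powr b = r powr (a + b) * (t powr a * (1 - t) powr b)"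
      if "t \<in> {0..1}"
    proof -
      have "r - r * t = r * (1 - t)" by (simp add: algebra_simps)
      then show ?thesis using that r by (simp add: powr_mult powr_add)
    qed
    then show "ennreal (indicator {0..r} (0 + r * t) * ((0 + r * t) powr a * (r - (0 + r * t)) powr b)) =
      ennreal (r powr (a + b)) * (indicator {0..1} t * ennreal (t powr a * (1 - t) powr b))"
      using ind by (auto simp: indicator_def simp flip: ennreal_mult')
  qed
  also have "\<dots> = ennreal (r powr (a + b)) * (\<integral>\<^sup>+t. indicator {0..1} t * ennreal (t powr a * (1 - t) powr b) \<partial>lborel)"
    by (rule nn_integral_cmult) auto
  also have "(\<integral>\<^sup>+t. indicator {0..1} t * ennreal (t powr a * (1 - t) powr b) \<partial>lborel) =
      ennreal (Beta (a + 1) (b + 1))"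
    using nn_integral_has_integral_lebesgue[OF _ has_integral_Beta_real[of "a + 1" "b + 1"]] assms
    by (simp add: ennreal_mult' ennreal_indicator)
  also have "ennreal \<bar>r\<bar> * (ennreal (r powr (a + b)) * ennreal (Beta (a + 1) (b + 1))) =
      ennreal (Beta (a + 1) (b + 1) * r powr (a + b + 1))"
    using r Beta by (simp add: powr_add mult_ac flip: ennreal_mult)
  finally show ?thesis .
qed

lemma simplex_region_measurable [measurable]:
  "(\<lambda>x. indicator (simplex_region d) x :: real) \<in> borel_measurable (PiM {1..d} (\<lambda>_. lborel))"
proof -
  have "(\<lambda>x. indicator (simplex_region d) x :: real) =
    (\<lambda>x. if (\<forall>i\<in>{1..d}. 0 \<le> x i) \<and> (\<Sum>i\<in>{1..d}. x i) \<le> 1 then 1 else 0)"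
    by (rule ext) (simp add: simplex_region_def indicator_def)
  then show ?thesis by simp
qed

lemma jacobi_weight_measurable [measurable]:
  "jacobi_weight d \<kappa> \<in> borel_measurable (PiM {1..d} (\<lambda>_. lborel))"
  unfolding jacobi_weight_def[abs_def] by measurable

lemma jacobi_weight_nonneg: "jacobi_weight d \<kappa> x \<ge> 0"
  by (auto simp: jacobi_weight_def intro!: mult_nonneg_nonneg prod_nonneg)

text \<open>
  Integrating out the last coordinate merges the last two exponents into \<open>a + b + 1\<close>, which
  reduces \<open>d + 1\<close> to \<open>d\<close>.
\<close>

lemma nn_integral_jacobi_weight:
  assumes "\<And>i. i \<in> {1..d+1} \<Longrightarrow> \<kappa> i > -1"
  shows "(\<integral>\<^sup>+x. ennreal (indicator (simplex_region d) x * jacobi_weight d \<kappa> x) \<partial>PiM {1..d} (\<lambda>_. lborel)) =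
    ennreal ((\<Prod>i=1..d+1. Gamma (\<kappa> i + 1)) / Gamma ((\<Sum>i=1..d+1. \<kappa> i) + real d + 1))"
  using assms
proof (induction d arbitrary: \<kappa>)
  \<comment> \<open>In dimension 0 the product space has one point, the weight is
    \<open>1 powr \<kappa> 1 = 1\<close>, and both Gamma values coincide.\<close>
  case 0
  interpret product_sigma_finite "\<lambda>_::nat. lborel :: real measure" ..
  have "Gamma (\<kappa> 1 + 1) > 0" using 0[of 1] by (intro Gamma_real_pos) simp
  then show ?case
    by (simp add: PiM_empty simplex_region_def jacobi_weight_def)
next
  case (Suc d)
  interpret product_sigma_finite "\<lambda>_::nat. lborel :: real measure" ..
  define a b where "a = \<kappa> (Suc d)" and "b = \<kappa> (Suc (Suc d))"
  have ab: "a > -1" "b > -1" using Suc.prems by (auto simp: a_def b_def)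
  define \<kappa>' where "\<kappa>' = \<kappa>(Suc d := a + b + 1)"
  have \<kappa>': "\<kappa>' i > -1" if "i \<in> {1..d+1}" for i
    using that Suc.prems[of i] ab by (auto simp: \<kappa>'_def)
  have Beta: "Beta (a + 1) (b + 1) \<ge> 0"
    using ab by (auto simp: Beta_def intro!: divide_nonneg_nonneg mult_nonneg_nonneg Gamma_real_nonneg)
  have ins: "{1..Suc d} = insert (Suc d) {1..d}" by auto
  let ?f = "\<lambda>x. ennreal (indicator (simplex_region (Suc d)) x * jacobi_weight (Suc d) \<kappa> x)"
  have upd: "(\<Prod>i=1..d. (x(Suc d := y)) i powr \<kappa> i) = (\<Prod>i=1..d. x i powr \<kappa> i)"
    "(\<Sum>i=1..d. (x(Suc d := y)) i) = (\<Sum>i=1..d. x i)" for x :: "nat \<Rightarrow> real" and y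
    by (auto intro!: prod.cong sum.cong)
  have meas: "?f \<in> borel_measurable (PiM {1..Suc d} (\<lambda>_. lborel))"
    by measurable
  have "integral\<^sup>N (PiM {1..Suc d} (\<lambda>_. lborel)) ?f =
      (\<integral>\<^sup>+x. (\<integral>\<^sup>+y. ?f (x(Suc d := y)) \<partial>lborel) \<partial>PiM {1..d} (\<lambda>_. lborel))"
    using product_nn_integral_insert[of "{1..d}" "Suc d" ?f] meas unfolding ins by simp
  also have "\<dots> = (\<integral>\<^sup>+x. ennreal (Beta (a + 1) (b + 1)) *
      ennreal (indicator (simplex_region d) x * jacobi_weight d \<kappa>' x) \<partial>PiM {1..d} (\<lambda>_. lborel))"
  proof (rule nn_integral_cong)
    fix x :: "nat \<Rightarrow> real"
    define r where "r = 1 - (\<Sum>i=1..d. x i)"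
    define P where "P = (\<Prod>i=1..d. x i powr \<kappa> i)"
    have P: "P \<ge> 0" unfolding P_def by (intro prod_nonneg) auto
    have P': "P = (\<Prod>i=1..d. x i powr \<kappa>' i)"
      unfolding P_def by (intro prod.cong) (auto simp: \<kappa>'_def)
    have w: "jacobi_weight d \<kappa>' x = P * r powr (a + b + 1)"
      by (simp add: jacobi_weight_def P' r_def) (simp add: \<kappa>'_def)
    show "(\<integral>\<^sup>+y. ?f (x(Suc d := y)) \<partial>lborel) = ennreal (Beta (a + 1) (b + 1)) *
      ennreal (indicator (simplex_region d) x * jacobi_weight d \<kappa>' x)"
    proof (cases "x \<in> simplex_region d")
      case False
      have "x(Suc d := y) \<notin> simplex_region (Suc d)" for y
      proof
        assume "x(Suc d := y) \<in> simplex_region (Suc d)"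
        then have *: "\<forall>i\<in>{1..Suc d}. 0 \<le> (x(Suc d := y)) i" "(\<Sum>i=1..d. x i) + y \<le> 1"
          using upd(2)[of x y] by (auto simp: simplex_region_def)
        from *(1) have "0 \<le> y" by (auto dest: bspec[of _ _ "Suc d"])
        moreover have "\<forall>i\<in>{1..d}. 0 \<le> x i"
          using *(1) by (metis atLeastAtMost_iff fun_upd_apply le_SucI not_less_eq_eq order_refl)
        ultimately show False using False *(2) by (simp add: simplex_region_def)
      qed
      then show ?thesis using False by simp
    next
      case True
      then have r: "r \<ge> 0" by (simp add: simplex_region_def r_def)
      have "x(Suc d := y) \<in> simplex_region (Suc d) \<longleftrightarrow> y \<in> {0..r}" for y
        using True upd(2)[of x y] by (auto simp: simplex_region_def r_def)
      then have "?f (x(Suc d := y)) = ennreal P * ennreal (indicator {0..r} y * (y powr a * (r - y) powr b))" for y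
        using upd[of x y] P
        by (auto simp: jacobi_weight_def indicator_def r_def P_def a_def b_def algebra_simps simp flip: ennreal_mult)
      then have "(\<integral>\<^sup>+y. ?f (x(Suc d := y)) \<partial>lborel) =
          (\<integral>\<^sup>+y. ennreal P * ennreal (indicator {0..r} y * (y powr a * (r - y) powr b)) \<partial>lborel)"
        by simp
      also have "\<dots> = ennreal P * (\<integral>\<^sup>+y. ennreal (indicator {0..r} y * (y powr a * (r - y) powr b)) \<partial>lborel)"
        by (rule nn_integral_cmult) auto
      also have "\<dots> = ennreal P * ennreal (Beta (a + 1) (b + 1) * r powr (a + b + 1))"
        by (simp only: nn_integral_Beta_scaled[OF ab r])
      also have "\<dots> = ennreal (Beta (a + 1) (b + 1)) * ennreal (indicator (simplex_region d) x * jacobi_weight d \<kappa>' x)"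
        using True P Beta by (simp add: w mult_ac flip: ennreal_mult')
      finally show ?thesis .
    qed
  qed
  also have "\<dots> = ennreal (Beta (a + 1) (b + 1)) *
      (\<integral>\<^sup>+x. ennreal (indicator (simplex_region d) x * jacobi_weight d \<kappa>' x) \<partial>PiM {1..d} (\<lambda>_. lborel))"
    by (rule nn_integral_cmult) measurable
  also have "\<dots> = ennreal (Beta (a + 1) (b + 1)) *
      ennreal ((\<Prod>i=1..d+1. Gamma (\<kappa>' i + 1)) / Gamma ((\<Sum>i=1..d+1. \<kappa>' i) + real d + 1))"
    by (simp only: Suc.IH[OF \<kappa>'])
  also have "\<dots> = ennreal (Beta (a + 1) (b + 1) *
      ((\<Prod>i=1..d+1. Gamma (\<kappa>' i + 1)) / Gamma ((\<Sum>i=1..d+1. \<kappa>' i) + real d + 1)))"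
    using Beta by (simp only: ennreal_mult')
  also have "(\<Prod>i=1..d+1. Gamma (\<kappa>' i + 1)) = (\<Prod>i=1..d. Gamma (\<kappa> i + 1)) * Gamma (a + b + 2)"
    by (simp add: \<kappa>'_def add_ac)
  also have "(\<Sum>i=1..d+1. \<kappa>' i) = (\<Sum>i=1..d. \<kappa> i) + a + b + 1"
    by (simp add: \<kappa>'_def)
  \<comment> \<open>The value \<open>Gamma (a + b + 2)\<close> contributed by the merged exponent is
    the denominator of the Beta factor, which restores the two separate Gamma factors.\<close>
  also have "Beta (a + 1) (b + 1) * ((\<Prod>i=1..d. Gamma (\<kappa> i + 1)) * Gamma (a + b + 2) /
      Gamma ((\<Sum>i=1..d. \<kappa> i) + a + b + 1 + real d + 1)) =
      (\<Prod>i=1..Suc d+1. Gamma (\<kappa> i + 1)) / Gamma ((\<Sum>i=1..Suc d+1. \<kappa> i) + real (Suc d) + 1)"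
  proof -
    have "Gamma (a + b + 2) > 0" using ab by (intro Gamma_real_pos) simp
    moreover have "a + 1 + (b + 1) = a + b + 2" by simp
    ultimately show ?thesis
      by (simp add: Beta_def a_def b_def algebra_simps)
  qed
  finally show ?case .
qed

text \<open>A barycentric monomial only raises the exponents of the weight, so each moment is the
  total mass for shifted parameters. The convention \<open>0 powr _ = 0\<close> keeps the identity
  true on the boundary.\<close>

lemma barycentric_power_weight:
  assumes "x \<in> simplex_region d"
  shows "monomial (d + 1) (barycentric d x) \<alpha> * jacobi_weight d \<kappa> x =
    jacobi_weight d (\<lambda>i. \<kappa> i + real (\<alpha> i)) x"
proof -
  have *: "t ^ k * t powr a = t powr (a + real k)" if "t \<ge> 0" for t a :: real and k
    using that by (cases "t = 0") (auto simp: powr_add powr_realpow)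
  have "(\<Prod>i=1..d. barycentric d x i ^ \<alpha> i) = (\<Prod>i=1..d. x i ^ \<alpha> i)"
    by (intro prod.cong) (auto simp: barycentric_def)
  then have "monomial (d + 1) (barycentric d x) \<alpha> =
      (\<Prod>i=1..d. x i ^ \<alpha> i) * (1 - (\<Sum>i=1..d. x i)) ^ \<alpha> (d + 1)"
    by (simp add: monomial_def) (simp add: barycentric_def)
  then have "monomial (d + 1) (barycentric d x) \<alpha> * jacobi_weight d \<kappa> x =
    (\<Prod>i=1..d. x i ^ \<alpha> i * x i powr \<kappa> i) *
    ((1 - (\<Sum>i=1..d. x i)) ^ \<alpha> (d + 1) * (1 - (\<Sum>i=1..d. x i)) powr \<kappa> (d + 1))"
    by (simp add: jacobi_weight_def prod.distrib mult_ac)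
  also have "\<dots> = jacobi_weight d (\<lambda>i. \<kappa> i + real (\<alpha> i)) x"
    unfolding jacobi_weight_def
    by (intro arg_cong2[of _ _ _ _ "(*)"] prod.cong refl *) (use assms in \<open>auto simp: simplex_region_def\<close>)
  finally show ?thesis .
qed

text \<open>The shifted total mass is divided by the unshifted one: each ratio
  \<open>Gamma (t + k) / Gamma t\<close> is the Pochhammer symbol \<open>(t)_k\<close>. Finiteness
  of the nonnegative integral turns the value into integrability.\<close>

lemma has_bochner_integral_monomial:
  assumes \<kappa>: "\<And>i. i \<in> {1..d+1} \<Longrightarrow> \<kappa> i > -1" and \<alpha>: "\<alpha> \<in> multi_index (d + 1) n"
  defines "\<sigma> \<equiv> (\<Sum>i=1..d+1. \<kappa> i) + real d + 1"
  shows "has_bochner_integral (PiM {1..d} (\<lambda>_. lborel))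
    (\<lambda>x. indicator (simplex_region d) x * (monomial (d + 1) (barycentric d x) \<alpha> * jacobi_weight d \<kappa> x))
    ((\<Prod>i=1..d+1. Gamma (\<kappa> i + 1)) / Gamma \<sigma> *
      (multi_pochhammer (d + 1) (\<lambda>i. \<kappa> i + 1) \<alpha> / pochhammer \<sigma> n))"
proof -
  let ?\<kappa> = "\<lambda>i. \<kappa> i + real (\<alpha> i)"
  have \<kappa>': "?\<kappa> i > -1" if "i \<in> {1..d+1}" for i
    using \<kappa>[OF that] by simp
  have npos: "x \<notin> \<int>\<^sub>\<le>\<^sub>0" if "x > 0" for x :: real
    using that by (auto elim!: nonpos_Ints_cases)
  have "(\<Sum>i=1..d+1. \<kappa> i + 1) > 0"
    by (rule sum_pos) (use \<kappa> in force)+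
  then have \<sigma>: "\<sigma> > 0" by (simp add: \<sigma>_def sum.distrib)
  have num: "(\<Prod>i=1..d+1. Gamma (?\<kappa> i + 1)) =
      (\<Prod>i=1..d+1. Gamma (\<kappa> i + 1)) * multi_pochhammer (d + 1) (\<lambda>i. \<kappa> i + 1) \<alpha>"
    unfolding multi_pochhammer_def prod.distrib[symmetric]
  proof (rule prod.cong)
    fix i assume i: "i \<in> {1..d+1}"
    have pos: "\<kappa> i + 1 > 0" using \<kappa>[OF i] by simp
    have eq: "?\<kappa> i + 1 = \<kappa> i + 1 + real (\<alpha> i)" by simp
    show "Gamma (?\<kappa> i + 1) = Gamma (\<kappa> i + 1) * pochhammer (\<kappa> i + 1) (\<alpha> i)"
      unfolding eq using Gamma_real_pos[OF pos] by (simp add: pochhammer_Gamma[OF npos[OF pos]])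
  qed simp
  have "(\<Sum>i=1..d+1. ?\<kappa> i) + real d + 1 = \<sigma> + real n"
    using \<alpha> by (simp add: \<sigma>_def multi_index_def sum.distrib flip: of_nat_sum)
  then have den: "Gamma ((\<Sum>i=1..d+1. ?\<kappa> i) + real d + 1) = Gamma \<sigma> * pochhammer \<sigma> n"
    using less_imp_neq[OF Gamma_real_pos[OF \<sigma>]] \<sigma> by (simp add: pochhammer_Gamma npos)
  have "(\<integral>\<^sup>+x. ennreal (indicator (simplex_region d) x * jacobi_weight d ?\<kappa> x) \<partial>PiM {1..d} (\<lambda>_. lborel)) =
      ennreal ((\<Prod>i=1..d+1. Gamma (\<kappa> i + 1)) / Gamma \<sigma> *
      (multi_pochhammer (d + 1) (\<lambda>i. \<kappa> i + 1) \<alpha> / pochhammer \<sigma> n))"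
    using nn_integral_jacobi_weight[of d ?\<kappa>, OF \<kappa>'] unfolding num den by simp
  moreover have "0 \<le> (\<Prod>i=1..d+1. Gamma (\<kappa> i + 1)) / Gamma \<sigma> *
      (multi_pochhammer (d + 1) (\<lambda>i. \<kappa> i + 1) \<alpha> / pochhammer \<sigma> n)"
  proof (intro mult_nonneg_nonneg divide_nonneg_nonneg prod_nonneg)
    show "0 \<le> Gamma (\<kappa> i + 1)" if "i \<in> {1..d+1}" for i
      using \<kappa>[OF that] by (intro Gamma_real_nonneg) simp
    show "0 \<le> multi_pochhammer (d + 1) (\<lambda>i. \<kappa> i + 1) \<alpha>"
      by (intro less_imp_le[OF multi_pochhammer_pos]) (use \<kappa> in force)
  qed (use \<sigma> in \<open>auto intro: pochhammer_nonneg Gamma_real_nonneg\<close>)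
  ultimately have "has_bochner_integral (PiM {1..d} (\<lambda>_. lborel))
    (\<lambda>x. indicator (simplex_region d) x * jacobi_weight d ?\<kappa> x)
    ((\<Prod>i=1..d+1. Gamma (\<kappa> i + 1)) / Gamma \<sigma> *
      (multi_pochhammer (d + 1) (\<lambda>i. \<kappa> i + 1) \<alpha> / pochhammer \<sigma> n))"
    by (intro has_bochner_integral_nn_integral borel_measurable_times
          simplex_region_measurable jacobi_weight_measurable)
       (auto intro!: mult_nonneg_nonneg jacobi_weight_nonneg)
  also have "(\<lambda>x. indicator (simplex_region d) x * jacobi_weight d ?\<kappa> x) =
     (\<lambda>x. indicator (simplex_region d) x * (monomial (d + 1) (barycentric d x) \<alpha> * jacobi_weight d \<kappa> x))"
  proof
    fix x
    show "indicator (simplex_region d) x * jacobi_weight d ?\<kappa> x = indicator (simplex_region d) x *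
        (monomial (d + 1) (barycentric d x) \<alpha> * jacobi_weight d \<kappa> x)"
    proof (cases "x \<in> simplex_region d")
      case True
      then show ?thesis by (simp only: barycentric_power_weight)
    qed simp
  qed
  finally show ?thesis .
qed

lemma monomial_mult: "monomial m y \<alpha> * monomial m y \<beta> = monomial m y (\<lambda>i. \<alpha> i + \<beta> i)"
  by (simp add: monomial_def power_add prod.distrib)

text \<open>With both polynomials homogenized to the same degree, all moments that occur have degree
  \<open>n + n\<close> and share one denominator; the Gamma factors cancel against the
  normalization.\<close>

lemma jacobi_inner_hom_eval:
  assumes \<kappa>: "\<forall>i\<in>{1..d+1}. \<kappa> i > -1"
    and f: "\<And>x. f x = hom_eval (d + 1) n u (barycentric d x)"
    and g: "\<And>x. g x = hom_eval (d + 1) n v (barycentric d x)"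
  shows "jacobi_inner d \<kappa> f g =
    (\<Sum>\<alpha>\<in>multi_index (d + 1) n. \<Sum>\<beta>\<in>multi_index (d + 1) n.
      u \<alpha> * v \<beta> * multi_pochhammer (d + 1) (\<lambda>i. \<kappa> i + 1) (\<lambda>i. \<alpha> i + \<beta> i)) /
    pochhammer ((\<Sum>i=1..d+1. \<kappa> i) + real d + 1) (n + n)"
proof -
  define \<sigma> where "\<sigma> = (\<Sum>i=1..d+1. \<kappa> i) + real d + 1"
  define G where "G = (\<Prod>i=1..d+1. Gamma (\<kappa> i + 1))"
  define S where "S = (\<Sum>\<alpha>\<in>multi_index (d + 1) n. \<Sum>\<beta>\<in>multi_index (d + 1) n.
      u \<alpha> * v \<beta> * multi_pochhammer (d + 1) (\<lambda>i. \<kappa> i + 1) (\<lambda>i. \<alpha> i + \<beta> i))"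
  have "(\<Sum>i=1..d+1. \<kappa> i + 1) > 0"
    by (rule sum_pos) (use \<kappa> in force)+
  then have \<sigma>: "\<sigma> > 0" by (simp add: \<sigma>_def sum.distrib)
  have G: "G > 0" unfolding G_def
    by (intro prod_pos) (use \<kappa> in \<open>force intro: Gamma_real_pos\<close>)
  let ?m = "\<lambda>\<alpha> \<beta> x. indicator (simplex_region d) x *
    (monomial (d + 1) (barycentric d x) (\<lambda>i. \<alpha> i + \<beta> i) * jacobi_weight d \<kappa> x)"
  have "has_bochner_integral (PiM {1..d} (\<lambda>_. lborel))
      (\<lambda>x. \<Sum>\<alpha>\<in>multi_index (d + 1) n. \<Sum>\<beta>\<in>multi_index (d + 1) n. (u \<alpha> * v \<beta>) * ?m \<alpha> \<beta> x)
      (\<Sum>\<alpha>\<in>multi_index (d + 1) n. \<Sum>\<beta>\<in>multi_index (d + 1) n. (u \<alpha> * v \<beta>) *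
        (G / Gamma \<sigma> * (multi_pochhammer (d + 1) (\<lambda>i. \<kappa> i + 1) (\<lambda>i. \<alpha> i + \<beta> i) / pochhammer \<sigma> (n + n))))"
    unfolding G_def \<sigma>_def
    by (intro has_bochner_integral_sum has_bochner_integral_mult_right has_bochner_integral_monomial bspec[OF \<kappa>])
       (auto simp: multi_index_def sum.distrib)
  also have "(\<lambda>x. \<Sum>\<alpha>\<in>multi_index (d + 1) n. \<Sum>\<beta>\<in>multi_index (d + 1) n. (u \<alpha> * v \<beta>) * ?m \<alpha> \<beta> x) =
     (\<lambda>x. indicator (simplex_region d) x *\<^sub>R (f x * g x * jacobi_weight d \<kappa> x))"
    unfolding f g hom_eval_def sum_product
    by (rule ext) (simp add: sum_distrib_left sum_distrib_right mult_ac flip: monomial_mult)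
  also have "(\<Sum>\<alpha>\<in>multi_index (d + 1) n. \<Sum>\<beta>\<in>multi_index (d + 1) n. (u \<alpha> * v \<beta>) *
        (G / Gamma \<sigma> * (multi_pochhammer (d + 1) (\<lambda>i. \<kappa> i + 1) (\<lambda>i. \<alpha> i + \<beta> i) / pochhammer \<sigma> (n + n)))) =
      G / Gamma \<sigma> * (S / pochhammer \<sigma> (n + n))"
    unfolding S_def by (simp add: sum_distrib_left sum_divide_distrib mult_ac)
  finally have "(LINT x:simplex_region d|PiM {1..d} (\<lambda>_. lborel). f x * g x * jacobi_weight d \<kappa> x) =
      G / Gamma \<sigma> * (S / pochhammer \<sigma> (n + n))"
    unfolding set_lebesgue_integral_def by (rule has_bochner_integral_integral_eq)
  then have "jacobi_inner d \<kappa> f g = Gamma \<sigma> / G * (G / Gamma \<sigma> * (S / pochhammer \<sigma> (n + n)))"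
    unfolding jacobi_inner_def by (simp add: \<sigma>_def G_def)
  also have "\<dots> = S / pochhammer \<sigma> (n + n)"
    using G Gamma_real_pos[OF \<sigma>] by simp
  finally show ?thesis by (simp add: S_def \<sigma>_def)
qed

section \<open>Jacobi polynomials as harmonic forms\<close>

definition jacobi_coeff :: "nat \<Rightarrow> real \<Rightarrow> real \<Rightarrow> nat \<Rightarrow> real" where
  "jacobi_coeff m a b k = pochhammer (- real m) k * pochhammer (real m + a + b + 1) k /
     (pochhammer (a + 1) k * fact k)"

text \<open>The hypergeometric term ratio with denominators cleared, arranged as the cancellation of
  neighbouring terms in \<open>Lap_jacobi_op\<close>.\<close>

lemma jacobi_coeff_Suc:
  assumes "a > -1"
  shows "jacobi_coeff m a b (Suc k) * (real k + 1) * (a + 1 + real k) =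
    - jacobi_coeff m a b k * (real m - real k) * (real m + real k + a + b + 1)"
proof -
  have cancel: "P * p * (Q * q) / (R * x * (y * F)) * y * x = - (P * Q / (R * F)) * (- p) * q"
    if "x > 0" "y > 0" for P p Q q R x y F :: real
    using that by simp
  have "a + 1 + real k > 0" "real k + 1 > 0" using assms by simp_all
  from cancel[OF this] show ?thesis
    unfolding jacobi_coeff_def pochhammer_Suc fact_Suc of_nat_Suc
    by (simp only: minus_diff_eq minus_add_distrib uminus_add_conv_diff minus_minus add_ac diff_conv_add_uminus)
qed

text \<open>This makes the passage from Jacobi factors to powers triangular with invertible
  diagonal. The case \<open>m = 0\<close> stands apart because \<open>a + b + 1\<close> may be
  negative; for \<open>m \<ge> 1\<close> the parameter \<open>m + a + b + 1\<close> is
  positive.\<close>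

lemma jacobi_coeff_diag_nonzero:
  assumes "a > -1" "b > -1"
  shows "jacobi_coeff m a b m \<noteq> 0"
proof (cases m)
  case 0
  then show ?thesis by (simp add: jacobi_coeff_def)
next
  case (Suc m')
  have "pochhammer (- real m) m \<noteq> 0"
    by (simp add: pochhammer_eq_0_iff)
  moreover have "pochhammer (a + 1) m > 0" using assms by (intro pochhammer_pos) simp
  moreover have "pochhammer (real m + a + b + 1) m > 0"
    using assms by (intro pochhammer_pos) (simp add: Suc)
  ultimately show ?thesis by (simp add: jacobi_coeff_def)
qed

section \<open>Adjoining one variable to a harmonic form\<close>

definition homogeneous_on :: "nat set \<Rightarrow> nat \<Rightarrow> ((nat \<Rightarrow> nat) \<Rightarrow> real) \<Rightarrow> bool" where
  "homogeneous_on J r c \<longleftrightarrow> (\<forall>\<alpha>. c \<alpha> \<noteq> 0 \<longrightarrow> sum \<alpha> J = r)"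

lemma homogeneous_on_shifts:
  assumes "finite K" "J \<subseteq> K" "homogeneous_on K r c"
  shows "homogeneous_on K (Suc r) (shifts J c)"
  unfolding homogeneous_on_def
proof (intro allI impI)
  fix \<alpha> assume "shifts J c \<alpha> \<noteq> 0"
  then obtain i where i: "i \<in> J" "shift i c \<alpha> \<noteq> 0"
    unfolding shifts_def by (rule sum.not_neutral_contains_not_neutral)
  then have *: "\<alpha> i \<noteq> 0" "c (\<alpha>(i := \<alpha> i - 1)) \<noteq> 0" by (auto simp: shift_def split: if_splits)
  have "sum (\<alpha>(i := \<alpha> i - 1)) K = r"
    using assms(3) *(2) unfolding homogeneous_on_def by blast
  then show "sum \<alpha> K = Suc r"
    using sum_inc[of K i "\<alpha>(i := \<alpha> i - 1)"] * i assms by auto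
qed

lemma homogeneous_on_shifts_pow:
  assumes "finite K" "J \<subseteq> K" "homogeneous_on K r c"
  shows "homogeneous_on K (r + k) ((shifts J ^^ k) c)"
  by (induction k) (auto simp: assms intro!: homogeneous_on_shifts[OF assms(1,2)])

lemma homogeneous_on_mult_degree:
  "homogeneous_on J r c \<Longrightarrow> f (sum \<alpha> J) * c \<alpha> = f r * c \<alpha>"
  by (cases "c \<alpha> = 0") (auto simp: homogeneous_on_def)

text \<open>Moving the lowering operator past \<open>k\<close> raising operators collects the
  weights \<open>2 (r + i) + A\<close> for \<open>i < k\<close>, where \<open>A\<close> is the sum
  of the \<open>\<kappa> i + 1\<close>; their sum is \<open>k (2 r + A + k - 1)\<close>.\<close>

lemma Lap_shifts_pow:
  assumes J: "finite J" and c: "homogeneous_on J r c"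
  shows "Lap \<kappa> J ((shifts J ^^ k) c) = (\<lambda>\<alpha>. (shifts J ^^ k) (Lap \<kappa> J c) \<alpha> +
    real k * (2 * real r + (\<Sum>i\<in>J. \<kappa> i + 1) + real k - 1) * (shifts J ^^ (k - 1)) c \<alpha>)"
proof (induction k)
  case (Suc k)
  let ?A = "\<Sum>i\<in>J. \<kappa> i + 1" and ?S = "shifts J"
  have deg: "(2 * real (sum \<alpha> J) + ?A) * (?S ^^ k) c \<alpha> = (2 * real (r + k) + ?A) * (?S ^^ k) c \<alpha>" for \<alpha>
    using homogeneous_on_mult_degree[OF homogeneous_on_shifts_pow[OF J order.refl c], of "\<lambda>n. 2 * real n + ?A"] .
  have 1: "Lap \<kappa> J ((?S ^^ Suc k) c) = (\<lambda>\<alpha>. ?S (Lap \<kappa> J ((?S ^^ k) c)) \<alpha> +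
      (2 * real (r + k) + ?A) * (?S ^^ k) c \<alpha>)"
    unfolding funpow.simps o_apply Lap_shifts[OF J] deg ..
  \<comment> \<open>The truncated exponent \<open>k - 1\<close> is harmless: at \<open>k = 0\<close>
    the scalar in front is 0.\<close>
  have 2: "real k * x * ?S ((?S ^^ (k - 1)) c) \<alpha> = real k * x * (?S ^^ k) c \<alpha>" for x \<alpha>
    by (cases k) auto
  show ?case
    unfolding 1 Suc.IH shifts_add shifts_scale 2 by (rule ext) (simp add: algebra_simps)
qed simp

lemma Lap_insert:
  "finite J \<Longrightarrow> j \<notin> J \<Longrightarrow> Lap \<kappa> (insert j J) c = (\<lambda>\<alpha>. Lap \<kappa> {j} c \<alpha> + Lap \<kappa> J c \<alpha>)"
  by (rule ext) (simp add: Lap_def)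

lemma Lap_shifts_pow_disjoint:
  "I \<inter> J = {} \<Longrightarrow> Lap \<kappa> I ((shifts J ^^ k) c) = (shifts J ^^ k) (Lap \<kappa> I c)"
  by (induction k) (auto simp: Lap_shifts_disjoint)

lemma shifts_pow_zero: "(shifts J ^^ k) (\<lambda>_. 0) = (\<lambda>_. 0)"
  by (induction k) (auto simp: shifts_zero)

lemma shifts_pow_scale: "(shifts J ^^ k) (\<lambda>\<alpha>. a * f \<alpha>) = (\<lambda>\<alpha>. a * (shifts J ^^ k) f \<alpha>)"
  by (induction k) (auto simp: shifts_scale)

text \<open>Multiplication by a homogenized Jacobi factor: \<open>shifts K\<close> plays the role of
  \<open>s\<close> and \<open>shifts J\<close> that of \<open>s - u\<close> in
  \<open>jacobi_homogenized\<close>.\<close>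

definition jacobi_op :: "nat \<Rightarrow> real \<Rightarrow> real \<Rightarrow> nat set \<Rightarrow> nat set \<Rightarrow>
    ((nat \<Rightarrow> nat) \<Rightarrow> real) \<Rightarrow> (nat \<Rightarrow> nat) \<Rightarrow> real" where
  "jacobi_op m a b K J c =
    (\<lambda>\<alpha>. \<Sum>k\<le>m. jacobi_coeff m a b k * (shifts K ^^ (m - k)) ((shifts J ^^ k) c) \<alpha>)"

text \<open>With \<open>S\<close> and \<open>T\<close> the sums over \<open>K\<close> and
  \<open>J\<close>, the operator sends \<open>S^(m-k) T^k c\<close> to a combination of the same
  product with one \<open>T\<close> fewer and with one \<open>S\<close> fewer. Terms belonging to
  neighbouring \<open>k\<close> coincide and cancel by the hypergeometric recurrence, because
  \<open>a + 1\<close> is the weight of \<open>c\<close>.\<close>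

lemma Lap_jacobi_op:
  assumes J: "finite J" "j \<notin> J" and K: "K = insert j J"
    and c: "homogeneous_on J r c" "homogeneous_on K r c" "Lap \<kappa> J c = (\<lambda>_. 0)" "Lap \<kappa> {j} c = (\<lambda>_. 0)"
    and a: "a = 2 * real r + (\<Sum>i\<in>J. \<kappa> i + 1) - 1" "a > -1"
  shows "Lap \<kappa> K (jacobi_op m a (\<kappa> j) K J c) = (\<lambda>_. 0)"
proof -
  let ?b = "\<kappa> j" and ?S = "shifts K" and ?T = "shifts J"
  have finK: "finite K" and JK: "J \<subseteq> K" using J K by auto
  \<comment> \<open>The part of the operator in the new variable \<open>j\<close> passes through the
    powers of \<open>T\<close> and kills \<open>c\<close>; only the part over \<open>J\<close>
    contributes.\<close>
  have "Lap \<kappa> K ((?T ^^ k) c) = (\<lambda>\<alpha>. real k * (a + real k) * (?T ^^ (k - 1)) c \<alpha>)" for k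
    unfolding K Lap_insert[OF J] using J
    by (simp add: Lap_shifts_pow[OF J(1) c(1)] Lap_shifts_pow_disjoint c shifts_pow_zero a algebra_simps)
  then have L: "Lap \<kappa> K ((?S ^^ (m - k)) ((?T ^^ k) c)) \<alpha> =
      real k * (a + real k) * (?S ^^ (m - k)) ((?T ^^ (k - 1)) c) \<alpha> +
      (real m - real k) * (real m + real k + a + ?b + 1) * (?S ^^ (m - k - 1)) ((?T ^^ k) c) \<alpha>"
    if "k \<le> m" for k \<alpha>
  proof -
    assume T: "\<And>k. Lap \<kappa> K ((?T ^^ k) c) = (\<lambda>\<alpha>. real k * (a + real k) * (?T ^^ (k - 1)) c \<alpha>)"
    \<comment> \<open>In the larger set \<open>T^k c\<close> has degree \<open>r + k\<close>, and
      the new variable adds \<open>\<kappa> j + 1\<close> to the weight; this produces the second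
      upper parameter of the hypergeometric series.\<close>
    have "2 * real (r + k) + (\<Sum>i\<in>K. \<kappa> i + 1) + real (m - k) - 1 = real m + real k + a + ?b + 1"
      using that J by (simp add: K a of_nat_diff)
    then show ?thesis
      using that
      by (simp add: Lap_shifts_pow[OF finK homogeneous_on_shifts_pow[OF finK JK c(2)]] T shifts_pow_scale of_nat_diff)
  qed
  \<comment> \<open>The products \<open>S^(m-k-1) T^k c\<close> shared by the two sums. At
    \<open>k = m\<close> the exponent is truncated, but there the factor \<open>m - k\<close> is
    0.\<close>
  define X where "X k \<alpha> = (?S ^^ (m - k - 1)) ((?T ^^ k) c) \<alpha>" for k \<alpha>
  show ?thesis
  proof
    fix \<alpha>
    have "Lap \<kappa> K (jacobi_op m a ?b K J c) \<alpha> =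
       (\<Sum>k\<le>m. jacobi_coeff m a ?b k * (real k * (a + real k) * (?S ^^ (m - k)) ((?T ^^ (k - 1)) c) \<alpha>)) +
       (\<Sum>k\<le>m. jacobi_coeff m a ?b k * ((real m - real k) * (real m + real k + a + ?b + 1) * X k \<alpha>))"
      unfolding jacobi_op_def Lap_sum Lap_scale sum.distrib[symmetric] distrib_left[symmetric] X_def
      by (intro sum.cong) (simp_all add: L)
    also have "(\<Sum>k\<le>m. jacobi_coeff m a ?b k * (real k * (a + real k) * (?S ^^ (m - k)) ((?T ^^ (k - 1)) c) \<alpha>)) =
       (\<Sum>k<m. jacobi_coeff m a ?b (Suc k) * ((real k + 1) * (a + 1 + real k) * X k \<alpha>))"
      unfolding X_def lessThan_Suc_atMost[symmetric] sum.lessThan_Suc_shift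
      by (simp add: algebra_simps)
    also have "\<dots> = (\<Sum>k<m. - (jacobi_coeff m a ?b k * ((real m - real k) * (real m + real k + a + ?b + 1) * X k \<alpha>)))"
    proof (rule sum.cong)
      fix k
      show "jacobi_coeff m a ?b (Suc k) * ((real k + 1) * (a + 1 + real k) * X k \<alpha>) =
        - (jacobi_coeff m a ?b k * ((real m - real k) * (real m + real k + a + ?b + 1) * X k \<alpha>))"
        using arg_cong[OF jacobi_coeff_Suc[OF a(2), of m ?b k], of "\<lambda>t. t * X k \<alpha>"] by (simp add: mult_ac)
    qed simp
    also have "(\<Sum>k\<le>m. jacobi_coeff m a ?b k * ((real m - real k) * (real m + real k + a + ?b + 1) * X k \<alpha>)) =
      (\<Sum>k<m. jacobi_coeff m a ?b k * ((real m - real k) * (real m + real k + a + ?b + 1) * X k \<alpha>))"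
      unfolding lessThan_Suc_atMost[symmetric] by simp
    finally show "Lap \<kappa> K (jacobi_op m a ?b K J c) \<alpha> = 0"
      by (simp add: sum_negf)
  qed
qed

lemma homogeneous_on_jacobi_op:
  assumes "finite L" "J \<subseteq> L" "K \<subseteq> L" "homogeneous_on L r c"
  shows "homogeneous_on L (r + m) (jacobi_op m a b K J c)"
  unfolding homogeneous_on_def
proof (intro allI impI)
  fix \<alpha> assume "jacobi_op m a b K J c \<alpha> \<noteq> 0"
  then obtain k where "k \<in> {..m}" "jacobi_coeff m a b k * (shifts K ^^ (m - k)) ((shifts J ^^ k) c) \<alpha> \<noteq> 0"
    unfolding jacobi_op_def by (rule sum.not_neutral_contains_not_neutral)
  then have k: "k \<le> m" "(shifts K ^^ (m - k)) ((shifts J ^^ k) c) \<alpha> \<noteq> 0"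
    by auto
  have "homogeneous_on L (r + k + (m - k)) ((shifts K ^^ (m - k)) ((shifts J ^^ k) c))"
    by (intro homogeneous_on_shifts_pow assms)
  then show "sum \<alpha> L = r + m" using k by (simp add: homogeneous_on_def)
qed

lemma hom_eval_jacobi_op:
  assumes "J \<subseteq> {1..M}" "K \<subseteq> {1..M}" "(\<Sum>i\<in>J. y i) = (\<Sum>i\<in>K. y i) - u"
  shows "hom_eval M (n + m) (jacobi_op m a b K J c) y =
    jacobi_homogenized m a b (\<Sum>i\<in>K. y i) u * hom_eval M n c y"
  unfolding jacobi_op_def hom_eval_sum hom_eval_scale jacobi_homogenized_def sum_distrib_right
proof (rule sum.cong)
  fix k assume "k \<in> {..m}"
  then have eq: "n + m = n + k + (m - k)" by simp
  show "jacobi_coeff m a b k * hom_eval M (n + m) ((shifts K ^^ (m - k)) ((shifts J ^^ k) c)) y =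
    pochhammer (- real m) k * pochhammer (real m + a + b + 1) k / (pochhammer (a + 1) k * fact k) *
    ((\<Sum>i\<in>K. y i) - u) ^ k * (\<Sum>i\<in>K. y i) ^ (m - k) * hom_eval M n c y"
    unfolding eq hom_eval_shifts_pow[OF assms(2)] hom_eval_shifts_pow[OF assms(1)] assms(3)
    by (simp add: jacobi_coeff_def)
qed simp

text \<open>
  The lower-order term is chosen to make the operator commute with \<open>shifts J\<close>, hence with
  \<open>jacobi_op\<close> for all larger index sets.
\<close>

definition casimir :: "(nat \<Rightarrow> real) \<Rightarrow> nat set \<Rightarrow> ((nat \<Rightarrow> nat) \<Rightarrow> real) \<Rightarrow> (nat \<Rightarrow> nat) \<Rightarrow> real" where
  "casimir \<kappa> J c \<alpha> = shifts J (Lap \<kappa> J c) \<alpha> -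
    real (sum \<alpha> J) * (real (sum \<alpha> J) + (\<Sum>i\<in>J. \<kappa> i + 1) - 1) * c \<alpha>"

lemma casimir_sum:
  "finite A \<Longrightarrow> casimir \<kappa> J (\<lambda>\<alpha>. \<Sum>x\<in>A. f x \<alpha>) = (\<lambda>\<alpha>. \<Sum>x\<in>A. casimir \<kappa> J (f x) \<alpha>)"
  unfolding casimir_def[abs_def] Lap_sum shifts_sum by (simp add: sum_subtractf sum_distrib_left)

lemma casimir_scale: "casimir \<kappa> J (\<lambda>\<alpha>. a * f \<alpha>) = (\<lambda>\<alpha>. a * casimir \<kappa> J f \<alpha>)"
  unfolding casimir_def[abs_def] Lap_scale shifts_scale by (simp add: algebra_simps)

lemma casimir_add: "casimir \<kappa> J (\<lambda>\<alpha>. f \<alpha> + g \<alpha>) = (\<lambda>\<alpha>. casimir \<kappa> J f \<alpha> + casimir \<kappa> J g \<alpha>)"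
  unfolding casimir_def[abs_def] Lap_add shifts_add by (simp add: algebra_simps)

lemma casimir_shift_notin:
  assumes "i \<notin> J"
  shows "casimir \<kappa> J (shift i c) = shift i (casimir \<kappa> J c)"
proof
  fix \<alpha> :: "nat \<Rightarrow> nat"
  have "sum (\<alpha>(i := \<alpha> i - 1)) J = sum \<alpha> J"
    using assms by (intro sum.cong) auto
  moreover have "shifts J (Lap \<kappa> J (shift i c)) = shift i (shifts J (Lap \<kappa> J c))"
    using assms by (simp add: Lap_shift_notin shift_shifts)
  ultimately show "casimir \<kappa> J (shift i c) \<alpha> = shift i (casimir \<kappa> J c) \<alpha>"
    by (simp add: casimir_def shift_def)
qed

text \<open>Multiplication by a linear form raises the degree by one, so a function of the degree
  passes it with its argument lowered. The argument is real to avoid truncation; at degree 0 both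
  sides vanish.\<close>

lemma shifts_mult_degree:
  assumes "finite J"
  shows "shifts J (\<lambda>\<alpha>. f (real (sum \<alpha> J)) * c \<alpha>) \<alpha> = f (real (sum \<alpha> J) - 1) * shifts J c \<alpha>"
  unfolding shifts_def sum_distrib_left
proof (rule sum.cong)
  fix i assume i: "i \<in> J"
  have "real (sum (\<alpha>(i := \<alpha> i - 1)) J) = real (sum \<alpha> J) - 1" if "\<alpha> i \<noteq> 0"
    using sum_inc[OF assms i, of "\<alpha>(i := \<alpha> i - 1)"] that by simp
  then show "shift i (\<lambda>\<alpha>. f (real (sum \<alpha> J)) * c \<alpha>) \<alpha> = f (real (sum \<alpha> J) - 1) * shift i c \<alpha>"
    by (simp add: shift_def)
qed simp

text \<open>With \<open>e\<close> the degree and \<open>A\<close> the sum of the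
  \<open>\<kappa> i + 1\<close>, the quadratic term obeys
  \<open>e (e + A - 1) - (e - 1) (e + A - 2) = 2 (e - 1) + A\<close>, which is exactly the
  commutator of the lowering and raising operators.\<close>

lemma casimir_shifts_same:
  assumes J: "finite J"
  shows "casimir \<kappa> J (shifts J c) = shifts J (casimir \<kappa> J c)"
proof
  fix \<alpha>
  define A where "A = (\<Sum>i\<in>J. \<kappa> i + 1)"
  have eq: "casimir \<kappa> J c = (\<lambda>\<alpha>. shifts J (Lap \<kappa> J c) \<alpha> +
      (\<lambda>e. - (e * (e + A - 1))) (real (sum \<alpha> J)) * c \<alpha>)"
    by (rule ext) (simp add: casimir_def A_def)
  have "shifts J (casimir \<kappa> J c) \<alpha> = shifts J (shifts J (Lap \<kappa> J c)) \<alpha> +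
      (\<lambda>e. - (e * (e + A - 1))) (real (sum \<alpha> J) - 1) * shifts J c \<alpha>"
    unfolding eq shifts_add shifts_mult_degree[OF J, where f="\<lambda>e. - (e * (e + A - 1))"] ..
  moreover have "shifts J (Lap \<kappa> J (shifts J c)) \<alpha> = shifts J (shifts J (Lap \<kappa> J c)) \<alpha> +
      (2 * (real (sum \<alpha> J) - 1) + A) * shifts J c \<alpha>"
    unfolding Lap_shifts[OF J] A_def[symmetric] shifts_add
      shifts_mult_degree[OF J, where f="\<lambda>e. 2 * e + A"] ..
  ultimately show "casimir \<kappa> J (shifts J c) \<alpha> = shifts J (casimir \<kappa> J c) \<alpha>"
    unfolding casimir_def[of \<kappa> J "shifts J c"] A_def[symmetric] by (simp add: algebra_simps)
qed

lemma casimir_shifts: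
  assumes "finite K" "J \<subseteq> K"
  shows "casimir \<kappa> J (shifts K c) = shifts K (casimir \<kappa> J c)"
proof -
  have J: "finite J" using assms finite_subset by blast
  have split: "shifts K f = (\<lambda>\<alpha>. shifts J f \<alpha> + (\<Sum>i\<in>K-J. shift i f \<alpha>))" for f
    unfolding shifts_def using assms by (auto simp: sum.subset_diff[OF assms(2,1)] add.commute)
  have "casimir \<kappa> J (\<lambda>\<alpha>. \<Sum>i\<in>K-J. shift i c \<alpha>) = (\<lambda>\<alpha>. \<Sum>i\<in>K-J. shift i (casimir \<kappa> J c) \<alpha>)"
    using assms by (simp add: casimir_sum casimir_shift_notin)
  then show ?thesis
    unfolding split casimir_add casimir_shifts_same[OF J] by simp
qed

lemma casimir_shifts_pow:
  "finite K \<Longrightarrow> J \<subseteq> K \<Longrightarrow> casimir \<kappa> J ((shifts K ^^ k) c) = (shifts K ^^ k) (casimir \<kappa> J c)"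
  by (induction k) (auto simp: casimir_shifts)

lemma casimir_jacobi_op:
  assumes "finite K" "I \<subseteq> K" "finite J" "I \<subseteq> J"
  shows "casimir \<kappa> I (jacobi_op m a b K J c) = jacobi_op m a b K J (casimir \<kappa> I c)"
  unfolding jacobi_op_def using assms
  by (simp add: casimir_sum casimir_scale casimir_shifts_pow)

lemma jacobi_op_scale: "jacobi_op m a b K J (\<lambda>\<alpha>. x * c \<alpha>) = (\<lambda>\<alpha>. x * jacobi_op m a b K J c \<alpha>)"
  unfolding jacobi_op_def by (simp add: shifts_pow_scale sum_distrib_left mult_ac)

text \<open>The composition of \<open>shifts J\<close> with its own adjoint is self-adjoint, and the
  degree term is diagonal in the monomials, as is the form.\<close>

lemma fischer_casimir:
  assumes J: "J \<subseteq> {1..m}"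
  shows "fischer m \<kappa> n (casimir \<kappa> J u) v = fischer m \<kappa> n u (casimir \<kappa> J v)"
proof -
  define E where "E \<alpha> = real (sum \<alpha> J) * (real (sum \<alpha> J) + (\<Sum>i\<in>J. \<kappa> i + 1) - 1)" for \<alpha>
  have *: "fischer m \<kappa> n u (casimir \<kappa> J v) =
      fischer m \<kappa> n u (shifts J (Lap \<kappa> J v)) - fischer m \<kappa> n u (\<lambda>\<alpha>. E \<alpha> * v \<alpha>)" for u v
    unfolding casimir_def[abs_def] E_def[symmetric] fischer_def
    by (simp add: sum_subtractf algebra_simps)
  have "fischer m \<kappa> n u (shifts J (Lap \<kappa> J v)) = fischer m \<kappa> n v (shifts J (Lap \<kappa> J u))"
  proof (cases n)
    case 0
    then show ?thesis by (simp add: fischer_shifts_0[OF J])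
  next
    case (Suc n')
    then show ?thesis by (simp only: fischer_shifts[OF J] fischer_commute)
  qed
  moreover have "fischer m \<kappa> n u (\<lambda>\<alpha>. E \<alpha> * v \<alpha>) = fischer m \<kappa> n v (\<lambda>\<alpha>. E \<alpha> * u \<alpha>)"
    by (simp add: fischer_def mult_ac)
  ultimately show ?thesis
    by (simp add: * fischer_commute[of m \<kappa> n "casimir \<kappa> J u"])
qed

text \<open>The coefficients of the product of the factors \<open>j, \<dots>, d\<close> of the homogenized Jacobi polynomial.\<close>

function tail_coeff :: "nat \<Rightarrow> (nat \<Rightarrow> real) \<Rightarrow> (nat \<Rightarrow> nat) \<Rightarrow> nat \<Rightarrow> (nat \<Rightarrow> nat) \<Rightarrow> real" where
  "tail_coeff d \<kappa> \<nu> j =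
    (if j \<le> d then jacobi_op (\<nu> j) (jacobi_param d \<kappa> \<nu> j) (\<kappa> j) {j..d+1} {Suc j..d+1} (tail_coeff d \<kappa> \<nu> (Suc j))
     else (\<lambda>\<alpha>. if \<alpha> = (\<lambda>_. 0) then 1 else 0))"
  by auto
termination by (relation "Wellfounded.measure (\<lambda>(d, _, _, j). Suc d - j)") auto

declare tail_coeff.simps [simp del]

lemma tail_coeff_step:
  "j \<le> d \<Longrightarrow> tail_coeff d \<kappa> \<nu> j =
    jacobi_op (\<nu> j) (jacobi_param d \<kappa> \<nu> j) (\<kappa> j) {j..d+1} {Suc j..d+1} (tail_coeff d \<kappa> \<nu> (Suc j))"
  by (subst tail_coeff.simps) simp

lemma tail_coeff_base: "tail_coeff d \<kappa> \<nu> (Suc d) = (\<lambda>\<alpha>. if \<alpha> = (\<lambda>_. 0) then 1 else 0)"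
  by (subst tail_coeff.simps) simp

text \<open>The set \<open>L\<close> is arbitrary because the induction for harmonicity measures the
  same form both in its own tail and in the tail enlarged by one variable.\<close>

lemma tail_coeff_homogeneous:
  "j \<le> d + 1 \<Longrightarrow> finite L \<Longrightarrow> {j..d+1} \<subseteq> L \<Longrightarrow>
    homogeneous_on L (\<Sum>i=j..d. \<nu> i) (tail_coeff d \<kappa> \<nu> j)"
proof (induction j rule: inc_induct)
  case base
  then show ?case by (simp add: tail_coeff_base homogeneous_on_def)
next
  case (step n)
  have "homogeneous_on L ((\<Sum>i=Suc n..d. \<nu> i) + \<nu> n) (tail_coeff d \<kappa> \<nu> n)"
    unfolding tail_coeff_step[OF step(2)[unfolded Suc_eq_plus1[symmetric] less_Suc_eq_le]]
    by (intro homogeneous_on_jacobi_op step) (use step.prems in auto)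
  moreover have "(\<Sum>i=n..d. \<nu> i) = (\<Sum>i=Suc n..d. \<nu> i) + \<nu> n"
    using step(2) by (simp add: sum.atLeast_Suc_atMost)
  ultimately show ?case by simp
qed

lemma Lap_tail_coeff_below:
  "j \<le> d + 1 \<Longrightarrow> i < j \<Longrightarrow> Lap \<kappa> {i} (tail_coeff d \<kappa> \<nu> j) = (\<lambda>_. 0)"
proof (induction j rule: inc_induct)
  case base
  then show ?case
    by (auto simp: tail_coeff_base Lap_def lap_def fun_eq_iff)
next
  case (step n)
  then have n: "n \<le> d" by simp
  have "Lap \<kappa> {i} (tail_coeff d \<kappa> \<nu> (Suc n)) = (\<lambda>_. 0)" using step by simp
  then show ?case
    using step.prems
    by (simp add: tail_coeff_step[OF n] jacobi_op_def Lap_sum Lap_scale Lap_shifts_pow_disjoint shifts_pow_zero)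
qed

lemma tail_sum_pos:
  fixes \<kappa> :: "nat \<Rightarrow> real"
  assumes "\<forall>i\<in>{1..d+1}. \<kappa> i > -1" "j \<in> {1..d+1}"
  shows "(\<Sum>i=j..d+1. \<kappa> i + 1) > 0"
proof (rule sum_pos)
  fix i assume "i \<in> {j..d+1}"
  then have "i \<in> {1..d+1}" using assms(2) by auto
  from bspec[OF assms(1) this] show "0 < \<kappa> i + 1" by simp
qed (use assms in auto)

text \<open>The classical parameter is the lowest weight of the remaining tail minus one; its
  summand \<open>d - j\<close> turns the \<open>d + 1 - j\<close> exponents into
  \<open>\<kappa> i + 1\<close>, up to that one.\<close>

lemma jacobi_param_eq:
  assumes "j \<le> d"
  shows "jacobi_param d \<kappa> \<nu> j = 2 * real (\<Sum>i=Suc j..d. \<nu> i) + (\<Sum>i\<in>{Suc j..d+1}. \<kappa> i + 1) - 1"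
proof -
  have "(\<Sum>i\<in>{Suc j..d+1}. \<kappa> i + 1) = (\<Sum>i\<in>{Suc j..d+1}. \<kappa> i) + (real (d + 1) - real j)"
    using assms by (simp only: sum.distrib) (simp add: of_nat_diff)
  then show ?thesis by (simp add: jacobi_param_def)
qed

lemma jacobi_param_gt:
  assumes "\<forall>i\<in>{1..d+1}. \<kappa> i > -1" "j \<le> d"
  shows "jacobi_param d \<kappa> \<nu> j > -1"
proof -
  have "(\<Sum>i=Suc j..d+1. \<kappa> i + 1) > (0::real)"
    by (rule tail_sum_pos) (use assms in auto)
  moreover have "real (\<Sum>i=Suc j..d. \<nu> i) \<ge> 0" by (rule of_nat_0_le_iff)
  ultimately show ?thesis unfolding jacobi_param_eq[OF assms(2)] by linarith
qed

lemma Lap_tail_coeff: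
  assumes \<kappa>: "\<forall>i\<in>{1..d+1}. \<kappa> i > -1"
  shows "j \<le> d + 1 \<Longrightarrow> Lap \<kappa> {j..d+1} (tail_coeff d \<kappa> \<nu> j) = (\<lambda>_. 0)"
proof (induction j rule: inc_induct)
  case base
  then show ?case
    by (auto simp: tail_coeff_base Lap_def lap_def fun_eq_iff)
next
  case (step n)
  then have n: "n \<le> d" by simp
  show ?case
    unfolding tail_coeff_step[OF n]
  proof (rule Lap_jacobi_op)
    show "{n..d+1} = insert n {Suc n..d+1}" using n by auto
    show "homogeneous_on {Suc n..d+1} (\<Sum>i=Suc n..d. \<nu> i) (tail_coeff d \<kappa> \<nu> (Suc n))"
      by (rule tail_coeff_homogeneous) (use n in auto)
    show "homogeneous_on {n..d+1} (\<Sum>i=Suc n..d. \<nu> i) (tail_coeff d \<kappa> \<nu> (Suc n))"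
      by (rule tail_coeff_homogeneous) (use n in auto)
    show "Lap \<kappa> {n} (tail_coeff d \<kappa> \<nu> (Suc n)) = (\<lambda>_. 0)"
      by (rule Lap_tail_coeff_below) (use n in auto)
    show "jacobi_param d \<kappa> \<nu> n > -1" by (rule jacobi_param_gt[OF \<kappa> n])
  qed (use step.IH jacobi_param_eq[OF n] in auto)
qed

text \<open>At \<open>i = j\<close> the form is harmonic in the tail and homogeneous of degree
  \<open>r\<close>, so only the quadratic term acts. Every further Jacobi factor commutes with the
  operator and leaves the eigenvalue unchanged.\<close>

lemma casimir_tail_coeff:
  fixes \<nu> :: "nat \<Rightarrow> nat"
  assumes \<kappa>: "\<forall>i\<in>{1..d+1}. \<kappa> i > -1" and "j \<le> d + 1"
  defines "r \<equiv> real (\<Sum>i=j..d. \<nu> i)"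
  shows "i \<le> j \<Longrightarrow> casimir \<kappa> {j..d+1} (tail_coeff d \<kappa> \<nu> i) =
    (\<lambda>\<alpha>. - (r * (r + (\<Sum>l=j..d+1. \<kappa> l + 1) - 1)) * tail_coeff d \<kappa> \<nu> i \<alpha>)"
proof (induction i rule: inc_induct)
  case base
  let ?f = "\<lambda>n. real n * (real n + (\<Sum>l=j..d+1. \<kappa> l + 1) - 1)"
  have "?f (sum \<alpha> {j..d+1}) * tail_coeff d \<kappa> \<nu> j \<alpha> = ?f (\<Sum>i=j..d. \<nu> i) * tail_coeff d \<kappa> \<nu> j \<alpha>" for \<alpha>
    by (rule homogeneous_on_mult_degree[where f = ?f], intro tail_coeff_homogeneous assms) auto
  moreover have "Lap \<kappa> {j..d+1} (tail_coeff d \<kappa> \<nu> j) = (\<lambda>_. 0)"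
    by (rule Lap_tail_coeff[OF \<kappa> assms(2)])
  ultimately show ?case
    unfolding casimir_def[abs_def] r_def
    by (intro ext) (simp only: shifts_zero diff_0 mult_minus_left)
next
  case (step n)
  then have n: "n \<le> d" using assms by simp
  have "casimir \<kappa> {j..d+1} (tail_coeff d \<kappa> \<nu> n) =
      jacobi_op (\<nu> n) (jacobi_param d \<kappa> \<nu> n) (\<kappa> n) {n..d+1} {Suc n..d+1}
        (casimir \<kappa> {j..d+1} (tail_coeff d \<kappa> \<nu> (Suc n)))"
    unfolding tail_coeff_step[OF n] by (rule casimir_jacobi_op) (use step in auto)
  then show ?case
    unfolding step.IH jacobi_op_scale tail_coeff_step[OF n] .
qed

lemma fischer_tail_coeff_orthogonal:
  assumes \<kappa>: "\<forall>i\<in>{1..d+1}. \<kappa> i > -1"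
    and \<nu>: "\<nu> \<in> multi_index d n" "\<mu> \<in> multi_index d n" "\<nu> \<noteq> \<mu>"
  shows "fischer (d + 1) \<kappa> n (tail_coeff d \<kappa> \<nu> 1) (tail_coeff d \<kappa> \<mu> 1) = 0"
proof -
  define D where "D = {i. \<nu> i \<noteq> \<mu> i}"
  have D: "D \<subseteq> {1..d}" "D \<noteq> {}" using \<nu> by (force simp: D_def multi_index_def fun_eq_iff)+
  then have fin: "finite D" using finite_subset by blast
  \<comment> \<open>Beyond the last disagreement the indices coincide, so the tail degrees starting
    at \<open>j\<close> differ by exactly the difference of the entries at \<open>j\<close>.\<close>
  define j where "j = Max D"
  have jD: "j \<in> D" unfolding j_def using fin D(2) by (rule Max_in)
  then have j: "j \<in> {1..d}" "\<nu> j \<noteq> \<mu> j" using D by (auto simp: D_def)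
  have "\<nu> i = \<mu> i" if "i > j" for i
    using Max_ge[OF fin, of i] that by (auto simp: D_def j_def)
  then have eq: "(\<Sum>i=Suc j..d. \<nu> i) = (\<Sum>i=Suc j..d. \<mu> i)" by (intro sum.cong) auto
  define R S where "R = (\<Sum>i=j..d. \<nu> i)" and "S = (\<Sum>i=j..d. \<mu> i)"
  define r s where "r = real R" and "s = real S"
  define A where "A = (\<Sum>l=j..d+1. \<kappa> l + 1)"
  have "R \<noteq> S"
    using j eq by (simp add: R_def S_def sum.atLeast_Suc_atMost)
  then have "r \<noteq> s" by (simp add: r_def s_def)
  \<comment> \<open>Here \<open>A\<close> may be less than 1; distinct natural numbers have sum at
    least 1, which keeps \<open>r + s + A - 1\<close> positive and the eigenvalues apart.\<close>
  moreover have "r + s \<ge> 1"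
    using \<open>R \<noteq> S\<close> unfolding r_def s_def by linarith
  moreover have "A > 0" unfolding A_def by (rule tail_sum_pos[OF \<kappa>]) (use j in auto)
  moreover have "r * (r + A - 1) - s * (s + A - 1) = (r - s) * (r + s + A - 1)"
    by (simp add: algebra_simps)
  ultimately have ne: "- (r * (r + A - 1)) \<noteq> - (s * (s + A - 1))" by auto
  let ?F = "fischer (d + 1) \<kappa> n" and ?u = "tail_coeff d \<kappa> \<nu> 1" and ?v = "tail_coeff d \<kappa> \<mu> 1"
  have "?F (casimir \<kappa> {j..d+1} ?u) ?v = ?F ?u (casimir \<kappa> {j..d+1} ?v)"
    by (rule fischer_casimir) (use j in auto)
  also have "casimir \<kappa> {j..d+1} ?u = (\<lambda>\<alpha>. - (r * (r + A - 1)) * ?u \<alpha>)"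
    unfolding r_def R_def A_def by (rule casimir_tail_coeff[OF \<kappa>]) (use j in auto)
  also have "casimir \<kappa> {j..d+1} ?v = (\<lambda>\<alpha>. - (s * (s + A - 1)) * ?v \<alpha>)"
    unfolding s_def S_def A_def by (rule casimir_tail_coeff[OF \<kappa>]) (use j in auto)
  finally have "- (r * (r + A - 1)) * ?F ?u ?v = - (s * (s + A - 1)) * ?F ?u ?v"
    using fischer_scale[of "d+1" \<kappa> n ?v "- (r * (r + A - 1))" ?u]
      fischer_scale[of "d+1" \<kappa> n ?u "- (s * (s + A - 1))" ?v]
    by (simp only: fischer_commute)
  then show ?thesis using ne by simp
qed

text \<open>At barycentric coordinates the sum over the tail from \<open>i\<close> on is
  \<open>1 - x_1 - ... - x_(i-1)\<close>, so \<open>j = 1\<close> recovers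
  \<open>simplex_jacobi\<close>; larger \<open>j\<close> serve the downward inductions.\<close>

definition tail_jacobi :: "nat \<Rightarrow> (nat \<Rightarrow> real) \<Rightarrow> (nat \<Rightarrow> nat) \<Rightarrow> nat \<Rightarrow> (nat \<Rightarrow> real) \<Rightarrow> real" where
  "tail_jacobi d \<kappa> \<nu> j y = (\<Prod>i=j..d. jacobi_homogenized (\<nu> i) (jacobi_param d \<kappa> \<nu> i) (\<kappa> i)
     (\<Sum>l=i..d+1. y l) (y i))"

lemma tail_jacobi_step:
  "j \<le> d \<Longrightarrow> tail_jacobi d \<kappa> \<nu> j y = jacobi_homogenized (\<nu> j) (jacobi_param d \<kappa> \<nu> j) (\<kappa> j)
     (\<Sum>l=j..d+1. y l) (y j) * tail_jacobi d \<kappa> \<nu> (Suc j) y"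
  unfolding tail_jacobi_def by (rule prod.atLeast_Suc_atMost)

lemma hom_eval_tail_coeff:
  "j \<le> d + 1 \<Longrightarrow> 1 \<le> j \<Longrightarrow>
    hom_eval (d + 1) (\<Sum>i=j..d. \<nu> i) (tail_coeff d \<kappa> \<nu> j) y = tail_jacobi d \<kappa> \<nu> j y"
proof (induction j rule: inc_induct)
  case base
  then show ?case
    by (simp add: tail_coeff_base tail_jacobi_def hom_eval_def multi_index_0 monomial_def)
next
  case (step n)
  then have n: "n \<le> d" by simp
  have deg: "(\<Sum>i=n..d. \<nu> i) = (\<Sum>i=Suc n..d. \<nu> i) + \<nu> n"
    using n by (simp add: sum.atLeast_Suc_atMost)
  have "(\<Sum>i\<in>{Suc n..d+1}. y i) = (\<Sum>i\<in>{n..d+1}. y i) - y n"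
    using n sum.atLeast_Suc_atMost[of n "d+1" y] by simp
  then show ?case
    using step unfolding tail_coeff_step[OF n] tail_jacobi_step[OF n] deg
    by (subst hom_eval_jacobi_op[where u = "y n"]) auto
qed

section \<open>Polynomials in barycentric coordinates\<close>

text \<open>Built by adding one multiple of a generator at a time, so that explicit coefficients can
  later be extracted by rule induction.\<close>

inductive_set lspan :: "('b \<Rightarrow> real) set \<Rightarrow> ('b \<Rightarrow> real) set" for G where
  zero: "(\<lambda>_. 0) \<in> lspan G"
| step: "f \<in> lspan G \<Longrightarrow> g \<in> G \<Longrightarrow> (\<lambda>x. f x + a * g x) \<in> lspan G"

lemma lspan_add: "g \<in> lspan G \<Longrightarrow> f \<in> lspan G \<Longrightarrow> (\<lambda>x. f x + g x) \<in> lspan G"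
proof (induction rule: lspan.induct)
  case (step g h a)
  then have "(\<lambda>x. (f x + g x) + a * h x) \<in> lspan G" by (intro lspan.step) auto
  then show ?case by (simp add: add.assoc)
qed simp

lemma lspan_base: "g \<in> G \<Longrightarrow> g \<in> lspan G"
  using lspan.step[OF lspan.zero, of g G 1] by simp

lemma lspan_scale: "f \<in> lspan G \<Longrightarrow> (\<lambda>x. a * f x) \<in> lspan G"
proof (induction rule: lspan.induct)
  case (step f g b)
  then have "(\<lambda>x. a * f x + (a * b) * g x) \<in> lspan G" by (intro lspan.step)
  then show ?case by (simp add: algebra_simps)
qed (simp add: lspan.zero)

lemma lspan_diff: "f \<in> lspan G \<Longrightarrow> g \<in> lspan G \<Longrightarrow> (\<lambda>x. f x - g x) \<in> lspan G"
  using lspan_add[OF lspan_scale[of g G "-1"], of f] by simp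

lemma lspan_sum: "(\<And>i. i \<in> A \<Longrightarrow> f i \<in> lspan G) \<Longrightarrow> (\<lambda>x. \<Sum>i\<in>A. f i x) \<in> lspan G"
  by (induction A rule: infinite_finite_induct) (auto intro: lspan.zero lspan_add)

lemma lspan_mult:
  "f \<in> lspan G \<Longrightarrow> (\<And>g. g \<in> G \<Longrightarrow> (\<lambda>x. h x * g x) \<in> lspan G') \<Longrightarrow> (\<lambda>x. h x * f x) \<in> lspan G'"
proof (induction rule: lspan.induct)
  case (step f g a)
  have "(\<lambda>x. h x * f x + a * (h x * g x)) \<in> lspan G'"
    by (intro lspan_add lspan_scale step)
  then show ?case by (simp add: algebra_simps)
qed (simp add: lspan.zero)

text \<open>The terms are sorted by the exponent of the last variable; as a polynomial in that
  variable the sum has all positive reals as roots. An arbitrary finite index set is needed because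
  the slices \<open>B k\<close> are not of the form \<open>multi_index m n\<close>, and positive
  points suffice so that vanishing where \<open>|y|\<close> is nonzero can be used.\<close>

lemma monomial_coeffs_unique:
  assumes "finite A" and "\<And>\<alpha> \<beta>. \<alpha> \<in> A \<Longrightarrow> \<beta> \<in> A \<Longrightarrow> (\<And>i. i \<in> {1..m} \<Longrightarrow> \<alpha> i = \<beta> i) \<Longrightarrow> \<alpha> = \<beta>"
    and "\<And>y :: nat \<Rightarrow> real. (\<And>i. y i > 0) \<Longrightarrow> (\<Sum>\<alpha>\<in>A. c \<alpha> * monomial m y \<alpha>) = 0"
    and "\<alpha> \<in> A"
  shows "c \<alpha> = 0"
  using assms
proof (induction m arbitrary: A)
  case 0
  then have "A = {\<alpha>}" by auto
  then show ?case using "0.prems"(3)[of "\<lambda>_. 1"] by (simp add: monomial_def)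
next
  case (Suc m)
  define B where "B k = {\<beta>\<in>A. \<beta> (Suc m) = k}" for k
  show ?case
  proof (rule Suc.IH[of "B (\<alpha> (Suc m))"])
    show "\<beta> = \<gamma>" if "\<beta> \<in> B (\<alpha> (Suc m))" "\<gamma> \<in> B (\<alpha> (Suc m))" and eq: "\<And>i. i \<in> {1..m} \<Longrightarrow> \<beta> i = \<gamma> i" for \<beta> \<gamma>
    proof (rule Suc.prems(2))
      show "\<beta> i = \<gamma> i" if "i \<in> {1..Suc m}" for i
        using that eq[of i] \<open>\<beta> \<in> _\<close> \<open>\<gamma> \<in> _\<close> by (cases "i = Suc m") (auto simp: B_def)
    qed (use that in \<open>auto simp: B_def\<close>)
    fix y :: "nat \<Rightarrow> real" assume y: "\<And>i. y i > 0"
    define b where "b k = (\<Sum>\<beta>\<in>B k. c \<beta> * monomial m y \<beta>)" for k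
    define K where "K = (\<lambda>\<beta>. \<beta> (Suc m)) ` A"
    define p where "p = (\<Sum>k\<in>K. monom (b k) k)"
    have finK: "finite K" using Suc.prems(1) by (simp add: K_def)
    have "poly p t = 0" if t: "t > 0" for t
    proof -
      have mono: "monomial (Suc m) (y(Suc m := t)) \<beta> = monomial m y \<beta> * t ^ \<beta> (Suc m)" for \<beta>
        by (simp add: monomial_def)
      have "0 = (\<Sum>\<beta>\<in>A. c \<beta> * monomial (Suc m) (y(Suc m := t)) \<beta>)"
        by (rule Suc.prems(3)[symmetric]) (use y t in auto)
      also have "\<dots> = (\<Sum>k\<in>K. \<Sum>\<beta>\<in>B k. c \<beta> * monomial (Suc m) (y(Suc m := t)) \<beta>)"
        unfolding K_def B_def by (rule sum.image_gen[OF Suc.prems(1)])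
      also have "\<dots> = (\<Sum>k\<in>K. b k * t ^ k)"
        unfolding b_def sum_distrib_right by (intro sum.cong) (auto simp: mono B_def)
      also have "\<dots> = poly p t"
        by (simp add: p_def poly_sum poly_monom)
      finally show ?thesis by simp
    qed
    then have "{0<..} \<subseteq> {t. poly p t = 0}" by auto
    then have "infinite {t. poly p t = 0}"
      using infinite_Ioi[of "0::real"] infinite_super by blast
    then have "p = 0" using poly_roots_finite by blast
    then have "coeff p (\<alpha> (Suc m)) = 0" by simp
    moreover have "coeff p (\<alpha> (Suc m)) = b (\<alpha> (Suc m))"
      using finK Suc.prems(4) by (simp add: p_def coeff_sum K_def)
    ultimately show "(\<Sum>\<beta>\<in>B (\<alpha> (Suc m)). c \<beta> * monomial m y \<beta>) = 0" by (simp add: b_def)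
  qed (use Suc.prems in \<open>auto simp: B_def\<close>)
qed

lemma hom_eval_eq_0_imp:
  assumes "m \<ge> 1" and "\<And>y. (\<Sum>i=1..m. y i) \<noteq> 0 \<Longrightarrow> hom_eval m n c y = 0" and "\<alpha> \<in> multi_index m n"
  shows "c \<alpha> = 0"
proof (rule monomial_coeffs_unique[OF finite_multi_index _ _ assms(3)])
  fix \<beta> \<gamma> assume "\<beta> \<in> multi_index m n" "\<gamma> \<in> multi_index m n" and eq: "\<And>i. i \<in> {1..m} \<Longrightarrow> \<beta> i = \<gamma> i"
  then have "\<beta> i = \<gamma> i" for i by (cases "i \<in> {1..m}") (auto simp: multi_index_def)
  then show "\<beta> = \<gamma>" ..
next
  fix y :: "nat \<Rightarrow> real" assume "\<And>i. y i > 0"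
  then have "(\<Sum>i=1..m. y i) > 0" using assms(1) by (intro sum_pos) auto
  then show "(\<Sum>\<beta>\<in>multi_index m n. c \<beta> * monomial m y \<beta>) = 0"
    using assms(2)[of y] by (simp add: hom_eval_def)
qed

section \<open>Polynomials of bounded degree as restrictions of forms\<close>

lemma polys_below_iff: "f \<in> polys_below d n \<longleftrightarrow> (\<exists>c. \<forall>x. f x = (\<Sum>k<n. hom_eval d k c x))"
  by (simp add: polys_below_def hom_eval_def)

lemma polys_below_add: "f \<in> polys_below d n \<Longrightarrow> g \<in> polys_below d n \<Longrightarrow> (\<lambda>x. f x + g x) \<in> polys_below d n"
  unfolding polys_below_iff
proof (elim exE)
  fix c c' assume "\<forall>x. f x = (\<Sum>k<n. hom_eval d k c x)" "\<forall>x. g x = (\<Sum>k<n. hom_eval d k c' x)"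
  then show "\<exists>c. \<forall>x. f x + g x = (\<Sum>k<n. hom_eval d k c x)"
    by (intro exI[of _ "\<lambda>\<alpha>. c \<alpha> + c' \<alpha>"]) (simp add: hom_eval_add sum.distrib)
qed

lemma polys_below_scale: "f \<in> polys_below d n \<Longrightarrow> (\<lambda>x. a * f x) \<in> polys_below d n"
  unfolding polys_below_iff
proof (elim exE)
  fix c assume "\<forall>x. f x = (\<Sum>k<n. hom_eval d k c x)"
  then show "\<exists>c. \<forall>x. a * f x = (\<Sum>k<n. hom_eval d k c x)"
    by (intro exI[of _ "\<lambda>\<alpha>. a * c \<alpha>"]) (simp add: hom_eval_scale sum_distrib_left)
qed

lemma polys_below_zero: "(\<lambda>_. 0) \<in> polys_below d n"
  unfolding polys_below_iff by (intro exI[of _ "\<lambda>_. 0"]) (simp add: hom_eval_def)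

lemma polys_below_diff: "f \<in> polys_below d n \<Longrightarrow> g \<in> polys_below d n \<Longrightarrow> (\<lambda>x. f x - g x) \<in> polys_below d n"
  using polys_below_add[OF _ polys_below_scale[of g d n "-1"], of f] by simp

lemma polys_below_sum:
  "(\<And>i. i \<in> A \<Longrightarrow> f i \<in> polys_below d n) \<Longrightarrow> (\<lambda>x. \<Sum>i\<in>A. f i x) \<in> polys_below d n"
  by (induction A rule: infinite_finite_induct) (auto intro: polys_below_zero polys_below_add)

lemma polys_below_Suc_mono:
  assumes "f \<in> polys_below d n"
  shows "f \<in> polys_below d (Suc n)"
proof -
  obtain c where c: "f x = (\<Sum>k<n. hom_eval d k c x)" for x using assms by (auto simp: polys_below_iff)
  \<comment> \<open>One coefficient function serves all degrees, and its values at length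
    \<open>n\<close> are arbitrary; they must be cut off before the bound is raised.\<close>
  define c' where "c' \<alpha> = (if (\<Sum>i=1..d. \<alpha> i) < n then c \<alpha> else 0)" for \<alpha>
  have "hom_eval d k c' x = (if k < n then hom_eval d k c x else 0)" for k x
    unfolding hom_eval_def by (auto simp: c'_def multi_index_def intro!: sum.cong sum.neutral)
  then have "f x = (\<Sum>k<Suc n. hom_eval d k c' x)" for x
    unfolding c by simp
  then show ?thesis by (auto simp: polys_below_iff)
qed

lemma polys_below_mult_var:
  assumes "f \<in> polys_below d n" "i \<in> {1..d}"
  shows "(\<lambda>x. x i * f x) \<in> polys_below d (Suc n)"
proof -
  obtain c where c: "f x = (\<Sum>k<n. hom_eval d k c x)" for x using assms by (auto simp: polys_below_iff)
  have "x i * f x = (\<Sum>k<Suc n. hom_eval d k (shift i c) x)" for x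
    unfolding c sum.lessThan_Suc_shift hom_eval_shift[OF assms(2)] hom_eval_shift_0[OF assms(2)]
    by (simp add: sum_distrib_left)
  then show ?thesis by (auto simp: polys_below_iff)
qed

lemma polys_below_mult_barycentric:
  assumes "f \<in> polys_below d n" "i \<in> {1..d+1}"
  shows "(\<lambda>x. barycentric d x i * f x) \<in> polys_below d (Suc n)"
proof (cases "i = d + 1")
  case True
  have "(\<lambda>x. f x - (\<Sum>j=1..d. x j * f x)) \<in> polys_below d (Suc n)"
    using assms by (intro polys_below_diff polys_below_sum polys_below_mult_var polys_below_Suc_mono)
  then show ?thesis using True by (simp add: barycentric_def algebra_simps sum_distrib_left)
next
  case False
  then show ?thesis using polys_below_mult_var[OF assms(1), of i] assms(2) by (simp add: barycentric_def)
qed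

lemma multi_index_SucE:
  assumes "\<alpha> \<in> multi_index m (Suc n)"
  obtains i \<beta> where "i \<in> {1..m}" "\<beta> \<in> multi_index m n" "\<alpha> = \<beta>(i := Suc (\<beta> i))"
proof -
  have "(\<Sum>i=1..m. \<alpha> i) \<noteq> 0" using assms by (auto simp: multi_index_def)
  then obtain i where i: "i \<in> {1..m}" and ai: "\<alpha> i \<noteq> 0"
    by (auto simp: sum.neutral)
  show ?thesis
    by (rule that[OF i multi_index_dec[OF i assms ai]]) (use ai in auto)
qed

lemma monomial_barycentric_polys_below:
  "\<alpha> \<in> multi_index (d + 1) n \<Longrightarrow> (\<lambda>x. monomial (d + 1) (barycentric d x) \<alpha>) \<in> polys_below d (Suc n)"
proof (induction n arbitrary: \<alpha>)
  case 0
  have "(\<lambda>x. 1) \<in> polys_below d (Suc 0)"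
    unfolding polys_below_iff
    by (intro exI[of _ "\<lambda>_. 1"]) (simp add: hom_eval_def multi_index_0 monomial_def)
  then show ?case using 0 by (simp add: multi_index_0 monomial_def)
next
  case (Suc n)
  obtain i \<beta> where "i \<in> {1..d+1}" "\<beta> \<in> multi_index (d + 1) n" "\<alpha> = \<beta>(i := Suc (\<beta> i))"
    using Suc.prems by (rule multi_index_SucE)
  then show ?case
    using polys_below_mult_barycentric[OF Suc.IH] by (simp only: monomial_inc)
qed

lemma hom_eval_barycentric_polys_below:
  "(\<lambda>x. hom_eval (d + 1) n c (barycentric d x)) \<in> polys_below d (Suc n)"
  unfolding hom_eval_def
  by (intro polys_below_sum polys_below_scale monomial_barycentric_polys_below)

lemma sum_barycentric: "(\<Sum>i=1..d+1. barycentric d x i) = 1"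
proof -
  have "(\<Sum>i=1..d. barycentric d x i) = (\<Sum>i=1..d. x i)"
    by (intro sum.cong) (auto simp: barycentric_def)
  then show ?thesis by (simp add: barycentric_def)
qed

lemma hom_eval_shifts_barycentric:
  "hom_eval (d + 1) (Suc n) (shifts {1..d+1} c) (barycentric d x) = hom_eval (d + 1) n c (barycentric d x)"
  by (simp only: hom_eval_shifts[OF order.refl] sum_barycentric mult_1)

lemma hom_eval_shifts_pow_barycentric:
  "hom_eval (d + 1) (n + k) ((shifts {1..d+1} ^^ k) c) (barycentric d x) = hom_eval (d + 1) n c (barycentric d x)"
  by (simp only: hom_eval_shifts_pow[OF order.refl] sum_barycentric power_one mult_1)

lemma monomial_as_barycentric:
  "\<alpha> \<in> multi_index d k \<Longrightarrow> \<exists>c. \<forall>x. monomial d x \<alpha> = hom_eval (d + 1) k c (barycentric d x)"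
proof (induction k arbitrary: \<alpha>)
  case 0
  then have "monomial d x \<alpha> = hom_eval (d + 1) 0 (\<lambda>_. 1) (barycentric d x)" for x
    by (simp add: multi_index_0 monomial_def hom_eval_def)
  then show ?case by blast
next
  case (Suc n)
  obtain i \<beta> where i: "i \<in> {1..d}" and \<beta>: "\<beta> \<in> multi_index d n" and \<alpha>: "\<alpha> = \<beta>(i := Suc (\<beta> i))"
    using Suc.prems by (rule multi_index_SucE)
  obtain c where c: "\<And>x. monomial d x \<beta> = hom_eval (d + 1) n c (barycentric d x)"
    using Suc.IH[OF \<beta>] by blast
  have "monomial d x \<alpha> = hom_eval (d + 1) (Suc n) (shift i c) (barycentric d x)" for x
    unfolding \<alpha> monomial_inc[OF i] c using i by (subst hom_eval_shift) (auto simp: barycentric_def)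
  then show ?case by blast
qed

text \<open>Monomials of lower degree are padded by powers of \<open>|y|\<close>, which is 1 at
  barycentric coordinates.\<close>

lemma polys_below_as_barycentric:
  assumes "f \<in> polys_below d (Suc n)"
  obtains c where "\<And>x. f x = hom_eval (d + 1) n c (barycentric d x)"
proof -
  obtain c where c: "f x = (\<Sum>k<Suc n. \<Sum>\<alpha>\<in>multi_index d k. c \<alpha> * monomial d x \<alpha>)" for x
    using assms by (auto simp: polys_below_def)
  have "\<exists>u. \<forall>x. monomial d x \<alpha> = hom_eval (d + 1) n u (barycentric d x)"
    if k: "k < Suc n" and \<alpha>: "\<alpha> \<in> multi_index d k" for k \<alpha>
  proof -
    obtain u where "\<And>x. monomial d x \<alpha> = hom_eval (d + 1) k u (barycentric d x)"
      using monomial_as_barycentric[OF \<alpha>] by blast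
    then have "\<forall>x. monomial d x \<alpha> = hom_eval (d + 1) n ((shifts {1..d+1} ^^ (n - k)) u) (barycentric d x)"
      using hom_eval_shifts_pow_barycentric[of d k "n - k" u] k by simp
    then show ?thesis by blast
  qed
  then obtain u where u: "\<And>k \<alpha> x. k < Suc n \<Longrightarrow> \<alpha> \<in> multi_index d k \<Longrightarrow>
      monomial d x \<alpha> = hom_eval (d + 1) n (u k \<alpha>) (barycentric d x)"
    by metis
  have "f x = hom_eval (d + 1) n (\<lambda>\<gamma>. \<Sum>k<Suc n. \<Sum>\<alpha>\<in>multi_index d k. c \<alpha> * u k \<alpha> \<gamma>) (barycentric d x)" for x
    unfolding c hom_eval_sum hom_eval_scale by (intro sum.cong refl) (use u in auto)
  then show ?thesis by (rule that)
qed

section \<open>Spanning by Jacobi polynomials\<close>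

lemma jacobi_homogenized_coeff:
  "jacobi_homogenized m a b s u = (\<Sum>k\<le>m. jacobi_coeff m a b k * ((s - u) ^ k * s ^ (m - k)))"
  by (simp add: jacobi_homogenized_def jacobi_coeff_def mult.assoc)

text \<open>Harmonic Jacobi forms of all degrees up to \<open>N\<close> in the tail variables,
  padded to degree \<open>N\<close> by powers of the tail sum. The padded forms are the generators
  with a factor \<open>|y|\<close> when \<open>j = 1\<close>.\<close>

definition tail_gens :: "nat \<Rightarrow> (nat \<Rightarrow> real) \<Rightarrow> nat \<Rightarrow> nat \<Rightarrow> ((nat \<Rightarrow> real) \<Rightarrow> real) set" where
  "tail_gens d \<kappa> j N = {\<lambda>y. (\<Sum>l=j..d+1. y l) ^ (N - (\<Sum>i=j..d. \<nu> i)) * tail_jacobi d \<kappa> \<nu> j y | \<nu>.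
     (\<forall>i. i \<notin> {j..d} \<longrightarrow> \<nu> i = 0) \<and> (\<Sum>i=j..d. \<nu> i) \<le> N}"

lemma tail_gensE:
  assumes "g \<in> tail_gens d \<kappa> j N"
  obtains \<nu> where "\<forall>i. i \<notin> {j..d} \<longrightarrow> \<nu> i = 0" "(\<Sum>i=j..d. \<nu> i) \<le> N"
    "g = (\<lambda>y. (\<Sum>l=j..d+1. y l) ^ (N - (\<Sum>i=j..d. \<nu> i)) * tail_jacobi d \<kappa> \<nu> j y)"
  using assms unfolding tail_gens_def mem_Collect_eq by (elim exE conjE) (rule that)

lemma tail_jacobi_upd:
  assumes "i < j"
  shows "tail_jacobi d \<kappa> (\<nu>(i := k)) j = tail_jacobi d \<kappa> \<nu> j"
proof -
  have "jacobi_param d \<kappa> (\<nu>(i := k)) l = jacobi_param d \<kappa> \<nu> l" if "l \<ge> j" for l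
    unfolding jacobi_param_def using that assms by (auto intro!: sum.cong)
  then show ?thesis
    unfolding tail_jacobi_def[abs_def] using assms by (intro ext prod.cong) auto
qed

lemma jacobi_param_upd: "jacobi_param d \<kappa> (\<nu>(j := k)) j = jacobi_param d \<kappa> \<nu> j"
  unfolding jacobi_param_def by (auto intro!: sum.cong)

text \<open>
  \<open>jacobi_homogenized k\<close> is a combination of \<open>T^i S^(k - i)\<close>, \<open>i \<le> k\<close>, with nonzero coefficient
  at \<open>i = k\<close>; this triangular system is inverted.
\<close>

lemma two_variable_span:
  assumes \<kappa>: "\<forall>i\<in>{1..d+1}. \<kappa> i > -1" and j: "1 \<le> j" "j \<le> d"
    and \<nu>: "\<forall>i. i \<notin> {Suc j..d} \<longrightarrow> \<nu> i = 0"
  defines "S \<equiv> \<lambda>y. \<Sum>l=j..d+1. y l" and "T \<equiv> \<lambda>y. \<Sum>l=Suc j..d+1. y l"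
    and "r \<equiv> \<Sum>i=Suc j..d. \<nu> i"
  shows "(\<lambda>y. T y ^ k * S y ^ l * tail_jacobi d \<kappa> \<nu> (Suc j) y) \<in> lspan (tail_gens d \<kappa> j (r + k + l))"
proof (induction k arbitrary: l rule: less_induct)
  case (less k)
  let ?q = "tail_jacobi d \<kappa> \<nu> (Suc j)"
  define a where "a = jacobi_param d \<kappa> \<nu> j"
  have c: "jacobi_coeff k a (\<kappa> j) k \<noteq> 0"
    unfolding a_def
    by (rule jacobi_coeff_diag_nonzero[OF jacobi_param_gt[OF \<kappa> j(2)] bspec[OF \<kappa>]]) (use j in auto)
  have ST: "S y - y j = T y" for y
    unfolding S_def T_def using j sum.atLeast_Suc_atMost[of j "d+1" y] by simp
  let ?\<mu> = "\<nu>(j := k)"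
  have sum\<mu>: "(\<Sum>i=j..d. ?\<mu> i) = r + k"
  proof -
    have "(\<Sum>i=j..d. ?\<mu> i) = k + (\<Sum>i=Suc j..d. ?\<mu> i)"
      using j by (simp add: sum.atLeast_Suc_atMost)
    also have "(\<Sum>i=Suc j..d. ?\<mu> i) = r" unfolding r_def by (intro sum.cong) auto
    finally show ?thesis by simp
  qed
  have g: "(\<lambda>y. S y ^ l * (jacobi_homogenized k a (\<kappa> j) (S y) (y j) * ?q y)) \<in> tail_gens d \<kappa> j (r + k + l)"
    unfolding tail_gens_def mem_Collect_eq
  proof (intro exI[of _ ?\<mu>] conjI)
    have "r + k + l - (\<Sum>i=j..d. ?\<mu> i) = l" unfolding sum\<mu> by simp
    then show "(\<lambda>y. S y ^ l * (jacobi_homogenized k a (\<kappa> j) (S y) (y j) * ?q y)) =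
        (\<lambda>y. (\<Sum>l=j..d+1. y l) ^ (r + k + l - (\<Sum>i=j..d. ?\<mu> i)) * tail_jacobi d \<kappa> ?\<mu> j y)"
      unfolding tail_jacobi_step[OF j(2)] tail_jacobi_upd[OF lessI] jacobi_param_upd S_def a_def fun_upd_same
      by simp
    show "\<forall>i. i \<notin> {j..d} \<longrightarrow> ?\<mu> i = 0" using \<nu> j by auto
    show "(\<Sum>i=j..d. ?\<mu> i) \<le> r + k + l" unfolding sum\<mu> by simp
  qed
  \<comment> \<open>The terms with \<open>i < k\<close> have the same total degree with more of it
    in \<open>S\<close>; the induction hypothesis covers them because it allows every exponent of
    \<open>S\<close>.\<close>
  have low: "(\<lambda>y. \<Sum>i<k. jacobi_coeff k a (\<kappa> j) i * (T y ^ i * S y ^ (k - i + l) * ?q y)) \<in>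
      lspan (tail_gens d \<kappa> j (r + k + l))"
  proof (intro lspan_sum lspan_scale)
    fix i assume "i \<in> {..<k}"
    then show "(\<lambda>y. T y ^ i * S y ^ (k - i + l) * ?q y) \<in> lspan (tail_gens d \<kappa> j (r + k + l))"
      using less[of i "k - i + l"] by (simp add: add.assoc)
  qed
  have "(\<lambda>y. (1 / jacobi_coeff k a (\<kappa> j) k) * (S y ^ l * (jacobi_homogenized k a (\<kappa> j) (S y) (y j) * ?q y) -
       (\<Sum>i<k. jacobi_coeff k a (\<kappa> j) i * (T y ^ i * S y ^ (k - i + l) * ?q y)))) \<in>
      lspan (tail_gens d \<kappa> j (r + k + l))"
    by (intro lspan_scale lspan_diff low lspan_base g)
  also have "(\<lambda>y. (1 / jacobi_coeff k a (\<kappa> j) k) * (S y ^ l * (jacobi_homogenized k a (\<kappa> j) (S y) (y j) * ?q y) -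
       (\<Sum>i<k. jacobi_coeff k a (\<kappa> j) i * (T y ^ i * S y ^ (k - i + l) * ?q y)))) =
      (\<lambda>y. T y ^ k * S y ^ l * ?q y)"
  proof
    fix y
    have "S y ^ l * (jacobi_homogenized k a (\<kappa> j) (S y) (y j) * ?q y) =
      (\<Sum>i\<le>k. jacobi_coeff k a (\<kappa> j) i * (T y ^ i * S y ^ (k - i + l) * ?q y))"
      unfolding jacobi_homogenized_coeff ST sum_distrib_left sum_distrib_right
      by (intro sum.cong refl) (simp only: power_add mult_ac)
    also have "\<dots> = (\<Sum>i<k. jacobi_coeff k a (\<kappa> j) i * (T y ^ i * S y ^ (k - i + l) * ?q y)) +
        jacobi_coeff k a (\<kappa> j) k * (T y ^ k * S y ^ l * ?q y)"
      by (simp flip: lessThan_Suc_atMost)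
    finally show "(1 / jacobi_coeff k a (\<kappa> j) k) * (S y ^ l * (jacobi_homogenized k a (\<kappa> j) (S y) (y j) * ?q y) -
       (\<Sum>i<k. jacobi_coeff k a (\<kappa> j) i * (T y ^ i * S y ^ (k - i + l) * ?q y))) = T y ^ k * S y ^ l * ?q y"
      using c by simp
  qed
  finally show ?case .
qed

text \<open>The newly adjoined variable is the difference \<open>S - T\<close> of two consecutive
  tail sums. Removing its factors one at a time reduces the claim to products of powers of
  \<open>S\<close> and \<open>T\<close> with a Jacobi form of the shorter tail.\<close>

lemma tail_monomial_span:
  assumes \<kappa>: "\<forall>i\<in>{1..d+1}. \<kappa> i > -1"
  shows "j \<le> d + 1 \<Longrightarrow> 1 \<le> j \<Longrightarrow>
    (\<lambda>y. \<Prod>i=j..d+1. y i ^ \<alpha> i) \<in> lspan (tail_gens d \<kappa> j (\<Sum>i=j..d+1. \<alpha> i))"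
proof (induction j rule: inc_induct)
  case base
  have "(\<lambda>y. \<Prod>i=d+1..d+1. y i ^ \<alpha> i) \<in> tail_gens d \<kappa> (d + 1) (\<Sum>i=d+1..d+1. \<alpha> i)"
    unfolding tail_gens_def mem_Collect_eq
    by (intro exI[of _ "\<lambda>_. 0"]) (simp add: tail_jacobi_def)
  then show ?case by (rule lspan_base)
next
  case (step j)
  then have j: "1 \<le> j" "j \<le> d" by auto
  define S T where "S y = (\<Sum>l=j..d+1. y l)" and "T y = (\<Sum>l=Suc j..d+1. y l)" for y :: "nat \<Rightarrow> real"
  have u: "y j = S y - T y" for y
    unfolding S_def T_def using j sum.atLeast_Suc_atMost[of j "d+1" y] by simp
  define N where "N = (\<Sum>i=Suc j..d+1. \<alpha> i)"
  have N: "(\<Sum>i=j..d+1. \<alpha> i) = \<alpha> j + N"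
    using j unfolding N_def by (intro sum.atLeast_Suc_atMost) simp
  have P: "(\<Prod>i=j..d+1. y i ^ \<alpha> i) = y j ^ \<alpha> j * (\<Prod>i=Suc j..d+1. y i ^ \<alpha> i)" for y :: "nat \<Rightarrow> real"
    using j by (intro prod.atLeast_Suc_atMost) simp
  show ?case
    unfolding P N
  proof (rule lspan_mult)
    show "(\<lambda>y. \<Prod>i=Suc j..d+1. y i ^ \<alpha> i) \<in> lspan (tail_gens d \<kappa> (Suc j) N)"
      unfolding N_def by (rule step.IH) simp
    fix g assume "g \<in> tail_gens d \<kappa> (Suc j) N"
    then obtain \<nu> where \<nu>: "\<forall>i. i \<notin> {Suc j..d} \<longrightarrow> \<nu> i = 0" "(\<Sum>i=Suc j..d. \<nu> i) \<le> N"
      and g: "g = (\<lambda>y. T y ^ (N - (\<Sum>i=Suc j..d. \<nu> i)) * tail_jacobi d \<kappa> \<nu> (Suc j) y)"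
      unfolding T_def by (rule tail_gensE)
    define r where "r = (\<Sum>i=Suc j..d. \<nu> i)"
    have span: "(\<lambda>y. (S y - T y) ^ a * (T y ^ k * S y ^ l * tail_jacobi d \<kappa> \<nu> (Suc j) y)) \<in>
      lspan (tail_gens d \<kappa> j (r + a + k + l))" for a k l
    proof (induction a arbitrary: k l)
      case 0
      then show ?case
        using two_variable_span[OF \<kappa> j \<nu>(1), where k = k and l = l] by (simp add: S_def T_def r_def)
    next
      case (Suc a)
      have "(\<lambda>y. (S y - T y) ^ a * (T y ^ k * S y ^ Suc l * tail_jacobi d \<kappa> \<nu> (Suc j) y) -
          (S y - T y) ^ a * (T y ^ Suc k * S y ^ l * tail_jacobi d \<kappa> \<nu> (Suc j) y)) \<in>
        lspan (tail_gens d \<kappa> j (r + Suc a + k + l))"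
        using lspan_diff[OF Suc.IH[of k "Suc l"], of "\<lambda>y. (S y - T y) ^ a * (T y ^ Suc k * S y ^ l * tail_jacobi d \<kappa> \<nu> (Suc j) y)"]
          Suc.IH[of "Suc k" l] by simp
      then show ?case by (simp add: algebra_simps)
    qed
    have "(\<lambda>y. y j ^ \<alpha> j * g y) = (\<lambda>y. (S y - T y) ^ \<alpha> j * (T y ^ (N - r) * S y ^ 0 * tail_jacobi d \<kappa> \<nu> (Suc j) y))"
      unfolding g r_def u[symmetric] by simp
    moreover have "\<alpha> j + N = r + \<alpha> j + (N - r) + 0" using \<nu>(2) by (simp add: r_def)
    ultimately show "(\<lambda>y. y j ^ \<alpha> j * g y) \<in> lspan (tail_gens d \<kappa> j (\<alpha> j + N))"
      using span[of "\<alpha> j" "N - r" 0] by simp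
  qed
qed

text \<open>Generators of full degree \<open>n\<close> are Jacobi forms; all others are visibly
  divisible by \<open>|y|\<close>.\<close>

lemma hom_eval_decomposition:
  assumes \<kappa>: "\<forall>i\<in>{1..d+1}. \<kappa> i > -1"
  obtains b u where "\<And>y. hom_eval (d + 1) n c y =
    (\<Sum>\<nu>\<in>multi_index d n. b \<nu> * hom_eval (d + 1) n (tail_coeff d \<kappa> \<nu> 1) y) +
    hom_eval (d + 1) n (shifts {1..d+1} u) y"
proof -
  define R where "R b u y = (\<Sum>\<nu>\<in>multi_index d n. b \<nu> * hom_eval (d + 1) n (tail_coeff d \<kappa> \<nu> 1) y) +
    hom_eval (d + 1) n (shifts {1..d+1} u) y" for b u y
  have R_add: "R b u y + a * R b' u' y = R (\<lambda>\<nu>. b \<nu> + a * b' \<nu>) (\<lambda>\<alpha>. u \<alpha> + a * u' \<alpha>) y" for b b' u u' a y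
    unfolding R_def shifts_add shifts_scale hom_eval_add hom_eval_scale
    by (simp add: algebra_simps sum.distrib sum_distrib_left)
  have R_0: "R (\<lambda>_. 0) (\<lambda>_. 0) y = 0" for y
    unfolding R_def shifts_zero by (simp add: hom_eval_def)
  have gen: "\<exists>b u. g = R b u" if g0: "g \<in> tail_gens d \<kappa> 1 n" for g
  proof -
    obtain \<nu> where \<nu>: "\<forall>i. i \<notin> {1..d} \<longrightarrow> \<nu> i = 0" and le: "(\<Sum>i=1..d. \<nu> i) \<le> n"
      and g: "g = (\<lambda>y. (\<Sum>l=1..d+1. y l) ^ (n - (\<Sum>i=1..d. \<nu> i)) * tail_jacobi d \<kappa> \<nu> 1 y)"
      using g0 by (rule tail_gensE)
    define r where "r = (\<Sum>i=1..d. \<nu> i)"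
    have q: "tail_jacobi d \<kappa> \<nu> 1 y = hom_eval (d + 1) r (tail_coeff d \<kappa> \<nu> 1) y" for y
      unfolding r_def by (rule hom_eval_tail_coeff[symmetric]) auto
    show ?thesis
    proof (cases "r = n")
      case True
      then have \<nu>n: "\<nu> \<in> multi_index d n" using \<nu> by (simp add: multi_index_def r_def)
      have "g y = R (\<lambda>\<mu>. if \<mu> = \<nu> then 1 else 0) (\<lambda>_. 0) y" for y
      proof -
        have "g y = hom_eval (d + 1) n (tail_coeff d \<kappa> \<nu> 1) y"
          unfolding g q using True r_def by simp
        also have "\<dots> = (\<Sum>\<mu>\<in>multi_index d n. (if \<mu> = \<nu> then 1 else 0) * hom_eval (d + 1) n (tail_coeff d \<kappa> \<mu> 1) y)"
          using \<nu>n finite_multi_index[of d n]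
          by (simp add: if_distrib[of "\<lambda>t. t * _"] sum.delta cong: if_cong)
        finally show ?thesis unfolding R_def shifts_zero by (simp add: hom_eval_def)
      qed
      then show ?thesis by blast
    next
      case False
      then have r: "r < n" using le by (simp add: r_def)
      \<comment> \<open>One of the \<open>n - r\<close> factors \<open>|y|\<close> is kept as the
        outer \<open>shifts\<close>; the other \<open>k\<close> go into the witness
        \<open>u\<close>.\<close>
      define k where "k = n - r - 1"
      have n: "n = r + Suc k" using r by (simp add: k_def)
      have "g y = R (\<lambda>_. 0) ((shifts {1..d+1} ^^ k) (tail_coeff d \<kappa> \<nu> 1)) y" for y
      proof -
        have "g y = (\<Sum>l=1..d+1. y l) ^ Suc k * hom_eval (d + 1) r (tail_coeff d \<kappa> \<nu> 1) y"
          unfolding g q using n by (simp add: r_def)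
        also have "\<dots> = hom_eval (d + 1) n ((shifts {1..d+1} ^^ Suc k) (tail_coeff d \<kappa> \<nu> 1)) y"
          unfolding n by (simp only: hom_eval_shifts_pow[OF order.refl])
        finally show ?thesis unfolding R_def by simp
      qed
      then show ?thesis by blast
    qed
  qed
  have span: "\<exists>b u. f = R b u" if "f \<in> lspan (tail_gens d \<kappa> 1 n)" for f
    using that
  proof (induction rule: lspan.induct)
    case zero
    show ?case using R_0 by (metis ext)
  next
    case (step f g a)
    then obtain b u b' u' where "f = R b u" "g = R b' u'" using gen by blast
    then show ?case using R_add[of b u _ a b' u'] by blast
  qed
  have "hom_eval (d + 1) n c \<in> lspan (tail_gens d \<kappa> 1 n)"
    unfolding hom_eval_def[abs_def] monomial_def
  proof (intro lspan_sum lspan_scale)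
    fix \<alpha> assume "\<alpha> \<in> multi_index (d + 1) n"
    then have "(\<Sum>i=1..d+1. \<alpha> i) = n" by (simp add: multi_index_def)
    then show "(\<lambda>y. \<Prod>i=1..d+1. y i ^ \<alpha> i) \<in> lspan (tail_gens d \<kappa> 1 n)"
      using tail_monomial_span[OF \<kappa>, where j = 1 and \<alpha> = \<alpha>] by simp
  qed
  then obtain b u where "hom_eval (d + 1) n c = R b u" using span by blast
  then show ?thesis using that[of b u] by (simp add: R_def)
qed

text \<open>With tail sums \<open>s\<close> and \<open>t\<close>, the new factor at
  \<open>s = 0\<close> is its diagonal coefficient times a power of \<open>t\<close>, hence nonzero.
  The induction also needs a nonzero tail sum, so \<open>s\<close> is moved slightly away from 0 by
  continuity.\<close>

lemma tail_jacobi_nonzero: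
  assumes \<kappa>: "\<forall>i\<in>{1..d+1}. \<kappa> i > -1"
  shows "j \<le> d + 1 \<Longrightarrow> 1 \<le> j \<Longrightarrow> \<exists>y. tail_jacobi d \<kappa> \<nu> j y \<noteq> 0 \<and> (\<Sum>l=j..d+1. y l) \<noteq> 0"
proof (induction j rule: inc_induct)
  case base
  show ?case by (intro exI[of _ "\<lambda>_. 1"]) (simp add: tail_jacobi_def)
next
  case (step j)
  then have j: "1 \<le> j" "j \<le> d" by auto
  obtain y where y: "tail_jacobi d \<kappa> \<nu> (Suc j) y \<noteq> 0" and t: "(\<Sum>l=Suc j..d+1. y l) \<noteq> 0"
    using step by auto
  define t where "t = (\<Sum>l=Suc j..d+1. y l)"
  define a where "a = jacobi_param d \<kappa> \<nu> j"
  define J where "J s = jacobi_homogenized (\<nu> j) a (\<kappa> j) s (s - t)" for s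
  have "J 0 = jacobi_coeff (\<nu> j) a (\<kappa> j) (\<nu> j) * t ^ \<nu> j"
    unfolding J_def jacobi_homogenized_coeff lessThan_Suc_atMost[symmetric] by (simp add: power_0_left)
  moreover have "jacobi_coeff (\<nu> j) a (\<kappa> j) (\<nu> j) \<noteq> 0"
    unfolding a_def
    by (rule jacobi_coeff_diag_nonzero[OF jacobi_param_gt[OF \<kappa> j(2)] bspec[OF \<kappa>]]) (use j in auto)
  ultimately have "J 0 \<noteq> 0" using t by (simp add: t_def)
  moreover have "isCont J 0" unfolding J_def jacobi_homogenized_def by (intro continuous_intros)
  ultimately have "eventually (\<lambda>s. J s \<noteq> 0) (at 0)"
    by (simp add: isCont_def tendsto_imp_eventually_ne)
  then have "eventually (\<lambda>s. J s \<noteq> 0 \<and> s \<noteq> 0) (at 0)"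
    by (simp add: eventually_at_filter)
  then obtain s where s: "J s \<noteq> 0" "s \<noteq> 0"
    using eventually_happens[of _ "at (0::real)"] by auto
  define z where "z = y(j := s - t)"
  have sum: "(\<Sum>l=i..d+1. z l) = (\<Sum>l=i..d+1. y l)" if "i > j" for i
    unfolding z_def using that by (intro sum.cong) auto
  have "(\<Sum>l=j..d+1. z l) = z j + (\<Sum>l=Suc j..d+1. z l)"
    using j by (intro sum.atLeast_Suc_atMost) simp
  then have sumj: "(\<Sum>l=j..d+1. z l) = s" by (simp only: sum[of "Suc j"] lessI) (simp add: z_def t_def)
  have "tail_jacobi d \<kappa> \<nu> (Suc j) z = tail_jacobi d \<kappa> \<nu> (Suc j) y"
    unfolding tail_jacobi_def
  proof (rule prod.cong)
    fix i assume "i \<in> {Suc j..d}"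
    then have "i > j" by simp
    then show "jacobi_homogenized (\<nu> i) (jacobi_param d \<kappa> \<nu> i) (\<kappa> i) (\<Sum>l=i..d+1. z l) (z i) =
        jacobi_homogenized (\<nu> i) (jacobi_param d \<kappa> \<nu> i) (\<kappa> i) (\<Sum>l=i..d+1. y l) (y i)"
      by (simp only: sum) (simp add: z_def)
  qed simp
  then have "tail_jacobi d \<kappa> \<nu> j z = J s * tail_jacobi d \<kappa> \<nu> (Suc j) y"
    unfolding tail_jacobi_step[OF j(2)] sumj by (simp add: J_def z_def a_def)
  then show ?case using s y sumj by (intro exI[of _ z]) simp
qed

section \<open>Hahn polynomials and the monic basis\<close>

lemma hom_eval_homogeneous: "hom_eval m n c (\<lambda>i. s * y i) = s ^ n * hom_eval m n c y"
  unfolding hom_eval_def sum_distrib_left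
proof (rule sum.cong)
  fix \<alpha> assume "\<alpha> \<in> multi_index m n"
  then have "(\<Prod>i=1..m. s ^ \<alpha> i) = s ^ n"
    by (simp add: multi_index_def flip: power_sum)
  then show "c \<alpha> * monomial m (\<lambda>i. s * y i) \<alpha> = s ^ n * (c \<alpha> * monomial m y \<alpha>)"
    by (simp add: monomial_def power_mult_distrib prod.distrib)
qed simp

lemma simplex_jacobi_hom_eval:
  assumes "\<nu> \<in> multi_index d n"
  shows "simplex_jacobi d \<kappa> \<nu> x = hom_eval (d + 1) n (tail_coeff d \<kappa> \<nu> 1) (barycentric d x)"
proof -
  have "hom_eval (d + 1) n (tail_coeff d \<kappa> \<nu> 1) (barycentric d x) = tail_jacobi d \<kappa> \<nu> 1 (barycentric d x)"
    using hom_eval_tail_coeff[of 1 d \<nu> \<kappa>] assms by (simp add: multi_index_def)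
  also have "\<dots> = simplex_jacobi d \<kappa> \<nu> x"
    unfolding tail_jacobi_def simplex_jacobi_def
  proof (rule prod.cong)
    fix j assume j: "j \<in> {1..d}"
    have "{1..d+1} = {1..<j} \<union> {j..d+1}" using j by auto
    then have "(\<Sum>i=1..d+1. barycentric d x i) = (\<Sum>i=1..<j. barycentric d x i) + (\<Sum>i=j..d+1. barycentric d x i)"
      by (simp only:) (rule sum.union_disjoint; auto)
    then have "(\<Sum>i=1..<j. barycentric d x i) + (\<Sum>i=j..d+1. barycentric d x i) = 1"
      by (simp only: sum_barycentric)
    moreover have "(\<Sum>i=1..<j. barycentric d x i) = (\<Sum>i=1..<j. x i)"
      using j by (intro sum.cong) (auto simp: barycentric_def)
    ultimately have "(\<Sum>i=j..d+1. barycentric d x i) = 1 - (\<Sum>i=1..<j. x i)" by simp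
    moreover have "barycentric d x j = x j" using j by (simp add: barycentric_def)
    ultimately show "jacobi_homogenized (\<nu> j) (jacobi_param d \<kappa> \<nu> j) (\<kappa> j) (\<Sum>l=j..d+1. barycentric d x l) (barycentric d x j) =
      jacobi_homogenized (\<nu> j) (jacobi_param d \<kappa> \<nu> j) (\<kappa> j) (1 - (\<Sum>i=1..<j. x i)) (x j)"
      by (simp only:)
  qed simp
  finally show ?thesis by simp
qed

lemma simplex_jacobi_homogenized:
  assumes \<nu>: "\<nu> \<in> multi_index d n" and s: "(\<Sum>i=1..d+1. y i) \<noteq> 0"
  shows "(\<Sum>i=1..d+1. y i) ^ n * simplex_jacobi d \<kappa> \<nu> (\<lambda>i. y i / (\<Sum>j=1..d+1. y j)) =
    hom_eval (d + 1) n (tail_coeff d \<kappa> \<nu> 1) y"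
proof -
  define t where "t = (\<Sum>i=1..d+1. y i)"
  have t: "t \<noteq> 0" "t = (\<Sum>i=1..d. y i) + y (d + 1)" using s by (auto simp: t_def)
  have "(\<Sum>i=1..d. y i / t) = (t - y (d + 1)) / t"
    unfolding sum_divide_distrib[symmetric] using t(2) by simp
  then have b: "barycentric d (\<lambda>i. y i / t) i = y i / t" for i
    using t(1) by (simp add: barycentric_def diff_divide_distrib)
  have "t ^ n * simplex_jacobi d \<kappa> \<nu> (\<lambda>i. y i / t) = hom_eval (d + 1) n (tail_coeff d \<kappa> \<nu> 1) (\<lambda>i. t * (y i / t))"
    unfolding simplex_jacobi_hom_eval[OF \<nu>] hom_eval_homogeneous b[abs_def] ..
  then show ?thesis using t(1) by (simp add: t_def)
qed

text \<open>Homogenizing the Jacobi polynomial gives the form with coefficients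
  \<open>tail_coeff\<close>, so these, rescaled by the multinomial factor, are candidates; they are
  the only ones because a form vanishing where \<open>|y|\<close> is nonzero has zero
  coefficients.\<close>

lemma hahn_eq:
  assumes \<nu>: "\<nu> \<in> multi_index d n" and \<alpha>: "\<alpha> \<in> multi_index (d + 1) n"
  shows "hahn d \<nu> \<kappa> n \<alpha> = multi_fact (d + 1) \<alpha> / fact n * tail_coeff d \<kappa> \<nu> 1 \<alpha>"
proof -
  let ?C = "tail_coeff d \<kappa> \<nu> 1"
  define h where "h \<alpha> = (if \<alpha> \<in> multi_index (d + 1) n then multi_fact (d + 1) \<alpha> / fact n * ?C \<alpha> else 0)" for \<alpha>
  have mf: "multi_fact (d + 1) \<alpha> \<noteq> 0" for \<alpha> using multi_fact_pos[of "d+1" \<alpha>] by simp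
  have "hahn d \<nu> \<kappa> n = h"
    unfolding hahn_def
  proof (rule the_equality, intro conjI allI impI)
    fix y :: "nat \<Rightarrow> real" assume y: "(\<Sum>i=1..d+1. y i) \<noteq> 0"
    show "(\<Sum>i=1..d+1. y i) ^ n * simplex_jacobi d \<kappa> \<nu> (\<lambda>i. y i / (\<Sum>j=1..d+1. y j)) =
       (\<Sum>\<alpha>\<in>multi_index (d + 1) n. fact n / multi_fact (d + 1) \<alpha> * h \<alpha> * monomial (d + 1) y \<alpha>)"
      unfolding simplex_jacobi_homogenized[OF \<nu> y] hom_eval_def
      by (intro sum.cong) (auto simp: h_def mf[simplified])
  next
    fix g
    assume g: "(\<forall>\<alpha>. \<alpha> \<notin> multi_index (d + 1) n \<longrightarrow> g \<alpha> = 0) \<and>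
        (\<forall>y. (\<Sum>i=1..d+1. y i) \<noteq> 0 \<longrightarrow>
           (\<Sum>i=1..d+1. y i) ^ n * simplex_jacobi d \<kappa> \<nu> (\<lambda>i. y i / (\<Sum>j=1..d+1. y j)) =
           (\<Sum>\<alpha>\<in>multi_index (d + 1) n. fact n / multi_fact (d + 1) \<alpha> * g \<alpha> * monomial (d + 1) y \<alpha>))"
    have "?C \<alpha> + (-1) * (fact n / multi_fact (d + 1) \<alpha> * g \<alpha>) = 0" if "\<alpha> \<in> multi_index (d + 1) n" for \<alpha>
    proof (rule hom_eval_eq_0_imp[OF _ _ that])
      fix y :: "nat \<Rightarrow> real" assume y: "(\<Sum>i=1..d+1. y i) \<noteq> 0"
      have "hom_eval (d + 1) n ?C y = hom_eval (d + 1) n (\<lambda>\<alpha>. fact n / multi_fact (d + 1) \<alpha> * g \<alpha>) y"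
        using trans[OF sym[OF simplex_jacobi_homogenized[OF \<nu> y]] g[THEN conjunct2, rule_format, OF y]]
        by (simp only: hom_eval_def)
      then show "hom_eval (d + 1) n (\<lambda>\<alpha>. ?C \<alpha> + (-1) * (fact n / multi_fact (d + 1) \<alpha> * g \<alpha>)) y = 0"
        by (simp only: hom_eval_add hom_eval_scale)
    qed simp
    then have "g \<alpha> = h \<alpha>" for \<alpha>
      using g mf[of \<alpha>] by (cases "\<alpha> \<in> multi_index (d + 1) n") (auto simp: h_def field_simps)
    then show "g = h" ..
  qed (simp add: h_def)
  then show ?thesis using \<alpha> by (simp add: h_def)
qed

text \<open>Each Hahn value carries a factor \<open>\<alpha>! / n!\<close>; its square times
  \<open>1 / \<alpha>!\<close> leaves the factorial part of the weight of F.\<close>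

lemma hahn_norm_sq_eq:
  assumes "\<nu> \<in> multi_index d n"
  shows "hahn_norm_sq d \<nu> \<kappa> n = fischer (d + 1) \<kappa> n (tail_coeff d \<kappa> \<nu> 1) (tail_coeff d \<kappa> \<nu> 1) /
    (fact n * pochhammer ((\<Sum>i=1..d+1. \<kappa> i) + real d + 1) n)"
proof -
  let ?C = "tail_coeff d \<kappa> \<nu> 1"
  have "(\<Sum>\<alpha>\<in>multi_index (d + 1) n. (hahn d \<nu> \<kappa> n \<alpha>)\<^sup>2 * multi_pochhammer (d + 1) (\<lambda>i. \<kappa> i + 1) \<alpha> /
        multi_fact (d + 1) \<alpha>) = fischer (d + 1) \<kappa> n ?C ?C / (fact n)\<^sup>2"
    unfolding fischer_def sum_divide_distrib
  proof (rule sum.cong)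
    fix \<alpha> assume \<alpha>: "\<alpha> \<in> multi_index (d + 1) n"
    show "(hahn d \<nu> \<kappa> n \<alpha>)\<^sup>2 * multi_pochhammer (d + 1) (\<lambda>i. \<kappa> i + 1) \<alpha> / multi_fact (d + 1) \<alpha> =
      multi_fact (d + 1) \<alpha> * multi_pochhammer (d + 1) (\<lambda>i. \<kappa> i + 1) \<alpha> * ?C \<alpha> * ?C \<alpha> / (fact n)\<^sup>2"
      unfolding hahn_eq[OF assms \<alpha>] using multi_fact_pos[of "d+1" \<alpha>]
      by (simp add: power2_eq_square)
  qed simp
  then show ?thesis
    unfolding hahn_norm_sq_def by (simp add: power2_eq_square)
qed

section \<open>The integral inner product on harmonic forms\<close>

lemma jacobi_inner_harmonic:
  assumes \<kappa>: "\<forall>i\<in>{1..d+1}. \<kappa> i > -1"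
    and f: "\<And>x. f x = hom_eval (d + 1) n u (barycentric d x)"
    and g: "\<And>x. g x = hom_eval (d + 1) n v (barycentric d x)" and v: "Lap \<kappa> {1..d+1} v = (\<lambda>_. 0)"
  shows "jacobi_inner d \<kappa> f g =
    fischer (d + 1) \<kappa> n u v / pochhammer ((\<Sum>i=1..d+1. \<kappa> i) + real d + 1) (n + n)"
  unfolding jacobi_inner_hom_eval[OF \<kappa> f g] fischer_eq_moments[OF v] ..

lemma jacobi_inner_commute: "jacobi_inner d \<kappa> f g = jacobi_inner d \<kappa> g f"
  by (simp add: jacobi_inner_def mult.commute[of "f _"])

lemma jacobi_inner_diff:
  assumes \<kappa>: "\<forall>i\<in>{1..d+1}. \<kappa> i > -1"
    and "f \<in> polys_below d (Suc n)" "g \<in> polys_below d (Suc n)" "h \<in> polys_below d (Suc n)"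
  shows "jacobi_inner d \<kappa> (\<lambda>x. f x - g x) h = jacobi_inner d \<kappa> f h - jacobi_inner d \<kappa> g h"
proof -
  obtain u v w where f: "\<And>x. f x = hom_eval (d + 1) n u (barycentric d x)"
    and g: "\<And>x. g x = hom_eval (d + 1) n v (barycentric d x)"
    and h: "\<And>x. h x = hom_eval (d + 1) n w (barycentric d x)"
    using assms(2-4) by (metis polys_below_as_barycentric)
  have fg: "f x - g x = hom_eval (d + 1) n (\<lambda>\<alpha>. u \<alpha> - v \<alpha>) (barycentric d x)" for x
    unfolding f g hom_eval_def by (simp add: left_diff_distrib sum_subtractf)
  show ?thesis
    unfolding jacobi_inner_hom_eval[OF \<kappa> f h] jacobi_inner_hom_eval[OF \<kappa> g h] jacobi_inner_hom_eval[OF \<kappa> fg h]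
    by (simp add: left_diff_distrib sum_subtractf diff_divide_distrib)
qed

lemma orth_polys_diff:
  assumes \<kappa>: "\<forall>i\<in>{1..d+1}. \<kappa> i > -1" and "f \<in> orth_polys d \<kappa> n" "g \<in> orth_polys d \<kappa> n"
  shows "(\<lambda>x. f x - g x) \<in> orth_polys d \<kappa> n"
  unfolding orth_polys_def mem_Collect_eq
proof (intro conjI ballI)
  show "(\<lambda>x. f x - g x) \<in> polys_below d (Suc n)"
    using assms by (intro polys_below_diff) (auto simp: orth_polys_def)
  fix h assume h: "h \<in> polys_below d n"
  have "jacobi_inner d \<kappa> (\<lambda>x. f x - g x) h = jacobi_inner d \<kappa> f h - jacobi_inner d \<kappa> g h"
    using assms h by (intro jacobi_inner_diff[OF \<kappa>, where n=n]) (auto simp: orth_polys_def intro: polys_below_Suc_mono)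
  then show "jacobi_inner d \<kappa> (\<lambda>x. f x - g x) h = 0" using assms h by (simp add: orth_polys_def)
qed

lemma orth_polys_scale: "f \<in> orth_polys d \<kappa> n \<Longrightarrow> (\<lambda>x. a * f x) \<in> orth_polys d \<kappa> n"
  by (auto simp: orth_polys_def jacobi_inner_def mult.assoc intro: polys_below_scale)

lemma orth_polys_zero: "(\<lambda>_. 0) \<in> orth_polys d \<kappa> n"
  by (auto simp: orth_polys_def jacobi_inner_def intro: polys_below_zero)

lemma orth_polys_sum:
  assumes \<kappa>: "\<forall>i\<in>{1..d+1}. \<kappa> i > -1" and f: "\<And>i. i \<in> A \<Longrightarrow> f i \<in> orth_polys d \<kappa> n"
  shows "(\<lambda>x. \<Sum>i\<in>A. f i x) \<in> orth_polys d \<kappa> n"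
  using f
proof (induction A rule: infinite_finite_induct)
  case (insert i A)
  have "(\<lambda>x. f i x - (-1) * (\<Sum>i\<in>A. f i x)) \<in> orth_polys d \<kappa> n"
    by (intro orth_polys_diff orth_polys_scale \<kappa> insert) auto
  then show ?case using insert by simp
qed (simp_all add: orth_polys_zero)

text \<open>A polynomial of lower degree is homogenized to degree \<open>n\<close> with at least one
  factor \<open>|y|\<close>. Moving that factor to the other side of F turns it into the operator
  that kills \<open>v\<close>.\<close>

lemma harmonic_orth_polys:
  assumes \<kappa>: "\<forall>i\<in>{1..d+1}. \<kappa> i > -1" and v: "Lap \<kappa> {1..d+1} v = (\<lambda>_. 0)"
  shows "(\<lambda>x. hom_eval (d + 1) n v (barycentric d x)) \<in> orth_polys d \<kappa> n"
  unfolding orth_polys_def mem_Collect_eq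
proof (intro conjI ballI hom_eval_barycentric_polys_below)
  fix g assume g: "g \<in> polys_below d n"
  let ?f = "\<lambda>x. hom_eval (d + 1) n v (barycentric d x)"
  show "jacobi_inner d \<kappa> ?f g = 0"
  proof (cases n)
    case 0
    with g have "g = (\<lambda>_. 0)" by (auto simp: polys_below_def)
    then show ?thesis by (simp add: jacobi_inner_def)
  next
    case (Suc n')
    obtain w where w: "\<And>x. g x = hom_eval (d + 1) n' w (barycentric d x)"
      using g unfolding Suc by (rule polys_below_as_barycentric) blast
    have "g x = hom_eval (d + 1) n (shifts {1..d+1} w) (barycentric d x)" for x
      unfolding w Suc by (rule hom_eval_shifts_barycentric[symmetric])
    then have "jacobi_inner d \<kappa> g ?f =
        fischer (d + 1) \<kappa> n (shifts {1..d+1} w) v / pochhammer ((\<Sum>i=1..d+1. \<kappa> i) + real d + 1) (n + n)"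
      by (intro jacobi_inner_harmonic[OF \<kappa> _ refl v])
    also have "fischer (d + 1) \<kappa> n (shifts {1..d+1} w) v = fischer (d + 1) \<kappa> n' (Lap \<kappa> {1..d+1} v) w"
      unfolding Suc by (subst fischer_commute) (rule fischer_shifts[OF order.refl])
    also have "\<dots> = 0" unfolding v by (simp add: fischer_def)
    finally show ?thesis by (simp add: jacobi_inner_commute)
  qed
qed

lemma hom_eval_shifts_polys_below:
  "(\<lambda>x. hom_eval (d + 1) n (shifts {1..d+1} u) (barycentric d x)) \<in> polys_below d n"
proof (cases n)
  case 0
  have "hom_eval (d + 1) 0 (shifts {1..d+1} u) y = 0" for y
    unfolding shifts_def[abs_def] hom_eval_sum by (intro sum.neutral ballI hom_eval_shift_0)
  then show ?thesis using 0 polys_below_zero by simp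
next
  case (Suc n')
  then show ?thesis
    unfolding Suc hom_eval_shifts_barycentric by (intro hom_eval_barycentric_polys_below)
qed

lemma pochhammer_total_pos:
  assumes "\<forall>i\<in>{1..d+1}. \<kappa> i > -1"
  shows "pochhammer ((\<Sum>i=1..d+1. \<kappa> i) + real d + 1) n > 0"
proof (rule pochhammer_pos)
  have "(\<Sum>i=1..d+1. \<kappa> i + 1) > 0" by (rule tail_sum_pos) (use assms in auto)
  then show "(\<Sum>i=1..d+1. \<kappa> i) + real d + 1 > 0" by (simp add: sum.distrib)
qed

lemma Lap_combination_tail_coeff:
  assumes \<kappa>: "\<forall>i\<in>{1..d+1}. \<kappa> i > -1"
  shows "Lap \<kappa> {1..d+1} (\<lambda>\<alpha>. \<Sum>\<nu>\<in>A. b \<nu> * tail_coeff d \<kappa> \<nu> 1 \<alpha>) = (\<lambda>_. 0)"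
proof -
  have "Lap \<kappa> {1..d+1} (tail_coeff d \<kappa> \<nu> 1) = (\<lambda>_. 0)" for \<nu>
    by (rule Lap_tail_coeff[OF \<kappa>]) auto
  then show ?thesis unfolding Lap_sum Lap_scale by simp
qed

text \<open>The top harmonic part \<open>P\<close> is orthogonal to the remainder and, by
  hypothesis, to \<open>f\<close>; hence it is orthogonal to itself. Positivity of F removes it, and
  the remainder has lower degree.\<close>

lemma self_orthogonal_polys_below:
  assumes \<kappa>: "\<forall>i\<in>{1..d+1}. \<kappa> i > -1"
  shows "f \<in> polys_below d n \<Longrightarrow> (\<And>g. g \<in> polys_below d n \<Longrightarrow> jacobi_inner d \<kappa> f g = 0) \<Longrightarrow> f x = 0"
proof (induction n arbitrary: f x)
  case 0
  then show ?case by (auto simp: polys_below_def)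
next
  case (Suc n)
  obtain c where c: "\<And>x. f x = hom_eval (d + 1) n c (barycentric d x)"
    using Suc.prems(1) by (rule polys_below_as_barycentric) blast
  obtain b u where bu: "\<And>y. hom_eval (d + 1) n c y =
    (\<Sum>\<nu>\<in>multi_index d n. b \<nu> * hom_eval (d + 1) n (tail_coeff d \<kappa> \<nu> 1) y) +
    hom_eval (d + 1) n (shifts {1..d+1} u) y"
    using hom_eval_decomposition[OF \<kappa>, where n = n and c = c] by blast
  define v where "v = (\<lambda>\<alpha>. \<Sum>\<nu>\<in>multi_index d n. b \<nu> * tail_coeff d \<kappa> \<nu> 1 \<alpha>)"
  have Lv: "Lap \<kappa> {1..d+1} v = (\<lambda>_. 0)"
    unfolding v_def by (rule Lap_combination_tail_coeff[OF \<kappa>])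
  define P where "P x = hom_eval (d + 1) n v (barycentric d x)" for x
  define g where "g x = hom_eval (d + 1) n (shifts {1..d+1} u) (barycentric d x)" for x
  have f: "f x = P x + g x" for x
    unfolding c bu P_def g_def v_def hom_eval_sum hom_eval_scale ..
  have P: "P \<in> orth_polys d \<kappa> n" unfolding P_def by (rule harmonic_orth_polys[OF \<kappa> Lv])
  have g: "g \<in> polys_below d n" unfolding g_def by (rule hom_eval_shifts_polys_below)
  have P': "P \<in> polys_below d (Suc n)" using P by (simp add: orth_polys_def)
  have "jacobi_inner d \<kappa> (\<lambda>x. f x - g x) P = jacobi_inner d \<kappa> f P - jacobi_inner d \<kappa> g P"
    by (rule jacobi_inner_diff[OF \<kappa> Suc.prems(1) polys_below_Suc_mono[OF g] P'])
  also have "\<dots> = 0"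
    using Suc.prems(2)[OF P'] P g by (simp add: jacobi_inner_commute[of d \<kappa> g] orth_polys_def)
  also have "(\<lambda>x. f x - g x) = P" by (simp add: f)
  finally have "fischer (d + 1) \<kappa> n v v = 0"
    using jacobi_inner_harmonic[OF \<kappa> P_def P_def Lv] pochhammer_total_pos[OF \<kappa>, of "n + n"] by simp
  then have "v \<alpha> = 0" if "\<alpha> \<in> multi_index (d + 1) n" for \<alpha>
    using fischer_pos_def[of "d + 1" \<kappa> n v \<alpha>] \<kappa> that by blast
  then have "P x = 0" for x by (simp add: P_def hom_eval_def)
  then have "f = g" by (simp add: f fun_eq_iff)
  then show ?case
    using Suc.IH[OF g] Suc.prems(2) polys_below_Suc_mono by blast
qed

lemma orth_polys_below_eq_0:
  assumes "\<forall>i\<in>{1..d+1}. \<kappa> i > -1" "f \<in> orth_polys d \<kappa> n" "f \<in> polys_below d n"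
  shows "f x = 0"
  using self_orthogonal_polys_below[OF assms(1,3)] assms(2) by (auto simp: orth_polys_def)

lemma fischer_tail_coeff_nonzero:
  assumes \<kappa>: "\<forall>i\<in>{1..d+1}. \<kappa> i > -1" and \<nu>: "\<nu> \<in> multi_index d n"
  shows "fischer (d + 1) \<kappa> n (tail_coeff d \<kappa> \<nu> 1) (tail_coeff d \<kappa> \<nu> 1) \<noteq> 0"
proof
  assume *: "fischer (d + 1) \<kappa> n (tail_coeff d \<kappa> \<nu> 1) (tail_coeff d \<kappa> \<nu> 1) = 0"
  have "tail_coeff d \<kappa> \<nu> 1 \<alpha> = 0" if "\<alpha> \<in> multi_index (d + 1) n" for \<alpha>
    using fischer_pos_def[of "d + 1" \<kappa> n "tail_coeff d \<kappa> \<nu> 1" \<alpha>] \<kappa> that * by blast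
  then have "hom_eval (d + 1) n (tail_coeff d \<kappa> \<nu> 1) y = 0" for y by (simp add: hom_eval_def)
  then have "tail_jacobi d \<kappa> \<nu> 1 y = 0" for y
    using hom_eval_tail_coeff[of 1 d \<nu> \<kappa> y] \<nu> by (simp add: multi_index_def)
  then show False using tail_jacobi_nonzero[OF \<kappa>, where j = 1 and \<nu> = \<nu>] by auto
qed

section \<open>The monic polynomials and the two expansions\<close>

text \<open>Two candidates share their leading term, so their difference is of lower degree and
  orthogonal to all polynomials of lower degree, itself included.\<close>

lemma simplex_monic_eqI:
  assumes \<kappa>: "\<forall>i\<in>{1..d+1}. \<kappa> i > -1" and \<alpha>: "\<alpha> \<in> multi_index (d + 1) n"
    and f: "f \<in> orth_polys d \<kappa> n" and q: "q \<in> polys_below d n"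
    and fq: "\<And>x. f x = monomial (d + 1) (barycentric d x) \<alpha> + q x"
  shows "simplex_monic d \<kappa> \<alpha> = f"
proof -
  have n: "(\<Sum>i=1..d+1. \<alpha> i) = n" using \<alpha> by (simp add: multi_index_def)
  show ?thesis
    unfolding simplex_monic_def n
  proof (rule the_equality)
    show "f \<in> orth_polys d \<kappa> n \<and> (\<exists>q\<in>polys_below d n. \<forall>x. f x = monomial (d + 1) (barycentric d x) \<alpha> + q x)"
      using f q fq by blast
    fix g assume g: "g \<in> orth_polys d \<kappa> n \<and> (\<exists>q\<in>polys_below d n. \<forall>x. g x = monomial (d + 1) (barycentric d x) \<alpha> + q x)"
    then obtain r where r: "r \<in> polys_below d n" "\<And>x. g x = monomial (d + 1) (barycentric d x) \<alpha> + r x" by blast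
    have "(\<lambda>x. g x - f x) = (\<lambda>x. r x - q x)" by (simp add: r fq)
    then have "(\<lambda>x. g x - f x) \<in> polys_below d n"
      using polys_below_diff[OF r(1) q] by simp
    moreover have "(\<lambda>x. g x - f x) \<in> orth_polys d \<kappa> n"
      using g f by (intro orth_polys_diff[OF \<kappa>]) auto
    ultimately have "g x - f x = 0" for x
      by (intro orth_polys_below_eq_0[OF \<kappa>])
    then show "g = f" by (simp add: fun_eq_iff)
  qed
qed

lemma simplex_monic_expansion:
  assumes \<kappa>: "\<forall>i\<in>{1..d+1}. \<kappa> i > -1" and \<alpha>: "\<alpha> \<in> multi_index (d + 1) n"
  obtains b q where "simplex_monic d \<kappa> \<alpha> \<in> orth_polys d \<kappa> n" "q \<in> polys_below d n"
    "\<And>x. simplex_monic d \<kappa> \<alpha> x = monomial (d + 1) (barycentric d x) \<alpha> + q x"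
    "\<And>x. simplex_monic d \<kappa> \<alpha> x = (\<Sum>\<nu>\<in>multi_index d n. b \<nu> * simplex_jacobi d \<kappa> \<nu> x)"
    "\<And>\<mu>. \<mu> \<in> multi_index d n \<Longrightarrow>
      multi_fact (d + 1) \<alpha> * multi_pochhammer (d + 1) (\<lambda>i. \<kappa> i + 1) \<alpha> * tail_coeff d \<kappa> \<mu> 1 \<alpha> =
      b \<mu> * fischer (d + 1) \<kappa> n (tail_coeff d \<kappa> \<mu> 1) (tail_coeff d \<kappa> \<mu> 1)"
proof -
  let ?C = "\<lambda>\<nu>. tail_coeff d \<kappa> \<nu> 1" and ?S = "shifts {1..d+1}"
  define \<delta> where "\<delta> = (\<lambda>\<beta>. if \<beta> = \<alpha> then 1 else 0 :: real)"
  have mono: "hom_eval (d + 1) n \<delta> y = monomial (d + 1) y \<alpha>" for y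
    unfolding hom_eval_def \<delta>_def using \<alpha> finite_multi_index[of "d + 1" n]
    by (simp add: if_distrib[of "\<lambda>t. t * _"] sum.delta cong: if_cong)
  obtain b u where bu: "\<And>y. hom_eval (d + 1) n \<delta> y =
    (\<Sum>\<nu>\<in>multi_index d n. b \<nu> * hom_eval (d + 1) n (?C \<nu>) y) + hom_eval (d + 1) n (?S u) y"
    using hom_eval_decomposition[OF \<kappa>, where n = n and c = \<delta>] by blast
  define f where "f x = (\<Sum>\<nu>\<in>multi_index d n. b \<nu> * simplex_jacobi d \<kappa> \<nu> x)" for x
  \<comment> \<open>The part of \<open>y^\<alpha>\<close> divisible by \<open>|y|\<close> drops in
    degree at barycentric coordinates; with its sign reversed it is the lower-order
    correction.\<close>
  define q where "q x = -1 * hom_eval (d + 1) n (?S u) (barycentric d x)" for x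
  have Lb: "Lap \<kappa> {1..d+1} (\<lambda>\<alpha>. \<Sum>\<nu>\<in>multi_index d n. b \<nu> * ?C \<nu> \<alpha>) = (\<lambda>_. 0)"
    by (rule Lap_combination_tail_coeff[OF \<kappa>])
  have f_eq: "f = (\<lambda>x. hom_eval (d + 1) n (\<lambda>\<alpha>. \<Sum>\<nu>\<in>multi_index d n. b \<nu> * ?C \<nu> \<alpha>) (barycentric d x))"
    unfolding f_def hom_eval_sum hom_eval_scale
    by (intro ext sum.cong refl) (simp only: simplex_jacobi_hom_eval)
  have f: "f \<in> orth_polys d \<kappa> n"
    unfolding f_eq by (rule harmonic_orth_polys[OF \<kappa> Lb])
  have q: "q \<in> polys_below d n"
    unfolding q_def by (intro polys_below_scale hom_eval_shifts_polys_below)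
  have fq: "f x = monomial (d + 1) (barycentric d x) \<alpha> + q x" for x
    unfolding mono[symmetric] bu q_def f_def by (simp add: simplex_jacobi_hom_eval)
  have R: "simplex_monic d \<kappa> \<alpha> = f" by (rule simplex_monic_eqI[OF \<kappa> \<alpha> f q fq])
  have \<delta>: "\<delta> \<beta> = (\<Sum>\<nu>\<in>multi_index d n. b \<nu> * ?C \<nu> \<beta>) + ?S u \<beta>" if "\<beta> \<in> multi_index (d + 1) n" for \<beta>
  proof -
    have "\<delta> \<beta> + (-1) * ((\<Sum>\<nu>\<in>multi_index d n. b \<nu> * ?C \<nu> \<beta>) + ?S u \<beta>) = 0"
      by (rule hom_eval_eq_0_imp[OF _ _ that])
         (simp_all only: hom_eval_add hom_eval_scale hom_eval_sum bu, simp_all)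
    then show ?thesis by simp
  qed
  have b: "multi_fact (d + 1) \<alpha> * multi_pochhammer (d + 1) (\<lambda>i. \<kappa> i + 1) \<alpha> * ?C \<mu> \<alpha> =
      b \<mu> * fischer (d + 1) \<kappa> n (?C \<mu>) (?C \<mu>)" if \<mu>: "\<mu> \<in> multi_index d n" for \<mu>
  proof -
    let ?F = "fischer (d + 1) \<kappa> n"
    have "multi_fact (d + 1) \<alpha> * multi_pochhammer (d + 1) (\<lambda>i. \<kappa> i + 1) \<alpha> * ?C \<mu> \<alpha> = ?F (?C \<mu>) \<delta>"
      unfolding fischer_def \<delta>_def using \<alpha> finite_multi_index[of "d + 1" n]
      by (simp add: if_distrib[of "\<lambda>t. _ * t"] sum.delta cong: if_cong)
    also have "\<dots> = ?F (?C \<mu>) (\<lambda>\<beta>. (\<Sum>\<nu>\<in>multi_index d n. b \<nu> * ?C \<nu> \<beta>) + ?S u \<beta>)"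
      by (rule fischer_cong) (simp_all only: \<delta>)
    also have "\<dots> = (\<Sum>\<nu>\<in>multi_index d n. b \<nu> * ?F (?C \<mu>) (?C \<nu>)) + ?F (?C \<mu>) (?S u)"
      unfolding fischer_add fischer_sum fischer_scale ..
    \<comment> \<open>Adjointness replaces the factor \<open>|y|\<close> by the operator that kills
      \<open>?C \<mu>\<close>; degree 0 admits no such factor and is treated separately.\<close>
    also have "?F (?C \<mu>) (?S u) = 0"
    proof (cases n)
      case 0
      then show ?thesis by (simp only: fischer_shifts_0[OF order.refl])
    next
      case (Suc n')
      have "Lap \<kappa> {1..d+1} (?C \<mu>) = (\<lambda>_. 0)" by (rule Lap_tail_coeff[OF \<kappa>]) auto
      then show ?thesis unfolding Suc fischer_shifts[OF order.refl] by (simp add: fischer_def)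
    qed
    also have "(\<Sum>\<nu>\<in>multi_index d n. b \<nu> * ?F (?C \<mu>) (?C \<nu>)) = b \<mu> * ?F (?C \<mu>) (?C \<mu>)"
    proof -
      have "(\<Sum>\<nu>\<in>multi_index d n - {\<mu>}. b \<nu> * ?F (?C \<mu>) (?C \<nu>)) = 0"
        by (rule sum.neutral) (use fischer_tail_coeff_orthogonal[OF \<kappa> \<mu>] in auto)
      then show ?thesis using sum.remove[OF finite_multi_index \<mu>, of "\<lambda>\<nu>. b \<nu> * ?F (?C \<mu>) (?C \<nu>)"] by simp
    qed
    finally show ?thesis by simp
  qed
  show ?thesis
    by (rule that[of q b]) (use f q fq b f_def in \<open>simp_all add: R\<close>)
qed

lemma simplex_jacobi_eq_sum_simplex_monic:
  assumes \<kappa>: "\<forall>i\<in>{1..d+1}. \<kappa> i > -1" and \<nu>: "\<nu> \<in> multi_index d n"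
  shows "simplex_jacobi d \<kappa> \<nu> x =
    (\<Sum>\<alpha>\<in>multi_index (d + 1) n. tail_coeff d \<kappa> \<nu> 1 \<alpha> * simplex_monic d \<kappa> \<alpha> x)"
proof -
  let ?C = "tail_coeff d \<kappa> \<nu> 1" and ?R = "simplex_monic d \<kappa>"
  define q where "q \<alpha> x = ?R \<alpha> x - monomial (d + 1) (barycentric d x) \<alpha>" for \<alpha> x
  have q: "q \<alpha> \<in> polys_below d n" and R: "?R \<alpha> \<in> orth_polys d \<kappa> n"
    if \<alpha>: "\<alpha> \<in> multi_index (d + 1) n" for \<alpha>
  proof -
    obtain r where "?R \<alpha> \<in> orth_polys d \<kappa> n" "r \<in> polys_below d n"
      and r: "\<And>x. ?R \<alpha> x = monomial (d + 1) (barycentric d x) \<alpha> + r x"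
      by (rule simplex_monic_expansion[OF \<kappa> \<alpha>]) blast
    moreover have "q \<alpha> = r" by (simp add: q_def r fun_eq_iff)
    ultimately show "q \<alpha> \<in> polys_below d n" "?R \<alpha> \<in> orth_polys d \<kappa> n" by simp_all
  qed
  have P: "simplex_jacobi d \<kappa> \<nu> \<in> orth_polys d \<kappa> n"
  proof -
    have "Lap \<kappa> {1..d+1} ?C = (\<lambda>_. 0)" by (rule Lap_tail_coeff[OF \<kappa>]) auto
    from harmonic_orth_polys[OF \<kappa> this, where n = n] show ?thesis
      by (simp only: simplex_jacobi_hom_eval[OF \<nu>, symmetric])
  qed
  \<comment> \<open>All leading monomials cancel in \<open>D\<close>, leaving only the corrections
    \<open>q \<alpha>\<close>; yet \<open>D\<close> is orthogonal to everything of lower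
    degree.\<close>
  define D where "D x = (\<Sum>\<alpha>\<in>multi_index (d + 1) n. ?C \<alpha> * ?R \<alpha> x) - simplex_jacobi d \<kappa> \<nu> x" for x
  have "D = (\<lambda>x. \<Sum>\<alpha>\<in>multi_index (d + 1) n. ?C \<alpha> * q \<alpha> x)"
    unfolding D_def[abs_def] simplex_jacobi_hom_eval[OF \<nu>] hom_eval_def q_def
    by (simp add: right_diff_distrib sum_subtractf)
  then have "D \<in> polys_below d n"
    using q by (auto intro!: polys_below_sum polys_below_scale)
  moreover have "D \<in> orth_polys d \<kappa> n"
    unfolding D_def[abs_def] by (intro orth_polys_diff orth_polys_sum orth_polys_scale \<kappa> R P)
  ultimately have "D x = 0" by (intro orth_polys_below_eq_0[OF \<kappa>])
  then show ?thesis by (simp add: D_def)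
qed

theorem theorem3p1:
  fixes d n :: nat and \<kappa> :: "nat \<Rightarrow> real"
  assumes "d \<ge> 1"
    and "\<And>i. i \<in> {1..d+1} \<Longrightarrow> \<kappa> i > -1"
  shows "(\<forall>\<nu>\<in>multi_index d n. \<forall>x :: nat \<Rightarrow> real.
            simplex_jacobi d \<kappa> \<nu> x =
            (\<Sum>\<alpha>\<in>multi_index (d + 1) n.
               fact n / multi_fact (d + 1) \<alpha> * hahn d \<nu> \<kappa> n \<alpha> * simplex_monic d \<kappa> \<alpha> x)) \<and>
         (\<forall>\<alpha>\<in>multi_index (d + 1) n. \<forall>x :: nat \<Rightarrow> real.
            simplex_monic d \<kappa> \<alpha> x =
            multi_pochhammer (d + 1) (\<lambda>i. \<kappa> i + 1) \<alpha> /
              pochhammer ((\<Sum>i=1..d+1. \<kappa> i) + real d + 1) n *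
            (\<Sum>\<nu>\<in>multi_index d n.
               hahn d \<nu> \<kappa> n \<alpha> / hahn_norm_sq d \<nu> \<kappa> n * simplex_jacobi d \<kappa> \<nu> x))"
proof (intro conjI ballI allI)
  have \<kappa>: "\<forall>i\<in>{1..d+1}. \<kappa> i > -1" using assms(2) by blast
  let ?C = "\<lambda>\<nu>. tail_coeff d \<kappa> \<nu> 1" and ?R = "simplex_monic d \<kappa>"
  fix x :: "nat \<Rightarrow> real"
  {
    fix \<nu> assume \<nu>: "\<nu> \<in> multi_index d n"
    have coeff: "fact n / multi_fact (d + 1) \<alpha> * hahn d \<nu> \<kappa> n \<alpha> = ?C \<nu> \<alpha>" if "\<alpha> \<in> multi_index (d + 1) n" for \<alpha>
      using multi_fact_pos[of "d + 1" \<alpha>] by (simp add: hahn_eq[OF \<nu> that])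
    show "simplex_jacobi d \<kappa> \<nu> x =
      (\<Sum>\<alpha>\<in>multi_index (d + 1) n. fact n / multi_fact (d + 1) \<alpha> * hahn d \<nu> \<kappa> n \<alpha> * ?R \<alpha> x)"
      unfolding simplex_jacobi_eq_sum_simplex_monic[OF \<kappa> \<nu>] by (intro sum.cong) (simp_all only: coeff)
  }
  fix \<alpha> assume \<alpha>: "\<alpha> \<in> multi_index (d + 1) n"
  define \<sigma> where "\<sigma> = pochhammer ((\<Sum>i=1..d+1. \<kappa> i) + real d + 1) n"
  have \<sigma>: "\<sigma> > 0" unfolding \<sigma>_def by (rule pochhammer_total_pos[OF \<kappa>])
  obtain b where R: "?R \<alpha> x = (\<Sum>\<nu>\<in>multi_index d n. b \<nu> * simplex_jacobi d \<kappa> \<nu> x)"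
    and b: "\<And>\<mu>. \<mu> \<in> multi_index d n \<Longrightarrow>
      multi_fact (d + 1) \<alpha> * multi_pochhammer (d + 1) (\<lambda>i. \<kappa> i + 1) \<alpha> * ?C \<mu> \<alpha> =
      b \<mu> * fischer (d + 1) \<kappa> n (?C \<mu>) (?C \<mu>)"
    by (rule simplex_monic_expansion[OF \<kappa> \<alpha>]) blast+
  \<comment> \<open>The factors \<open>n!\<close> and \<sigma> cancel between the Hahn value and the
    norm, while the \<open>\<alpha>!\<close> of the Hahn value supplies the factorial in the weight
    of F.\<close>
  have "b \<nu> = multi_pochhammer (d + 1) (\<lambda>i. \<kappa> i + 1) \<alpha> / \<sigma> * (hahn d \<nu> \<kappa> n \<alpha> / hahn_norm_sq d \<nu> \<kappa> n)"
    if \<nu>: "\<nu> \<in> multi_index d n" for \<nu>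
    using b[OF \<nu>] fischer_tail_coeff_nonzero[OF \<kappa> \<nu>] \<sigma>
    unfolding hahn_eq[OF \<nu> \<alpha>] hahn_norm_sq_eq[OF \<nu>] \<sigma>_def[symmetric]
    by (simp add: field_simps)
  then show "?R \<alpha> x = multi_pochhammer (d + 1) (\<lambda>i. \<kappa> i + 1) \<alpha> /
      pochhammer ((\<Sum>i=1..d+1. \<kappa> i) + real d + 1) n *
    (\<Sum>\<nu>\<in>multi_index d n. hahn d \<nu> \<kappa> n \<alpha> / hahn_norm_sq d \<nu> \<kappa> n * simplex_jacobi d \<kappa> \<nu> x)"
    unfolding R \<sigma>_def[symmetric] sum_distrib_left by (intro sum.cong) (simp_all add: mult.assoc)
qed

end
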